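(* Let $\Phi(n)=\sum_{k=1}^n\phi(k)$, where $\phi$ is Euler's totient function. With an optimal parameter selection of $$a=\Theta\left(\left(\frac{n}{\ln(\ln(n))}\right)^{2/3}\right),$$ Algorithm A described in the context (which takes as input any integer $n\ge1$) computes $\Phi(n)$ in $\Theta\left(n^{1/3}\cdot(\ln(\ln(n)))^{2/3}\right)$ space and $\Theta\left(n^{2/3}\cdot(\ln(\ln(n)))^{1/3}\right)$ time. Here "optimal" means that no choice of the parameter $a$ gives an asymptotically smaller running time.
   Context: Time counts arithmetic operations and space counts integers stored (not bit operations or bits). $\widetilde\Theta$ and $\widetilde O$ are $\Theta$ and $O$ up to logarithmic factors. $\mu$ is the Möbius function. Algorithm A. Input: an integer $n\ge1$. Write $r=\lfloor\sqrt n\rfloor$. The parameter $a=a(n)$ is a positive integer with $a=\widetilde\Theta(n^{2/3})$; put $b=\lfloor n/a\rfloor$. Initialization: $X\gets0$; $Y\gets0$; $Z\gets0$; $m\gets0$; $d\gets b$; $s\gets r$; if $r=\lfloor n/r\rfloor$ then $s\gets s-1$; $\chi\gets\lfloor n/s\rfloor$; $\gamma\gets\lfloor\sqrt{n/d}\rfloor$. (Conventions: $\chi=\infty$ whenever $s=0$, and $\gamma=\infty$ whenever $d=0$.) The values $\mu(1),\dots,\mu(a)$ are produced in order by a segmented sieve, which takes $\Theta(a\ln(\ln(a)))$ time and $\widetilde O(\sqrt a)$ space. $\mathcal M$ is an array of size $b$ (its indexing varies as the algorithm executes), initially empty. $M'$ is an array indexed by $1,\dots,b$, initialized to all zeros.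 Main loop. For $x=1,2,\dots,a$: (1) $v\gets\lfloor n/x\rfloor$; $m\gets m+\mu(x)$; $X\gets X+\mu(x)\,v(v+1)/2$. (2) If $x\le r$: (2a) $\mathcal M_x\gets m$. (2b) If $x>1$ and $\mu(x)\ne0$: for $y=1,\dots,\min(b,\lfloor v/x\rfloor)$ do $M'_y\gets M'_y-\mu(x)\lfloor v/y\rfloor$. (2c) While $x=\gamma$: $M'_d\gets M'_d+1-\lfloor n/d\rfloor+mx$; $d\gets d-1$; $\gamma\gets\lfloor\sqrt{n/d}\rfloor$. (2d) If $b\mid x$ or $x=r$: let $A$ be the least index in $\mathcal M$; for $t=1,\dots,b$, set $\ell_{\min}=1+\lfloor n/(t(x+1))\rfloor$ and $\ell_{\max}=\min(\lfloor\sqrt{n/t}\rfloor,\lfloor n/(tA)\rfloor)$, and for $\ell=\ell_{\min},\dots,\ell_{\max}$ do $M'_t\gets M'_t-\mathcal M_{\lfloor n/(\ell t)\rfloor}$; then empty $\mathcal M$. (3) Otherwise (so $x>r$), if $x=\chi$: if $v\ne b$, then (if $\mathcal M$ is empty, set $A\gets v$) set $\mathcal M_v\gets m$ and $B\gets v$; in either case then $s\gets s-1$ and $\chi\gets\lfloor n/s\rfloor$. (4) If $x=a$, or if $x>r$ and $\mathcal M$ is full: for $y=1,\dots,b$ and all integers $t$ with $2\le t\le\lfloor\sqrt{n/y}\rfloor$, $r<\lfloor n/(ty)\rfloor$ and $B\le\left\lfloor n/\lfloor n/(ty)\rfloor\right\rfloor\le A$, do $M'_y\gets M'_y-\mathcal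 M_{ty}$ (nothing is done if $\mathcal M$ is empty); then empty $\mathcal M$. (5) If $x=a$: $Z\gets m\,b(b+1)/2$. Final loop. For $y=b,b-1,\dots,1$: $v\gets\lfloor n/y\rfloor$; $m\gets0$; for $t=2,3,4,\dots$: if $n/(b+1)\ge\lfloor v/t\rfloor$ break out of the $t$-loop, otherwise $m\gets m-M'_{\lfloor n/\lfloor v/t\rfloor\rfloor}$. Then $M'_y\gets M'_y+m$ and $Y\gets Y+y\,M'_y$. Output: $X+Y-Z$.
   Formalization: The sieve's space is taken as O(√a·ln ln a), since Õ(√a) with a larger log factor (e.g. √a·ln a) breaks the space bound; correctness is claimed for each n with a(n) > ⌊√n⌋, hence for all large n, since n = 1, a = 1 outputs 0 instead of 1. *)

theory Defs
  imports
    Complex_Main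
    "HOL-Library.Landau_Symbols"
    "HOL-Library.While_Combinator"
    "HOL-Library.Extended_Nat"
    "HOL-Computational_Algebra.Squarefree"
    "HOL-Number_Theory.Number_Theory"
begin

definition moebius :: "nat \<Rightarrow> int" where
  "moebius k = (if squarefree k then (- 1) ^ card (prime_factors k) else 0)"

definition totient_sum :: "nat \<Rightarrow> nat" where
  "totient_sum n = (\<Sum>k = 1..n. totient k)"

definition root_quot :: "nat \<Rightarrow> nat \<Rightarrow> nat" where
  "root_quot n d = nat \<lfloor>sqrt (real n / real d)\<rfloor>"

definition chi_val :: "nat \<Rightarrow> nat \<Rightarrow> enat" where
  "chi_val n s = (if s = 0 then \<infinity> else enat (n div s))"

definition gamma_val :: "nat \<Rightarrow> nat \<Rightarrow> enat" where
  "gamma_val n d = (if d = 0 then \<infinity> else enat (root_quot n d))"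

text \<open>
  The algorithm is a state transformer. Arrays are partial maps; the domain is the set of indices
  at which an integer is currently stored, and reading any other index yields the unspecified
  value \<open>the None\<close>.

  Two components are bookkeeping only: \<open>ops\<close> counts the operations performed so far (arithmetic
  operations including integer division and floor of a square root, comparisons and minima, loop
  counter increments and loop tests, array reads and writes; each costs one unit), and \<open>peak\<close> is
  the largest number of integers that have been stored simultaneously. Neither includes the
  sieve, which is added at the end.
\<close>

record state =
  X :: int
  Y :: int
  Z :: int
  m :: int
  d :: nat
  s :: nat
  chi :: enat
  gam :: enat
  A :: nat
  B :: nat
  blk :: "nat \<rightharpoonup> int"  \<comment> \<open>the array \<open>\<M>\<close>\<close>
  mp :: "nat \<rightharpoonup> int"   \<comment> \<open>the array \<open>M'\<close>\<close>
  ops :: nat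
  peak :: nat

hide_const (open) X Y Z m d s A B

text \<open>
  The 22 scalars are \<open>n, a, b, r, X, Y, Z, m, d, s, \<chi>, \<gamma>, A, B, x, v, y, t, \<ell>, \<ell>\<^sub>m\<^sub>i\<^sub>n, \<ell>\<^sub>m\<^sub>a\<^sub>x\<close> and the
  current Moebius value.
\<close>

definition stored :: "state \<Rightarrow> nat" where
  "stored \<sigma> = 22 + card (dom (blk \<sigma>)) + card (dom (mp \<sigma>))"

definition tick :: "nat \<Rightarrow> state \<Rightarrow> state" where
  "tick k \<sigma> = \<sigma>\<lparr>ops := ops \<sigma> + k\<rparr>"

definition record_peak :: "state \<Rightarrow> state" where
  "record_peak \<sigma> = \<sigma>\<lparr>peak := max (peak \<sigma>) (stored \<sigma>)\<rparr>"

text \<open>\<open>blk_write i e\<close> is \<open>\<M>\<^sub>i \<leftarrow> e\<close>, and \<open>mp_add i e\<close> is \<open>M'\<^sub>i \<leftarrow> M'\<^sub>i + e\<close> (read, add, write).\<close>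

definition blk_write :: "nat \<Rightarrow> int \<Rightarrow> state \<Rightarrow> state" where
  "blk_write i e \<sigma> = tick 1 (record_peak (\<sigma>\<lparr>blk := (blk \<sigma>)(i \<mapsto> e)\<rparr>))"

definition mp_add :: "nat \<Rightarrow> int \<Rightarrow> state \<Rightarrow> state" where
  "mp_add i e \<sigma> = tick 3 (record_peak (\<sigma>\<lparr>mp := (mp \<sigma>)(i \<mapsto> the (mp \<sigma> i) + e)\<rparr>))"

text \<open>Emptying \<open>\<M>\<close> only resets the index range of the array.\<close>

definition blk_clear :: "state \<Rightarrow> state" where
  "blk_clear \<sigma> = tick 1 (\<sigma>\<lparr>blk := Map.empty\<rparr>)"

text \<open>Each iteration of a loop is charged one counter increment and one test.\<close>

definition for_each :: "nat list \<Rightarrow> (nat \<Rightarrow> state \<Rightarrow> state) \<Rightarrow> state \<Rightarrow> state" where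
  "for_each xs body \<sigma> = fold (\<lambda>i \<sigma>. tick 2 (body i \<sigma>)) xs \<sigma>"

definition init :: "nat \<Rightarrow> nat \<Rightarrow> state" where
  "init n a =
    (let b = n div a;
         r = root_quot n 1;
         s\<^sub>0 = (if r = n div r then r - 1 else r)
     in record_peak
         \<lparr>state.X = 0, Y = 0, Z = 0, m = 0, d = b, s = s\<^sub>0,
          chi = chi_val n s\<^sub>0, gam = gamma_val n b, A = 0, B = 0,
          blk = Map.empty,
          mp = (\<lambda>i. if 1 \<le> i \<and> i \<le> b then Some 0 else None),
          ops = 10 + b,
          peak = 0\<rparr>)"

definition step_1 :: "nat \<Rightarrow> nat \<Rightarrow> state \<Rightarrow> state" where
  "step_1 n x \<sigma> =
    (let v = int (n div x)
     in tick 7 (\<sigma>\<lparr>state.m := state.m \<sigma> + moebius x,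
                  state.X := state.X \<sigma> + moebius x * (v * (v + 1) div 2)\<rparr>))"

definition step_2a :: "nat \<Rightarrow> state \<Rightarrow> state" where
  "step_2a x \<sigma> = blk_write x (state.m \<sigma>) \<sigma>"

definition step_2b :: "nat \<Rightarrow> nat \<Rightarrow> nat \<Rightarrow> state \<Rightarrow> state" where
  "step_2b n b x \<sigma> =
    (let v = n div x
     in tick 2
         (if x > 1 \<and> moebius x \<noteq> 0
          then tick 2
            (for_each [1..<Suc (min b (v div x))]
              (\<lambda>y \<sigma>. tick 2 (mp_add y (- (moebius x * int (v div y))) \<sigma>)) \<sigma>)
          else \<sigma>))"

definition step_2c :: "nat \<Rightarrow> nat \<Rightarrow> state \<Rightarrow> state" where
  "step_2c n x \<sigma> =
    tick 1
     (while (\<lambda>\<sigma>. enat x = gam \<sigma>)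
       (\<lambda>\<sigma>. let d = state.d \<sigma>;
                 \<sigma>' = mp_add d (1 - int (n div d) + state.m \<sigma> * int x) \<sigma>
             in tick 8 (\<sigma>'\<lparr>state.d := d - 1, gam := gamma_val n (d - 1)\<rparr>))
       \<sigma>)"

text \<open>
  The indices of \<open>\<M>\<close> form an interval whose end points are known, so the least one is available
  in one operation.
\<close>

definition step_2d :: "nat \<Rightarrow> nat \<Rightarrow> nat \<Rightarrow> nat \<Rightarrow> state \<Rightarrow> state" where
  "step_2d n b r x \<sigma> =
    tick 3
     (if b dvd x \<or> x = r
      then
        (let A = Min (dom (blk \<sigma>));
             \<sigma>' = for_each [1..<Suc b]
               (\<lambda>t \<sigma>.
                 let l_min = 1 + n div (t * (x + 1));
                     l_max = min (root_quot n t) (n div (t * A))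
                 in tick 9
                     (for_each [l_min..<Suc l_max]
                       (\<lambda>l \<sigma>. tick 3 (mp_add t (- the (blk \<sigma> (n div (l * t)))) \<sigma>)) \<sigma>))
               (tick 1 (\<sigma>\<lparr>state.A := A\<rparr>))
         in blk_clear \<sigma>')
      else \<sigma>)"

definition step_3 :: "nat \<Rightarrow> nat \<Rightarrow> nat \<Rightarrow> state \<Rightarrow> state" where
  "step_3 n b x \<sigma> =
    (let v = n div x
     in tick 1
         (if enat x = chi \<sigma>
          then
            (let \<sigma>' =
                  (if v \<noteq> b
                   then
                     (let \<sigma>'' = (if blk \<sigma> = Map.empty then \<sigma>\<lparr>state.A := v\<rparr> else \<sigma>)
                      in tick 1 ((blk_write v (state.m \<sigma>) \<sigma>'')\<lparr>state.B := v\<rparr>))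
                   else \<sigma>);
                 s' = state.s \<sigma>' - 1
             in tick 3 (\<sigma>'\<lparr>state.s := s', chi := chi_val n s'\<rparr>))
          else \<sigma>))"

text \<open>
  For fixed \<open>y\<close> the conditions on \<open>t\<close> are monotone in \<open>t\<close>, so the admissible \<open>t\<close> form an interval
  with end points computable from \<open>n, r, y, A, B\<close> in a bounded number of operations. Accordingly
  each \<open>y\<close> is charged a constant, and the inner loop is charged only for the admissible \<open>t\<close>.
\<close>

definition step_4_range :: "nat \<Rightarrow> nat \<Rightarrow> nat \<Rightarrow> nat \<Rightarrow> nat \<Rightarrow> nat list" where
  "step_4_range n r A B y =
    filter (\<lambda>t. r < n div (t * y)
                \<and> B \<le> n div (n div (t * y)) \<and> n div (n div (t * y)) \<le> A)
      [2..<Suc (root_quot n y)]"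

definition step_4 :: "nat \<Rightarrow> nat \<Rightarrow> nat \<Rightarrow> nat \<Rightarrow> nat \<Rightarrow> state \<Rightarrow> state" where
  "step_4 n a b r x \<sigma> =
    tick 4
     (if x = a \<or> (x > r \<and> card (dom (blk \<sigma>)) = b)
      then
        (if blk \<sigma> = Map.empty then \<sigma>
         else
           blk_clear
            (for_each [1..<Suc b]
              (\<lambda>y \<sigma>. tick 20
                 (for_each (step_4_range n r (state.A \<sigma>) (state.B \<sigma>) y)
                   (\<lambda>t \<sigma>. tick 2 (mp_add y (- the (blk \<sigma> (t * y))) \<sigma>)) \<sigma>))
              \<sigma>))
      else \<sigma>)"

definition step_5 :: "nat \<Rightarrow> nat \<Rightarrow> nat \<Rightarrow> state \<Rightarrow> state" where
  "step_5 a b x \<sigma> =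
    tick 1
     (if x = a
      then tick 4 (\<sigma>\<lparr>state.Z := state.m \<sigma> * (int b * (int b + 1) div 2)\<rparr>)
      else \<sigma>)"

definition main_step :: "nat \<Rightarrow> nat \<Rightarrow> nat \<Rightarrow> state \<Rightarrow> state" where
  "main_step n a x \<sigma> =
    (let b = n div a;
         r = root_quot n 1;
         \<sigma>\<^sub>1 = tick 1 (step_1 n x \<sigma>);
         \<sigma>\<^sub>3 = (if x \<le> r
               then step_2d n b r x (step_2c n x (step_2b n b x (step_2a x \<sigma>\<^sub>1)))
               else step_3 n b x \<sigma>\<^sub>1)
     in step_5 a b x (step_4 n a b r x \<sigma>\<^sub>3))"

text \<open>The division \<open>n / (b + 1)\<close> in the test that ends the inner loop is exact, not rounded.\<close>

definition final_step :: "nat \<Rightarrow> nat \<Rightarrow> nat \<Rightarrow> state \<Rightarrow> state" where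
  "final_step n b y \<sigma> =
    (let v = n div y;
         (t, \<sigma>') = while
           (\<lambda>(t, \<sigma>). \<not> real n / real (b + 1) \<ge> real (v div t))
           (\<lambda>(t, \<sigma>). (t + 1,
              tick 8 (\<sigma>\<lparr>state.m := state.m \<sigma> - the (mp \<sigma> (n div (v div t)))\<rparr>)))
           (2, \<sigma>\<lparr>state.m := 0\<rparr>);
         \<sigma>'' = mp_add y (state.m \<sigma>') (tick 5 \<sigma>')
     in tick 3 (\<sigma>''\<lparr>state.Y := state.Y \<sigma>'' + int y * the (mp \<sigma>'' y)\<rparr>))"

definition run :: "nat \<Rightarrow> nat \<Rightarrow> state" where
  "run n a =
    for_each (rev [1..<Suc (n div a)]) (final_step n (n div a))
      (for_each [1..<Suc a] (main_step n a) (init n a))"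

definition alg_output :: "nat \<Rightarrow> nat \<Rightarrow> int" where
  "alg_output n a = state.X (run n a) + state.Y (run n a) - state.Z (run n a)"

text \<open>
  The segmented sieve delivers the values \<open>moebius 1, \<dots>, moebius a\<close> one by one while the main loop
  runs; it enters through its running time \<open>sieve_time a\<close> and its working space \<open>sieve_space a\<close>.
\<close>

definition alg_time :: "(nat \<Rightarrow> nat) \<Rightarrow> nat \<Rightarrow> nat \<Rightarrow> nat" where
  "alg_time sieve_time n a = sieve_time a + ops (run n a) + 2"

definition alg_space :: "(nat \<Rightarrow> nat) \<Rightarrow> nat \<Rightarrow> nat \<Rightarrow> nat" where
  "alg_space sieve_space n a = sieve_space a + peak (run n a)"

end

theory Submission
  imports Defs "HOL-Real_Asymp.Real_Asymp"
begin

text \<open>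
  Splitting \<open>\<Sum>\<^sub>k \<mu>(k) T(n div k)\<close>, where \<open>T\<close> denotes triangular numbers, by the hyperbola method at
  \<open>k = a\<close> gives \<open>\<Phi>(n) = X + Y - Z\<close>, where \<open>Y\<close> sums \<open>y M(n div y)\<close> over \<open>y \<le> b\<close> and \<open>M\<close> is the
  Mertens function. A second application, to the identity \<open>\<Sum>\<^sub>t M(v div t) = 1\<close> at \<open>\<surd>v\<close>, expresses
  \<open>M(n div y)\<close> by values \<open>\<mu>(k)\<close> with \<open>k\<^sup>2 y \<le> n\<close> and values \<open>M(n div (t y))\<close> with \<open>t\<^sup>2 y \<le> n\<close>. Those
  with \<open>n div (t y) \<le> r\<close> are found by steps (2a, 2d), those with \<open>r < n div (t y)\<close> and \<open>t y > b\<close> by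
  steps (3, 4), and those with \<open>t y \<le> b\<close> by the final loop.

  Every inner loop visits each pair \<open>(y, t)\<close> with \<open>t\<^sup>2 y \<le> n\<close>, \<open>y \<le> b\<close> at most a bounded number of
  times, and there are at most \<open>2 \<surd>(n b) \<le> 2 n / \<surd>a\<close> such pairs. Conversely, step (2b) alone performs
  \<open>b\<close> iterations for each squarefree \<open>x \<le> \<surd>a\<close>, and squarefree numbers have positive lower density. So
  the running time is of order \<open>a ln (ln a) + n / \<surd>a\<close>, and the stated \<open>a\<close> balances the two terms.
\<close>

subsection \<open>Mertens sums and the hyperbola method\<close>

text \<open>The obstacle is memory: with \<open>b\<close> cells in the block array, Mertens values
  are available for one window of arguments at a time, so an entry of \<open>M'\<close> is assembled
  piecewise over the whole run. Correctness is therefore carried by a closed form for every entry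
  after each pass of the main loop (\<open>mp1\<close>, \<open>mp2\<close>). Up to \<open>r\<close>
  a window is a range of arguments. Above \<open>r\<close> only arguments \<open>n div k\<close> are
  needed, and they are addressed by \<open>k\<close>, which works because
  \<open>n div (n div k) = k\<close> for these \<open>k\<close>. Each emptying of the block visits
  all \<open>y\<close> and so costs order \<open>b\<close> beyond its useful work; a full window has
  consumed \<open>b\<close> fresh arguments or indices, and the cost bounds carry such charges as
  telescoping terms. The contents are controlled only under \<open>r < a\<close>, which puts
  \<open>n div y\<close> above \<open>r\<close> for all \<open>1 \<le> y \<le> b\<close>.\<close>

definition mertens :: "nat \<Rightarrow> int" where
  "mertens v = (\<Sum>k = 1..v. moebius k)"

lemma moebius_1 [simp]: "moebius (Suc 0) = 1"
  by (simp add: moebius_def)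

lemma moebius_not_squarefree: "\<not> squarefree k \<Longrightarrow> moebius k = 0"
  by (simp add: moebius_def)

lemma moebius_prime_mult:
  assumes "prime p" "\<not> p dvd d" "d > 0"
  shows "moebius (p * d) = - moebius d"
proof -
  have co: "coprime p d" using assms(1,2) by (simp add: prime_imp_coprime)
  have "squarefree (p * d) \<longleftrightarrow> squarefree d"
    using squarefree_multD(2)[of p d] squarefree_mult_coprime[OF co] squarefree_prime[OF assms(1)] by auto
  moreover have "prime_factors (p * d) = insert p (prime_factors d)"
    using assms by (simp add: prime_factors_product prime_prime_factors)
  moreover have "p \<notin> prime_factors d" using assms(2) by (simp add: in_prime_factors_iff)
  ultimately show ?thesis by (simp add: moebius_def)
qed

text \<open>Multiplication by a prime divisor of \<open>n\<close> pairs the squarefree divisors with opposite signs.\<close>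

lemma sum_moebius_divisors:
  assumes "n > 0"
  shows "(\<Sum>k | k dvd n. moebius k) = (if n = 1 then 1 else 0)"
proof (cases "n = 1")
  case False
  then obtain p where p: "prime p" "p dvd n" using prime_factor_nat by blast
  let ?D = "{k. k dvd n \<and> squarefree k}"
  let ?U = "{k. k dvd n \<and> squarefree k \<and> \<not> p dvd k}"
  let ?V = "{k. k dvd n \<and> squarefree k \<and> p dvd k}"
  have fin: "finite {k. k dvd n}" using assms by simp
  have "(\<Sum>k | k dvd n. moebius k) = sum moebius ?D"
    by (rule sum.mono_neutral_right) (use fin in \<open>auto simp: moebius_not_squarefree\<close>)
  also have "?D = ?U \<union> ?V" by auto
  also have "sum moebius (?U \<union> ?V) = sum moebius ?U + sum moebius ?V"
    by (rule sum.union_disjoint) (use fin in \<open>auto intro: finite_subset\<close>)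
  also have "sum moebius ?V = sum (\<lambda>k. moebius (p * k)) ?U"
  proof (rule sum.reindex_bij_witness[of _ "\<lambda>k. p * k" "\<lambda>k. k div p"])
    fix k assume k: "k \<in> ?V"
    then obtain j where j: "k = p * j" by (auto elim: dvdE)
    have "p > 0" using p(1) by (simp add: prime_gt_0_nat)
    then show "p * (k div p) = k" by (simp add: j)
    then show "moebius (p * (k div p)) = moebius k" by simp
    have "\<not> p dvd j"
    proof
      assume "p dvd j"
      then have "p ^ 2 dvd k" by (simp add: j power2_eq_square)
      then show False using k p(1) squarefreeD[of k p] by auto
    qed
    then show "k div p \<in> ?U"
      using k j \<open>p > 0\<close> squarefree_multD(2)[of p j] by (auto intro: dvd_mult_right)
  next
    fix k assume k: "k \<in> ?U"
    have "coprime p k" using k p(1) by (simp add: prime_imp_coprime)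
    then show "p * k \<in> ?V"
      using k p by (auto intro: divides_mult squarefree_mult_coprime squarefree_prime)
    show "p * k div p = k" using p(1) by (simp add: prime_gt_0_nat)
  qed
  also have "\<dots> = sum (\<lambda>k. - moebius k) ?U"
    by (rule sum.cong[OF refl], rule moebius_prime_mult)
       (use p assms in \<open>auto intro: Nat.gr0I\<close>)
  finally show ?thesis using False by (simp add: sum_negf)
qed simp

text \<open>Both sides run over the pairs \<open>(k, t)\<close> with \<open>k * t \<le> n\<close>;
  the left side groups them by the product \<open>j = k * t\<close>.\<close>

lemma sum_divisors_swap:
  fixes f :: "nat \<Rightarrow> nat \<Rightarrow> 'a::comm_monoid_add"
  shows "(\<Sum>j = 1..n. \<Sum>k | k dvd j. f k (j div k)) = (\<Sum>k = 1..n. \<Sum>t = 1..n div k. f k t)"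
proof -
  have "(\<Sum>j = 1..n. \<Sum>k | k dvd j. f k (j div k))
      = (\<Sum>(j, k)\<in>(SIGMA j:{1..n}. {k. k dvd j}). f k (j div k))"
    by (rule sum.Sigma) auto
  also have "\<dots> = (\<Sum>(k, t)\<in>(SIGMA k:{1..n}. {1..n div k}). f k t)"
  proof (rule sum.reindex_bij_witness[of _ "\<lambda>(k, t). (k * t, k)" "\<lambda>(j, k). (k, j div k)"], goal_cases)
    case (2 p)
    then show ?case
      by (auto simp: Suc_le_eq div_greater_zero_iff div_le_mono intro: dvd_imp_le dvd_pos_nat order_trans[OF dvd_imp_le])
  next
    case (4 p)
    then show ?case by (auto simp: less_eq_div_iff_mult_less_eq mult.commute Suc_le_eq)
  qed auto
  also have "\<dots> = (\<Sum>k = 1..n. \<Sum>t = 1..n div k. f k t)"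
    by (rule sum.Sigma[symmetric]) auto
  finally show ?thesis .
qed

text \<open>Since \<open>g\<close> sees only the product \<open>k * t\<close>, grouping by products
  leaves the Moebius divisor sum as coefficient of \<open>g j\<close>, and it vanishes unless
  \<open>j = 1\<close>.\<close>

lemma sum_moebius_div_swap:
  "(\<Sum>k = 1..n. \<Sum>t = 1..n div k. moebius k * g (k * t)) = (if n = 0 then 0 else g 1)"
proof -
  have "(\<Sum>k = 1..n. \<Sum>t = 1..n div k. moebius k * g (k * t))
     = (\<Sum>j = 1..n. \<Sum>k | k dvd j. moebius k * g (k * (j div k)))"
    by (rule sum_divisors_swap[symmetric])
  also have "\<dots> = (\<Sum>j = 1..n. if j = 1 then g 1 else 0)"
  proof (rule sum.cong[OF refl])
    fix j assume "j \<in> {1..n}"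
    then have "(\<Sum>k | k dvd j. moebius k) = (if j = 1 then 1 else 0)"
      by (intro sum_moebius_divisors) auto
    moreover have "(\<Sum>k | k dvd j. moebius k * g (k * (j div k))) = (\<Sum>k | k dvd j. moebius k) * g j"
      by (simp add: sum_distrib_right)
    ultimately show "(\<Sum>k | k dvd j. moebius k * g (k * (j div k))) = (if j = 1 then g 1 else 0)"
      by simp
  qed
  finally show ?thesis by (simp add: sum.delta)
qed

lemma sum_Suc0_int: "(\<Sum>t = Suc 0..v. int t) = int v * (int v + 1) div 2"
proof -
  have "2 * (\<Sum>t = Suc 0..v. int t) = int v * (int v + 1)"
    by (induction v) (auto simp: algebra_simps)
  then show ?thesis by simp
qed

lemma sum_totient_sum_div:
  "(\<Sum>t = 1..v. int (totient_sum (v div t))) = int v * (int v + 1) div 2"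
proof -
  have "(\<Sum>t = 1..v. totient_sum (v div t)) = (\<Sum>k = 1..v. \<Sum>t = 1..v div k. totient t)"
    by (simp add: totient_sum_def)
  also have "\<dots> = (\<Sum>j = 1..v. \<Sum>k | k dvd j. totient (j div k))"
    by (rule sum_divisors_swap[symmetric])
  also have "\<dots> = (\<Sum>j = 1..v. j)"
  proof (rule sum.cong[OF refl])
    fix j assume j: "j \<in> {1..v}"
    have "(\<Sum>k | k dvd j. totient (j div k)) = (\<Sum>k | k dvd j. totient k)"
      by (rule sum.reindex_bij_witness[of _ "\<lambda>k. j div k" "\<lambda>k. j div k"])
         (use j in \<open>auto simp: div_dvd_iff_mult dvd_div_eq_mult\<close>)
    then show "(\<Sum>k | k dvd j. totient (j div k)) = j" by (simp add: totient_divisor_sum)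
  qed
  finally have "(\<Sum>t = 1..v. totient_sum (v div t)) = (\<Sum>j = 1..v. j)" .
  from arg_cong[OF this, of int] show ?thesis by (simp add: sum_Suc0_int)
qed

text \<open>Expanding each triangular number by \<open>sum_totient_sum_div\<close> gives a sum over
  \<open>g (k * t)\<close> with \<open>g j = totient_sum (n div j)\<close>, of which Moebius
  cancellation keeps only \<open>j = 1\<close>.\<close>

lemma sum_moebius_triangle:
  assumes "n > 0"
  shows "(\<Sum>k = 1..n. moebius k * (int (n div k) * (int (n div k) + 1) div 2)) = int (totient_sum n)"
proof -
  have "(\<Sum>k = 1..n. moebius k * (int (n div k) * (int (n div k) + 1) div 2))
     = (\<Sum>k = 1..n. \<Sum>t = 1..n div k. moebius k * int (totient_sum (n div (k * t))))"
    by (simp only: sum_totient_sum_div[symmetric] sum_distrib_left div_mult2_eq)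
  also have "\<dots> = int (totient_sum n)"
    using assms sum_moebius_div_swap[of "\<lambda>j. int (totient_sum (n div j))" n] by simp
  finally show ?thesis .
qed

text \<open>Under the assumption a pair with \<open>k > p\<close> must have
  \<open>t \<le> q\<close>. Cutting at \<open>k = p\<close> alone is thus a disjoint split, and the
  second part can be summed with \<open>t\<close> outermost.\<close>

lemma hyperbola_split:
  fixes f :: "nat \<Rightarrow> nat \<Rightarrow> 'a::comm_monoid_add"
  assumes "n < (p + 1) * (q + 1)"
  shows "(\<Sum>k = 1..n. \<Sum>t = 1..n div k. f k t)
       = (\<Sum>k = 1..p. \<Sum>t = 1..n div k. f k t) + (\<Sum>t = 1..q. \<Sum>k = p + 1..n div t. f k t)"
proof -
  let ?K = "SIGMA k:{1..p}. {1..n div k}"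
  let ?T = "SIGMA t:{1..q}. {p + 1..n div t}"
  let ?T' = "{(k, t). p < k \<and> 1 \<le> t \<and> t \<le> q \<and> k * t \<le> n}"
  have q: "t \<le> q" if "k * t \<le> n" "p < k" for t k
  proof (rule ccontr)
    assume "\<not> t \<le> q"
    then have "(p + 1) * (q + 1) \<le> k * t" using that by (intro mult_mono) auto
    then show False using assms that by simp
  qed
  have le_n: "k \<le> n" if "1 \<le> t" "k * t \<le> n" for k t
    using that by (cases t) auto
  have mem: "(k, t) \<in> (SIGMA k:{1..N}. {1..n div k}) \<longleftrightarrow> 1 \<le> k \<and> k \<le> N \<and> 1 \<le> t \<and> k * t \<le> n" for k t N
    by (auto simp: less_eq_div_iff_mult_less_eq mult.commute)
  have eq: "(SIGMA k:{1..n}. {1..n div k}) = ?K \<union> ?T'"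
  proof (rule Set.set_eqI)
    fix z :: "nat \<times> nat"
    obtain k t where z: "z = (k, t)" by fastforce
    have "1 \<le> k" if "p < k" using that by simp
    then show "z \<in> (SIGMA k:{1..n}. {1..n div k}) \<longleftrightarrow> z \<in> ?K \<union> ?T'"
      unfolding z Un_iff mem mem_Collect_eq prod.case using q[of k t] le_n[of t k] not_le[of k p] by blast
  qed
  have "finite (SIGMA k:{1..n}. {1..n div k})" by blast
  then have "finite ?T'" unfolding eq by blast
  have "(\<Sum>k = 1..n. \<Sum>t = 1..n div k. f k t) = (\<Sum>(k, t)\<in>?K \<union> ?T'. f k t)"
    unfolding eq[symmetric] by (rule sum.Sigma) auto
  also have "\<dots> = (\<Sum>(k, t)\<in>?K. f k t) + (\<Sum>(k, t)\<in>?T'. f k t)"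
    by (rule sum.union_disjoint) (use \<open>finite ?T'\<close> in auto)
  also have "(\<Sum>(k, t)\<in>?T'. f k t) = (\<Sum>(t, k)\<in>?T. f k t)"
    by (rule sum.reindex_bij_witness[of _ "\<lambda>(t, k). (k, t)" "\<lambda>(k, t). (t, k)"])
       (auto simp: less_eq_div_iff_mult_less_eq)
  also have "\<dots> = (\<Sum>t = 1..q. \<Sum>k = p + 1..n div t. f k t)"
    by (rule sum.Sigma[symmetric]) auto
  also have "(\<Sum>(k, t)\<in>?K. f k t) = (\<Sum>k = 1..p. \<Sum>t = 1..n div k. f k t)"
    by (rule sum.Sigma[symmetric]) auto
  finally show ?thesis .
qed

lemma mertens_diff:
  assumes "p \<le> v"
  shows "(\<Sum>k = p + 1..v. moebius k) = mertens v - mertens p"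
proof -
  have "{1..v} = {1..p} \<union> {p + 1..v}" using assms by auto
  then have "mertens v = sum moebius {1..p} + sum moebius {p + 1..v}"
    unfolding mertens_def by (simp add: sum.union_disjoint)
  then show ?thesis by (simp add: mertens_def)
qed

text \<open>The extra condition \<open>p * q \<le> n\<close> gives \<open>p \<le> n div t\<close>
  for \<open>t \<le> q\<close>, so that the inner sums over \<open>k > p\<close> are true
  differences of Mertens values even at the end of the range.\<close>

lemma hyperbola_moebius:
  fixes g :: "nat \<Rightarrow> int"
  assumes "n < (p + 1) * (q + 1)" "p * q \<le> n"
  shows "(\<Sum>k = 1..n. \<Sum>t = 1..n div k. moebius k * g t)
       = (\<Sum>k = 1..p. moebius k * (\<Sum>t = 1..n div k. g t))
       + (\<Sum>t = 1..q. g t * mertens (n div t)) - mertens p * (\<Sum>t = 1..q. g t)"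
proof -
  have "(\<Sum>t = 1..q. \<Sum>k = p + 1..n div t. moebius k * g t)
      = (\<Sum>t = 1..q. g t * (mertens (n div t) - mertens p))"
  proof (rule sum.cong[OF refl])
    fix t assume t: "t \<in> {1..q}"
    then have "p * t \<le> n" using assms(2) by (meson atLeastAtMost_iff le_trans mult_le_mono2)
    then have "p \<le> n div t" using t by (simp add: less_eq_div_iff_mult_less_eq)
    then show "(\<Sum>k = p + 1..n div t. moebius k * g t) = g t * (mertens (n div t) - mertens p)"
      by (simp add: mertens_diff[symmetric] sum_distrib_left mult.commute)
  qed
  then show ?thesis
    unfolding hyperbola_split[OF assms(1)]
    by (simp add: sum_distrib_left sum_subtractf right_diff_distrib mult.commute)
qed

lemma totient_sum_hyperbola:
  assumes "n > 0" "a > 0"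
  shows "int (totient_sum n)
       = (\<Sum>k = 1..a. moebius k * (int (n div k) * (int (n div k) + 1) div 2))
       + (\<Sum>y = 1..n div a. int y * mertens (n div y))
       - mertens a * (int (n div a) * (int (n div a) + 1) div 2)"
proof -
  have "n < a * (n div a + 1)" using assms(2) by (simp add: dividend_less_times_div)
  then have "n < (a + 1) * (n div a + 1)" by (simp add: algebra_simps)
  from hyperbola_moebius[OF this, of int]
  show ?thesis
    using sum_moebius_triangle[OF assms(1)] by (simp add: sum_Suc0_int sum_distrib_left[symmetric])
qed

text \<open>The symmetric cut \<open>p = q = u\<close> with constant weight. The terms
  \<open>k = 1\<close> and \<open>t = 1\<close> are split off: the first is \<open>v\<close>, the
  second is the wanted \<open>mertens v\<close>. Its summands correspond to the updates of
  \<open>M'\<close>: step (2c) supplies the closed part, step (2b) the sum over \<open>k\<close>,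
  the remaining loops the sum over \<open>t\<close>.\<close>

lemma mertens_hyperbola:
  assumes "v > 0" "u * u \<le> v" "v < (u + 1) * (u + 1)"
  shows "mertens v = 1 - int v + int u * mertens u
    - (\<Sum>k = 2..u. moebius k * int (v div k)) - (\<Sum>t = 2..u. mertens (v div t))"
proof -
  have u: "1 \<le> u" using assms by (cases u) auto
  have "(\<Sum>k = 1..v. \<Sum>t = 1..v div k. moebius k * 1) = 1"
    using sum_moebius_div_swap[of "\<lambda>_. 1" v] assms(1) by simp
  then have "1 = (\<Sum>k = 1..u. moebius k * int (v div k)) + (\<Sum>t = 1..u. mertens (v div t)) - mertens u * int u"
    unfolding hyperbola_moebius[OF assms(3,2), of "\<lambda>_. 1"] by simp
  then show ?thesis using u by (simp add: sum.atLeast_Suc_atMost numeral_2_eq_2 mult.commute)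
qed

text \<open>Replaces the floor of a real square root by an integer inequality, so that the loop
  bounds can be compared by arithmetic in \<open>nat\<close>.\<close>

lemma le_root_quot_iff:
  assumes "y > 0"
  shows "x \<le> root_quot n y \<longleftrightarrow> x * x * y \<le> n"
proof -
  have "x \<le> root_quot n y \<longleftrightarrow> real x \<le> sqrt (real n / real y)"
    unfolding root_quot_def by (auto simp: le_nat_iff le_floor_iff)
  also have "\<dots> \<longleftrightarrow> (real x)\<^sup>2 \<le> real n / real y"
    by (metis of_nat_0_le_iff real_le_rsqrt real_sqrt_le_iff real_sqrt_unique)
  also have "\<dots> \<longleftrightarrow> real (x * x * y) \<le> real n"
    using assms by (simp add: field_simps power2_eq_square)
  finally show ?thesis by (simp only: of_nat_le_iff)
qed

subsection \<open>Loops that only add to \<open>M'\<close>\<close>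

text \<open>Separating the fixed domain from a total function \<open>g\<close> turns statements
  about \<open>M'\<close> into equations between integer functions, with values outside
  \<open>1..b\<close> left free (\<open>arr_cong\<close>).\<close>

definition arr :: "nat \<Rightarrow> (nat \<Rightarrow> int) \<Rightarrow> nat \<rightharpoonup> int" where
  "arr b g = (\<lambda>i. if 1 \<le> i \<and> i \<le> b then Some (g i) else None)"

lemma the_arr: "1 \<le> i \<Longrightarrow> i \<le> b \<Longrightarrow> the (arr b g i) = g i"
  by (simp add: arr_def)

lemma arr_cong: "(\<And>i. 1 \<le> i \<Longrightarrow> i \<le> b \<Longrightarrow> g i = h i) \<Longrightarrow> arr b g = arr b h"
  by (auto simp: arr_def)

lemma dom_arr: "dom (arr b g) = {1..b}"
  by (auto simp: arr_def split: if_splits)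

lemma card_dom_arr [simp]: "card (dom (arr b g)) = b"
  by (simp add: dom_arr)

lemma arr_update:
  assumes "1 \<le> i" "i \<le> b"
  shows "(arr b g)(i \<mapsto> the (arr b g i) + e) = arr b (\<lambda>j. g j + (if j = i then e else 0))"
  using assms by (auto simp: arr_def fun_eq_iff)

text \<open>
  The effect of a program fragment that only adds to \<open>M'\<close>: entry \<open>y\<close> grows by \<open>F y\<close> and at most
  \<open>k\<close> operations are performed. Since the fragment stores nothing in fresh cells, the peak is
  bounded by what is stored at its start.
\<close>

definition adds :: "nat \<Rightarrow> (nat \<Rightarrow> int) \<Rightarrow> nat \<Rightarrow> state \<Rightarrow> state \<Rightarrow> bool" where
  "adds b F k \<sigma> \<sigma>' \<longleftrightarrow> (\<forall>g. mp \<sigma> = arr b g \<longrightarrow>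
     (\<exists>c p. c \<le> ops \<sigma> + k \<and> peak \<sigma> \<le> p \<and> p \<le> max (peak \<sigma>) (22 + card (dom (blk \<sigma>)) + b)
        \<and> \<sigma>' = \<sigma>\<lparr>mp := arr b (\<lambda>y. g y + F y), ops := c, peak := p\<rparr>))"

lemma addsE:
  assumes "adds b F k \<sigma> \<sigma>'" "mp \<sigma> = arr b g"
  obtains c p where "c \<le> ops \<sigma> + k" "peak \<sigma> \<le> p" "p \<le> max (peak \<sigma>) (22 + card (dom (blk \<sigma>)) + b)"
    "\<sigma>' = \<sigma>\<lparr>mp := arr b (\<lambda>y. g y + F y), ops := c, peak := p\<rparr>"
  using assms unfolding adds_def by blast

lemma addsI:
  assumes "\<And>g. mp \<sigma> = arr b g \<Longrightarrow> c \<le> ops \<sigma> + k" "\<And>g. mp \<sigma> = arr b g \<Longrightarrow> peak \<sigma> \<le> p"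
    "\<And>g. mp \<sigma> = arr b g \<Longrightarrow> p \<le> max (peak \<sigma>) (22 + card (dom (blk \<sigma>)) + b)"
    "\<And>g. mp \<sigma> = arr b g \<Longrightarrow> \<sigma>' = \<sigma>\<lparr>mp := arr b (\<lambda>y. g y + F y), ops := c, peak := p\<rparr>"
  shows "adds b F k \<sigma> \<sigma>'"
  using assms unfolding adds_def by blast

lemma adds_mono:
  assumes "adds b F k \<sigma> \<sigma>'" "k \<le> k'" "\<And>y. 1 \<le> y \<Longrightarrow> y \<le> b \<Longrightarrow> F y = F' y"
  shows "adds b F' k' \<sigma> \<sigma>'"
  unfolding adds_def
proof (intro allI impI)
  fix g assume g: "mp \<sigma> = arr b g"
  have *: "arr b (\<lambda>y. g y + F y) = arr b (\<lambda>y. g y + F' y)" by (rule arr_cong) (simp add: assms(3))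
  from assms(1) g obtain c p where "c \<le> ops \<sigma> + k" "peak \<sigma> \<le> p" "p \<le> max (peak \<sigma>) (22 + card (dom (blk \<sigma>)) + b)"
    "\<sigma>' = \<sigma>\<lparr>mp := arr b (\<lambda>y. g y + F y), ops := c, peak := p\<rparr>" by (rule addsE)
  then show "\<exists>c p. c \<le> ops \<sigma> + k' \<and> peak \<sigma> \<le> p \<and> p \<le> max (peak \<sigma>) (22 + card (dom (blk \<sigma>)) + b)
        \<and> \<sigma>' = \<sigma>\<lparr>mp := arr b (\<lambda>y. g y + F' y), ops := c, peak := p\<rparr>"
    using assms(2) unfolding * by (intro exI[of _ c] exI[of _ p]) auto
qed

lemma adds_refl: "adds b (\<lambda>_. 0) 0 \<sigma> \<sigma>"
proof (rule addsI[where c = "ops \<sigma>" and p = "peak \<sigma>"])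
  fix g assume "mp \<sigma> = arr b g"
  then show "\<sigma> = \<sigma>\<lparr>mp := arr b (\<lambda>y. g y + 0), ops := ops \<sigma>, peak := peak \<sigma>\<rparr>" by (cases \<sigma>) simp
qed auto

lemma adds_trans:
  assumes "adds b F k \<sigma> \<sigma>'" "adds b G l \<sigma>' \<sigma>''"
  shows "adds b (\<lambda>y. F y + G y) (k + l) \<sigma> \<sigma>''"
  unfolding adds_def
proof (intro allI impI)
  fix g assume g: "mp \<sigma> = arr b g"
  from assms(1) g obtain c p where 1: "c \<le> ops \<sigma> + k" "peak \<sigma> \<le> p" "p \<le> max (peak \<sigma>) (22 + card (dom (blk \<sigma>)) + b)"
    "\<sigma>' = \<sigma>\<lparr>mp := arr b (\<lambda>y. g y + F y), ops := c, peak := p\<rparr>" by (rule addsE)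
  then have "mp \<sigma>' = arr b (\<lambda>y. g y + F y)" by simp
  from addsE[OF assms(2) this] obtain c' p' where 2: "c' \<le> ops \<sigma>' + l" "peak \<sigma>' \<le> p'" "p' \<le> max (peak \<sigma>') (22 + card (dom (blk \<sigma>')) + b)"
    "\<sigma>'' = \<sigma>'\<lparr>mp := arr b (\<lambda>y. g y + F y + G y), ops := c', peak := p'\<rparr>" by blast
  show "\<exists>c p. c \<le> ops \<sigma> + (k + l) \<and> peak \<sigma> \<le> p \<and> p \<le> max (peak \<sigma>) (22 + card (dom (blk \<sigma>)) + b)
        \<and> \<sigma>'' = \<sigma>\<lparr>mp := arr b (\<lambda>y. g y + (F y + G y)), ops := c, peak := p\<rparr>"
    using 1 2 by (intro exI[of _ c'] exI[of _ p']) (auto simp: add.assoc)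
qed

lemma adds_tick: "adds b (\<lambda>_. 0) k \<sigma> (tick k \<sigma>)"
  by (rule addsI[where c = "ops \<sigma> + k" and p = "peak \<sigma>"]) (cases \<sigma>; auto simp: tick_def)+

lemma adds_tickI: "adds b F l \<sigma> \<sigma>' \<Longrightarrow> adds b F (l + k) \<sigma> (tick k \<sigma>')"
  by (rule adds_mono[OF adds_trans[OF _ adds_tick]]) auto

lemma adds_mp_add:
  assumes "1 \<le> i" "i \<le> b"
  shows "adds b (\<lambda>j. if j = i then e else 0) 3 \<sigma> (mp_add i e \<sigma>)"
  by (rule addsI[where c = "ops \<sigma> + 3" and p = "max (peak \<sigma>) (22 + card (dom (blk \<sigma>)) + b)"])
     (use assms in \<open>auto simp: arr_update mp_add_def tick_def record_peak_def stored_def\<close>)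

text \<open>The states \<open>\<sigma>\<lparr>mp := f, ops := c, peak := p\<rparr>\<close> are those reachable from \<open>\<sigma>\<close> inside the loop.\<close>

lemma adds_for_each:
  assumes "\<And>i f c p. i \<in> set xs \<Longrightarrow>
    adds b (F i) (k i) (\<sigma>\<lparr>mp := f, ops := c, peak := p\<rparr>) (body i (\<sigma>\<lparr>mp := f, ops := c, peak := p\<rparr>))"
  shows "adds b (\<lambda>y. \<Sum>i\<leftarrow>xs. F i y) (\<Sum>i\<leftarrow>xs. k i + 2) \<sigma> (for_each xs body \<sigma>)"
  using assms
proof (induction xs arbitrary: \<sigma>)
  case Nil
  then show ?case by (simp add: for_each_def adds_refl)
next
  case (Cons i xs)
  have step: "adds b (F i) (k i + 2) \<sigma> (tick 2 (body i \<sigma>))"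
    using Cons.prems[where i = i and f = "mp \<sigma>" and c = "ops \<sigma>" and p = "peak \<sigma>"] by (intro adds_tickI) simp
  have "adds b (\<lambda>y. F i y + (\<Sum>i\<leftarrow>xs. F i y)) ((k i + 2) + (\<Sum>i\<leftarrow>xs. k i + 2)) \<sigma>
         (for_each xs body (tick 2 (body i \<sigma>)))"
    unfolding adds_def
  proof (intro allI impI)
    fix g assume g: "mp \<sigma> = arr b g"
    from step g obtain c p where eq: "tick 2 (body i \<sigma>) = \<sigma>\<lparr>mp := arr b (\<lambda>y. g y + F i y), ops := c, peak := p\<rparr>"
      by (rule addsE)
    have "adds b (\<lambda>y. \<Sum>i\<leftarrow>xs. F i y) (\<Sum>i\<leftarrow>xs. k i + 2) (tick 2 (body i \<sigma>)) (for_each xs body (tick 2 (body i \<sigma>)))"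
      by (rule Cons.IH) (use Cons.prems in \<open>auto simp: eq\<close>)
    from adds_trans[OF step this] g
    show "\<exists>c p. c \<le> ops \<sigma> + (k i + 2 + (\<Sum>i\<leftarrow>xs. k i + 2)) \<and> peak \<sigma> \<le> p \<and> p \<le> max (peak \<sigma>) (22 + card (dom (blk \<sigma>)) + b)
        \<and> for_each xs body (tick 2 (body i \<sigma>)) = \<sigma>\<lparr>mp := arr b (\<lambda>y. g y + (F i y + (\<Sum>i\<leftarrow>xs. F i y))), ops := c, peak := p\<rparr>"
      unfolding adds_def by blast
  qed
  then show ?case by (simp add: for_each_def)
qed

text \<open>Fits the innermost loops of steps (2d) and (4), which keep adding to one entry.\<close>

lemma adds_for_each_const:
  assumes "distinct xs"
    "\<And>i f c p. i \<in> set xs \<Longrightarrow>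
    adds b (\<lambda>y. if y = j then h i else 0) k (\<sigma>\<lparr>mp := f, ops := c, peak := p\<rparr>) (body i (\<sigma>\<lparr>mp := f, ops := c, peak := p\<rparr>))"
  shows "adds b (\<lambda>y. if y = j then sum h (set xs) else 0) ((k + 2) * card (set xs)) \<sigma> (for_each xs body \<sigma>)"
proof (rule adds_mono[OF adds_for_each[of xs b "\<lambda>i y. if y = j then h i else 0" "\<lambda>_. k"]])
  show "(\<Sum>i\<leftarrow>xs. k + 2) \<le> (k + 2) * card (set xs)"
    using assms(1) by (simp add: sum_list_triv distinct_card mult.commute)
  show "(\<Sum>i\<leftarrow>xs. if y = j then h i else 0) = (if y = j then sum h (set xs) else 0)" for y
    using assms(1) by (simp add: sum_list_distinct_conv_sum_set)
qed (use assms in auto)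

text \<open>Fits step (2b) and the outer loops of steps (2d) and (4), where each iteration owns one
  entry.\<close>

lemma adds_for_each_upto:
  assumes "N \<le> b" "\<And>i f c p. 1 \<le> i \<Longrightarrow> i \<le> N \<Longrightarrow>
    adds b (\<lambda>y. if y = i then h i else 0) (k i) (\<sigma>\<lparr>mp := f, ops := c, peak := p\<rparr>) (body i (\<sigma>\<lparr>mp := f, ops := c, peak := p\<rparr>))"
  shows "adds b (\<lambda>y. if y \<le> N then h y else 0) (\<Sum>i=1..N. k i + 2) \<sigma> (for_each [1..<Suc N] body \<sigma>)"
proof (rule adds_mono[OF adds_for_each[of "[1..<Suc N]" b "\<lambda>i y. if y = i then h i else 0" "k"]])
  show "(\<Sum>i\<leftarrow>[1..<Suc N]. k i + 2) \<le> (\<Sum>i=1..N. k i + 2)"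
    by (simp only: interv_sum_list_conv_sum_set_nat set_upt) (simp add: atLeastLessThanSuc_atLeastAtMost)
  show "(\<Sum>i\<leftarrow>[1..<Suc N]. if y = i then h i else 0) = (if y \<le> N then h y else 0)" if "1 \<le> y" for y
    using that by (simp only: interv_sum_list_conv_sum_set_nat set_upt) (auto)
qed (use assms in \<open>auto simp del: upt_Suc\<close>)

section \<open>Quotients \<open>n div k\<close> on both sides of the square root\<close>

lemma root_quot_antimono:
  assumes "0 < y" "y \<le> y'"
  shows "root_quot n y' \<le> root_quot n y"
proof -
  have "root_quot n y' * root_quot n y' * y' \<le> n"
    using le_root_quot_iff[of y' "root_quot n y'" n] assms by simp
  moreover have "root_quot n y' * root_quot n y' * y \<le> root_quot n y' * root_quot n y' * y'"
    using assms by simp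
  ultimately have "root_quot n y' * root_quot n y' * y \<le> n" by (rule le_trans[rotated])
  then show ?thesis using le_root_quot_iff[of y] assms by simp
qed

text \<open>The assumption \<open>r < a\<close> lets the first phase finish before
  \<open>x = a\<close>, and it yields \<open>b \<le> s\<^sub>0\<close>, so that indices up to
  \<open>b\<close> are determined by their quotients.\<close>

locale alg_run =
  fixes n a b r s\<^sub>0 :: nat
  assumes n_pos: "1 \<le> n" and r_less: "r < a"
    and b_def: "b = n div a" and r_def: "r = root_quot n 1"
    and s0_def: "s\<^sub>0 = (if r = n div r then r - 1 else r)"
begin

abbreviation u :: "nat \<Rightarrow> nat" where "u \<equiv> root_quot n"

lemma le_r_iff: "x \<le> r \<longleftrightarrow> x * x \<le> n"
  using le_root_quot_iff[of 1 x n] by (simp add: r_def)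

lemma r_pos: "1 \<le> r"
  using n_pos by (simp add: le_r_iff)

lemma r_bounds: "r * r \<le> n" "n < (r + 1) * (r + 1)"
  using le_r_iff[of r] le_r_iff[of "r + 1"] by auto

lemma a_pos: "0 < a"
  using r_less by simp

lemma le_b_iff: "y \<le> b \<longleftrightarrow> a * y \<le> n"
  using a_pos by (simp add: b_def less_eq_div_iff_mult_less_eq mult.commute)

lemma u_le_r: "1 \<le> y \<Longrightarrow> u y \<le> r"
  unfolding r_def by (rule root_quot_antimono) auto

lemma u_pos: "1 \<le> y \<Longrightarrow> y \<le> b \<Longrightarrow> 1 \<le> u y"
proof -
  assume "1 \<le> y" "y \<le> b"
  then have "a * y \<le> n" by (simp add: le_b_iff)
  moreover have "y \<le> a * y" using a_pos by simp
  ultimately have "y \<le> n" by (rule le_trans[rotated])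
  then show ?thesis using \<open>1 \<le> y\<close> by (simp add: le_root_quot_iff)
qed

text \<open>The bounds on \<open>r\<close> settle every \<open>k\<close> except
  \<open>k = r\<close>: the condition fails for \<open>k > r\<close> and holds for
  \<open>k < r\<close>. At \<open>k = r\<close> it says \<open>r * (r + 1) \<le> n\<close>, and that
  is what the initial test \<open>r = n div r\<close> decides.\<close>

lemma le_s0_iff:
  assumes "1 \<le> k"
  shows "k \<le> s\<^sub>0 \<longleftrightarrow> r < n div k"
proof -
  have *: "r < n div k \<longleftrightarrow> (r + 1) * k \<le> n"
    using assms less_eq_div_iff_mult_less_eq[of k "r + 1" n] by auto
  show ?thesis
  proof (cases "r = n div r")
    case True
    have "n < r + r * (n div r)" using r_pos by (intro dividend_less_times_div) simp
    then have lt: "n < r * (r + 1)" by (simp flip: True)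
    have "k \<le> r - 1 \<longleftrightarrow> (r + 1) * k \<le> n"
    proof
      assume "k \<le> r - 1"
      then have "(r + 1) * k \<le> (r + 1) * (r - 1)" by (rule mult_le_mono2)
      also have "\<dots> \<le> r * r" by (cases r) auto
      finally show "(r + 1) * k \<le> n" using r_bounds by linarith
    next
      assume k: "(r + 1) * k \<le> n"
      show "k \<le> r - 1"
      proof (rule ccontr)
        assume "\<not> k \<le> r - 1"
        then have "(r + 1) * r \<le> (r + 1) * k" by (intro mult_le_mono2) simp
        then show False using k lt by (simp add: mult.commute)
      qed
    qed
    then show ?thesis using True s0_def * by simp
  next
    case False
    have "r \<le> n div r" using r_pos r_bounds by (simp add: less_eq_div_iff_mult_less_eq)
    then have "r + 1 \<le> n div r" using False by simp
    then have le: "(r + 1) * r \<le> n" using r_pos by (simp add: less_eq_div_iff_mult_less_eq)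
    have "k \<le> r \<longleftrightarrow> (r + 1) * k \<le> n"
    proof
      assume "k \<le> r"
      then have "(r + 1) * k \<le> (r + 1) * r" by (rule mult_le_mono2)
      then show "(r + 1) * k \<le> n" using le by simp
    next
      assume k: "(r + 1) * k \<le> n"
      show "k \<le> r"
      proof (rule ccontr)
        assume "\<not> k \<le> r"
        then have "(r + 1) * (r + 1) \<le> (r + 1) * k" by (intro mult_le_mono2) simp
        then show False using k r_bounds by simp
      qed
    qed
    then show ?thesis using False s0_def * by simp
  qed
qed

lemma s0_le_r: "s\<^sub>0 \<le> r"
  by (simp add: s0_def)

lemma a_le_div: "1 \<le> y \<Longrightarrow> y \<le> b \<Longrightarrow> a \<le> n div y"
  by (simp add: le_b_iff less_eq_div_iff_mult_less_eq)

lemma b_le_s0: "b \<le> s\<^sub>0"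
proof (cases "b = 0")
  case False
  then have "r < n div b" using a_le_div[of b] r_less by simp
  then show ?thesis using False by (simp add: le_s0_iff)
qed simp

text \<open>Here \<open>q = n div k\<close> exceeds \<open>k\<close>, whence
  \<open>n < k * q + k < (k + 1) * q\<close>. This is why step (3) can recover the index
  \<open>s\<close> as \<open>n div x\<close> and store the Mertens value under it.\<close>

lemma div_div_self:
  assumes "1 \<le> k" "k \<le> s\<^sub>0"
  shows "n div (n div k) = k"
proof -
  let ?q = "n div k"
  have q: "k < ?q" using assms le_s0_iff[of k] s0_le_r by simp
  have "n < k * ?q + k" using dividend_less_times_div[of k n] assms by simp
  then have "n < Suc k * ?q" using q by simp
  then have "n div ?q < Suc k" using less_mult_imp_div_less by blast
  moreover have "k \<le> n div ?q"
  proof -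
    have "0 < ?q" using q by simp
    then show ?thesis by (simp add: less_eq_div_iff_mult_less_eq times_div_less_eq_dividend)
  qed
  ultimately show ?thesis by simp
qed

lemma div_strict_antimono:
  assumes "1 \<le> k" "k < k'" "k' \<le> s\<^sub>0"
  shows "n div k' < n div k"
proof -
  have "n div k' \<noteq> n div k" using assms div_div_self[of k] div_div_self[of k'] by auto
  moreover have "n div k' \<le> n div k" using assms by (simp add: div_le_mono2)
  ultimately show ?thesis by simp
qed

lemma div_less_a: "b < k \<Longrightarrow> n div k < a"
  using le_b_iff[of k] a_pos by (simp add: div_less_iff_less_mult)

text \<open>For \<open>t * y \<le> s\<^sub>0\<close> the double quotient is \<open>t * y\<close>
  itself. For larger products the test against \<open>r\<close> fails, and so does
  \<open>t * y \<le> A\<close>.\<close>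

lemma step_4_range_set:
  assumes "1 \<le> y" "1 \<le> B" "A \<le> s\<^sub>0"
  shows "set (step_4_range n r A B y) = {t \<in> {2..u y}. B \<le> t * y \<and> t * y \<le> A}"
proof -
  have "(r < n div (t * y) \<and> B \<le> n div (n div (t * y)) \<and> n div (n div (t * y)) \<le> A) \<longleftrightarrow> B \<le> t * y \<and> t * y \<le> A"
    if "2 \<le> t" for t
  proof -
    have "1 \<le> t * y" using that assms by simp
    show ?thesis
    proof (cases "t * y \<le> s\<^sub>0")
      case True
      with le_s0_iff[OF \<open>1 \<le> t * y\<close>] div_div_self[OF \<open>1 \<le> t * y\<close> True] show ?thesis by simp
    next
      case False
      with le_s0_iff[OF \<open>1 \<le> t * y\<close>] assms(3) show ?thesis by simp
    qed
  qed
  then show ?thesis by (auto simp: step_4_range_def simp del: upt_Suc)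
qed

lemma distinct_step_4_range: "distinct (step_4_range n r A B y)"
  by (simp add: step_4_range_def del: upt_Suc)

end

subsection \<open>The individual steps\<close>

lemma while_induct:
  assumes "P s" "\<And>s. P s \<Longrightarrow> c s \<Longrightarrow> P (body s) \<and> f (body s) < (f s :: nat)"
  shows "P (while c body s) \<and> \<not> c (while c body s)"
  by (rule while_rule[where P = P and r = "measure f"]) (use assms in auto)

context alg_run
begin

text \<open>The loop bound \<open>y \<le> n div x div x\<close> is the condition
  \<open>x * x * y \<le> n\<close>, so the term for \<open>k = x\<close> reaches exactly the entries
  whose recursion contains it. An iteration costs 3 for the update, 2 for arithmetic and 2 for the
  loop.\<close>

lemma adds_step_2b:
  assumes "1 \<le> x"
  shows "adds b (\<lambda>y. if 1 < x \<and> x \<le> u y then - (moebius x * int (n div (x * y))) else 0)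
    (4 + 7 * card {y \<in> {1..b}. x \<le> u y}) \<sigma> (step_2b n b x \<sigma>)"
proof (cases "x > 1 \<and> moebius x \<noteq> 0")
  case True
  define N where "N = min b (n div x div x)"
  let ?body = "\<lambda>y \<sigma>. tick 2 (mp_add y (- (moebius x * int (n div x div y))) \<sigma>)"
  have N: "y \<le> N \<longleftrightarrow> x \<le> u y" if "1 \<le> y" "y \<le> b" for y
    using that assms by (simp add: N_def le_root_quot_iff less_eq_div_iff_mult_less_eq mult_ac)
  have "{y \<in> {1..b}. x \<le> u y} = {1..N}" using N by (auto simp: N_def)
  then have card: "card {y \<in> {1..b}. x \<le> u y} = N" by simp
  have "adds b (\<lambda>y. if y \<le> N then - (moebius x * int (n div x div y)) else 0)
      (\<Sum>i=1..N. 5 + 2) \<sigma> (for_each [1..<Suc N] ?body \<sigma>)"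
  proof (rule adds_for_each_upto)
    fix i f c p assume "1 \<le> i" "i \<le> N"
    let ?\<rho> = "\<sigma>\<lparr>mp := f, ops := c, peak := p\<rparr>"
    show "adds b (\<lambda>y. if y = i then - (moebius x * int (n div x div i)) else 0) 5 ?\<rho> (?body i ?\<rho>)"
      using adds_tickI[OF adds_mp_add[of i b "- (moebius x * int (n div x div i))" ?\<rho>], of 2]
        \<open>1 \<le> i\<close> \<open>i \<le> N\<close> by (simp add: N_def)
  qed (simp add: N_def)
  then have "adds b (\<lambda>y. if y \<le> N then - (moebius x * int (n div x div y)) else 0)
      ((\<Sum>i=1..N. 5 + 2) + 2 + 2) \<sigma> (tick 2 (tick 2 (for_each [1..<Suc N] ?body \<sigma>)))"
    by (intro adds_tickI)
  moreover have "step_2b n b x \<sigma> = tick 2 (tick 2 (for_each [1..<Suc N] ?body \<sigma>))"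
    using True by (simp add: step_2b_def N_def Let_def del: upt_Suc)
  ultimately have *: "adds b (\<lambda>y. if y \<le> N then - (moebius x * int (n div x div y)) else 0)
      ((\<Sum>i=1..N. 5 + 2) + 2 + 2) \<sigma> (step_2b n b x \<sigma>)" by (simp only:)
  show ?thesis
    by (rule adds_mono[OF *]) (use N True in \<open>simp_all only: card, simp_all add: div_mult2_eq\<close>)
next
  case False
  then have "step_2b n b x \<sigma> = tick 2 \<sigma>" by (auto simp: step_2b_def)
  moreover have "adds b (\<lambda>_. 0) 2 \<sigma> (tick 2 \<sigma>)" by (rule adds_tick)
  ultimately show ?thesis by (simp only:, elim adds_mono) (use False in auto)
qed

text \<open>As \<open>u\<close> is antitone, the \<open>y\<close> with \<open>u y = x\<close> are
  consecutive and lie directly above those with \<open>x < u y\<close>; the loop moves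
  \<open>d\<close> down through them. Charging 11 per unit of decrease makes the total cost
  telescope. At \<open>d = 0\<close> the value infinity of \<open>gam\<close> stops the
  loop.\<close>

lemma step_2c_result:
  assumes mp: "mp \<sigma> = arr b g" and gam: "gam \<sigma> = gamma_val n (state.d \<sigma>)"
    and d: "state.d \<sigma> \<le> b" "\<And>y. 1 \<le> y \<Longrightarrow> y \<le> b \<Longrightarrow> y \<le> state.d \<sigma> \<longleftrightarrow> x \<le> u y"
  obtains d' c p where "d' \<le> state.d \<sigma>" "\<And>y. 1 \<le> y \<Longrightarrow> y \<le> b \<Longrightarrow> y \<le> d' \<longleftrightarrow> x < u y"
    "c \<le> ops \<sigma> + 1 + 11 * (state.d \<sigma> - d')" "peak \<sigma> \<le> p" "p \<le> max (peak \<sigma>) (22 + card (dom (blk \<sigma>)) + b)"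
    "step_2c n x \<sigma> = \<sigma>\<lparr>state.d := d', gam := gamma_val n d', ops := c, peak := p,
      mp := arr b (\<lambda>y. g y + (if u y = x then 1 - int (n div y) + state.m \<sigma> * int x else 0))\<rparr>"
proof -
  let ?e = "\<lambda>y. 1 - int (n div y) + state.m \<sigma> * int x"
  let ?body = "(\<lambda>\<sigma>. let d = state.d \<sigma>;
                 \<sigma>' = mp_add d (1 - int (n div d) + state.m \<sigma> * int x) \<sigma>
             in tick 8 (\<sigma>'\<lparr>state.d := d - 1, gam := gamma_val n (d - 1)\<rparr>))"
  define P where "P = (\<lambda>\<tau>. \<exists>d' c p. d' \<le> state.d \<sigma> \<and> (\<forall>y. d' < y \<and> y \<le> state.d \<sigma> \<longrightarrow> u y = x) \<and>
    c \<le> ops \<sigma> + 11 * (state.d \<sigma> - d') \<and> peak \<sigma> \<le> p \<and> p \<le> max (peak \<sigma>) (22 + card (dom (blk \<sigma>)) + b) \<and>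
    \<tau> = \<sigma>\<lparr>state.d := d', gam := gamma_val n d', ops := c, peak := p,
      mp := arr b (\<lambda>y. g y + (if d' < y \<and> y \<le> state.d \<sigma> then ?e y else 0))\<rparr>)"
  let ?W = "while (\<lambda>\<sigma>. enat x = gam \<sigma>) ?body \<sigma>"
  have "P ?W \<and> \<not> enat x = gam ?W"
  proof (rule while_induct[where f = state.d])
    show "P \<sigma>"
      unfolding P_def using mp gam
      by (intro exI[of _ "state.d \<sigma>"] exI[of _ "ops \<sigma>"] exI[of _ "peak \<sigma>"]) (cases \<sigma>; auto simp: arr_def)
  next
    fix \<tau> assume "P \<tau>" and x: "enat x = gam \<tau>"
    then obtain d' c p where P: "d' \<le> state.d \<sigma>" "\<And>y. d' < y \<and> y \<le> state.d \<sigma> \<Longrightarrow> u y = x"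
      "c \<le> ops \<sigma> + 11 * (state.d \<sigma> - d')" "peak \<sigma> \<le> p" "p \<le> max (peak \<sigma>) (22 + card (dom (blk \<sigma>)) + b)"
      and \<tau>: "\<tau> = \<sigma>\<lparr>state.d := d', gam := gamma_val n d', ops := c, peak := p,
      mp := arr b (\<lambda>y. g y + (if d' < y \<and> y \<le> state.d \<sigma> then ?e y else 0))\<rparr>"
      unfolding P_def by blast
    have d': "1 \<le> d'" "u d' = x" "d' \<le> b" using x P(1) d(1) by (auto simp: \<tau> gamma_val_def split: if_splits)
    let ?h = "\<lambda>y. g y + (if d' < y \<and> y \<le> state.d \<sigma> then ?e y else 0)"
    have mp': "mp \<tau> = arr b ?h" by (simp add: \<tau>)
    from addsE[OF adds_mp_add[OF d'(1,3)] mp', of "?e d'"] obtain c' p' where c': "c' \<le> ops \<tau> + 3"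
      "peak \<tau> \<le> p'" "p' \<le> max (peak \<tau>) (22 + card (dom (blk \<tau>)) + b)"
      "mp_add d' (?e d') \<tau> = \<tau>\<lparr>mp := arr b (\<lambda>y. ?h y + (if y = d' then ?e d' else 0)), ops := c', peak := p'\<rparr>"
      by blast
    have arr: "arr b (\<lambda>y. ?h y + (if y = d' then ?e d' else 0))
      = arr b (\<lambda>y. g y + (if d' - 1 < y \<and> y \<le> state.d \<sigma> then ?e y else 0))"
      by (rule arr_cong) (use d' P(1) in auto)
    have body: "?body \<tau> = \<sigma>\<lparr>state.d := d' - 1, gam := gamma_val n (d' - 1), ops := c' + 8, peak := p',
      mp := arr b (\<lambda>y. g y + (if d' - 1 < y \<and> y \<le> state.d \<sigma> then ?e y else 0))\<rparr>"
    proof -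
      have "state.d \<tau> = d'" "state.m \<tau> = state.m \<sigma>" by (simp_all add: \<tau>)
      then show ?thesis unfolding Let_def
        by (simp only: c'(4)) (simp add: tick_def \<tau> arr)
    qed
    have "P (?body \<tau>)"
      unfolding P_def body
    proof (intro exI conjI)
      show "d' - 1 \<le> state.d \<sigma>" using P by simp
      show "\<forall>y. d' - 1 < y \<and> y \<le> state.d \<sigma> \<longrightarrow> u y = x"
      proof (intro allI impI)
        fix y assume "d' - 1 < y \<and> y \<le> state.d \<sigma>"
        then show "u y = x" using P(2)[of y] d' by (cases "y = d'") auto
      qed
      show "c' + 8 \<le> ops \<sigma> + 11 * (state.d \<sigma> - (d' - 1))" using c'(1) P(1,3) d'(1) by (simp add: \<tau>)
      show "peak \<sigma> \<le> p'" using c'(2) P by (simp add: \<tau>)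
      show "p' \<le> max (peak \<sigma>) (22 + card (dom (blk \<sigma>)) + b)" using c'(3) P by (simp add: \<tau>)
    qed (rule refl)
    moreover have "state.d (?body \<tau>) < state.d \<tau>" unfolding body using d' by (simp add: \<tau>)
    ultimately show "P (?body \<tau>) \<and> state.d (?body \<tau>) < state.d \<tau>" by blast
  qed
  then obtain d' c p where P: "d' \<le> state.d \<sigma>" "\<And>y. d' < y \<and> y \<le> state.d \<sigma> \<Longrightarrow> u y = x"
      "c \<le> ops \<sigma> + 11 * (state.d \<sigma> - d')" "peak \<sigma> \<le> p" "p \<le> max (peak \<sigma>) (22 + card (dom (blk \<sigma>)) + b)"
      and W: "?W = \<sigma>\<lparr>state.d := d', gam := gamma_val n d', ops := c, peak := p,
      mp := arr b (\<lambda>y. g y + (if d' < y \<and> y \<le> state.d \<sigma> then ?e y else 0))\<rparr>"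
      and ne: "enat x \<noteq> gam ?W"
    unfolding P_def by blast
  have x: "x < u y \<longleftrightarrow> y \<le> d'" if y: "1 \<le> y" "y \<le> b" for y
  proof
    assume "x < u y"
    then have "y \<le> state.d \<sigma>" using d(2) y by auto
    then show "y \<le> d'" using P(2)[of y] \<open>x < u y\<close> by (cases "y \<le> d'") auto
  next
    assume le: "y \<le> d'"
    then have "1 \<le> d'" using y by simp
    moreover have "enat x \<noteq> gamma_val n d'" using ne unfolding W by simp
    ultimately have "x \<noteq> u d'" by (simp add: gamma_val_def)
    moreover have "x \<le> u d'" using d(1) d(2)[of d'] P(1) \<open>1 \<le> d'\<close> by simp
    moreover have "u d' \<le> u y" using root_quot_antimono y le by simp
    ultimately show "x < u y" by simp
  qed
  have arr: "arr b (\<lambda>y. g y + (if d' < y \<and> y \<le> state.d \<sigma> then ?e y else 0))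
    = arr b (\<lambda>y. g y + (if u y = x then ?e y else 0))"
  proof (rule arr_cong)
    fix y assume y: "1 \<le> y" "y \<le> b"
    have "d' < y \<and> y \<le> state.d \<sigma> \<longleftrightarrow> u y = x" using x[OF y] d(2)[OF y] by auto
    then show "g y + (if d' < y \<and> y \<le> state.d \<sigma> then ?e y else 0) = g y + (if u y = x then ?e y else 0)" by simp
  qed
  have "step_2c n x \<sigma> = \<sigma>\<lparr>state.d := d', gam := gamma_val n d', ops := c + 1, peak := p,
      mp := arr b (\<lambda>y. g y + (if u y = x then ?e y else 0))\<rparr>"
    unfolding step_2c_def W arr by (simp add: tick_def)
  from that[OF P(1) _ _ P(4,5) this] show ?thesis using x P(3) by auto
qed

lemma step_2d_result:
  assumes mp: "mp \<sigma> = arr b g" and flush: "b dvd x \<or> x = r"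
    and blk: "blk \<sigma> = (\<lambda>i. if lo < i \<and> i \<le> x then Some (mertens i) else None)"
    and lo: "lo < x" "x \<le> r"
  obtains c p where "c \<le> ops \<sigma> + 5 + 11 * b + 8 * (\<Sum>y=1..b. card {l \<in> {2..u y}. lo < n div (l * y) \<and> n div (l * y) \<le> x})"
    "peak \<sigma> \<le> p" "p \<le> max (peak \<sigma>) (22 + card (dom (blk \<sigma>)) + b)"
    "step_2d n b r x \<sigma> = \<sigma>\<lparr>state.A := lo + 1, blk := Map.empty, ops := c, peak := p,
      mp := arr b (\<lambda>y. g y - (\<Sum>l | l \<in> {2..u y} \<and> lo < n div (l * y) \<and> n div (l * y) \<le> x. mertens (n div (l * y))))\<rparr>"
proof -
  let ?S = "\<lambda>y. {l \<in> {2..u y}. lo < n div (l * y) \<and> n div (l * y) \<le> x}"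
  have Min: "Min (dom (blk \<sigma>)) = lo + 1"
    by (rule Min_eqI) (use lo in \<open>auto simp: blk dom_def split: if_splits\<close>)
  let ?lmin = "\<lambda>t. 1 + n div (t * (x + 1))"
  let ?lmax = "\<lambda>t. min (u t) (n div (t * (lo + 1)))"
  have S: "set [?lmin t..<Suc (?lmax t)] = ?S t" if t: "1 \<le> t" "t \<le> b" for t
  proof -
    have *: "l \<in> set [?lmin t..<Suc (?lmax t)] \<longleftrightarrow> l \<in> ?S t" for l
    proof (cases "2 \<le> l")
      case True
      have 1: "?lmin t \<le> l \<longleftrightarrow> n div (l * t) \<le> x"
      proof -
        have "?lmin t \<le> l \<longleftrightarrow> n div (t * (x + 1)) < l" by auto
        also have "\<dots> \<longleftrightarrow> n < l * (t * (x + 1))" using t by (simp add: div_less_iff_less_mult)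
        also have "\<dots> \<longleftrightarrow> n div (l * t) < x + 1" using t True by (simp add: div_less_iff_less_mult mult_ac)
        finally show ?thesis by auto
      qed
      have 2: "l \<le> n div (t * (lo + 1)) \<longleftrightarrow> lo < n div (l * t)"
      proof -
        have "l \<le> n div (t * (lo + 1)) \<longleftrightarrow> l * (t * (lo + 1)) \<le> n"
          using t by (simp add: less_eq_div_iff_mult_less_eq)
        also have "\<dots> \<longleftrightarrow> lo + 1 \<le> n div (l * t)"
          using t True less_eq_div_iff_mult_less_eq[of "l * t" "lo + 1" n] by (simp only: mult_ac) auto
        finally show ?thesis by auto
      qed
      show ?thesis using 1 2 True by (auto simp del: upt_Suc)
    next
      case False
      \<comment> \<open>The program does not exclude \<open>l = 1\<close> explicitly. It is excluded
        because \<open>x + 1 \<le> r + 1 \<le> a\<close> gives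
        \<open>t * (x + 1) \<le> a * b \<le> n\<close>.\<close>
      moreover have "2 \<le> ?lmin t"
      proof -
        have "(x + 1) * t \<le> a * t" using lo r_less by (intro mult_le_mono1) simp
        then have "t * (x + 1) \<le> n" using t by (simp add: le_b_iff mult.commute)
        then have "1 \<le> n div (t * (x + 1))" using t by (simp add: less_eq_div_iff_mult_less_eq)
        then show ?thesis by simp
      qed
      ultimately show ?thesis by (auto simp del: upt_Suc)
    qed
    then show ?thesis by blast
  qed
  let ?inner = "\<lambda>t l \<sigma>. tick 3 (mp_add t (- the (blk \<sigma> (n div (l * t)))) \<sigma>)"
  let ?body = "\<lambda>t \<sigma>. tick 9 (for_each [?lmin t..<Suc (?lmax t)] (?inner t) \<sigma>)"
  let ?h = "\<lambda>y. \<Sum>l\<in>?S y. - mertens (n div (l * y))"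
  define \<tau> where "\<tau> = tick 1 (\<sigma>\<lparr>state.A := lo + 1\<rparr>)"
  define \<sigma>' where "\<sigma>' = for_each [1..<Suc b] ?body \<tau>"
  have "adds b (\<lambda>y. if y \<le> b then ?h y else 0) (\<Sum>y=1..b. (8 * card (?S y) + 9) + 2) \<tau> \<sigma>'"
    unfolding \<sigma>'_def
  proof (rule adds_for_each_upto[OF le_refl])
    fix t f c p assume t: "1 \<le> t" "t \<le> b"
    let ?\<rho> = "\<tau>\<lparr>mp := f, ops := c, peak := p\<rparr>"
    have "adds b (\<lambda>y. if y = t then \<Sum>l\<in>set [?lmin t..<Suc (?lmax t)]. - mertens (n div (l * t)) else 0)
            ((6 + 2) * card (set [?lmin t..<Suc (?lmax t)])) ?\<rho> (for_each [?lmin t..<Suc (?lmax t)] (?inner t) ?\<rho>)"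
    proof (rule adds_for_each_const)
      fix l f c p assume l: "l \<in> set [?lmin t..<Suc (?lmax t)]"
      let ?\<rho>' = "?\<rho>\<lparr>mp := f, ops := c, peak := p\<rparr>"
      have "l \<in> ?S t" using l by (simp only: S[OF t])
      then have "blk ?\<rho>' (n div (l * t)) = Some (mertens (n div (l * t)))"
        by (simp add: \<tau>_def tick_def blk)
      then show "adds b (\<lambda>y. if y = t then - mertens (n div (l * t)) else 0) 6 ?\<rho>' (?inner t l ?\<rho>')"
        using adds_tickI[OF adds_mp_add[OF t, of "- mertens (n div (l * t))" ?\<rho>'], of 3] by simp
    qed (simp del: upt_Suc)
    then have "adds b (\<lambda>y. if y = t then ?h t else 0) (8 * card (?S t)) ?\<rho> (for_each [?lmin t..<Suc (?lmax t)] (?inner t) ?\<rho>)"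
      unfolding S[OF t] by simp
    then show "adds b (\<lambda>y. if y = t then ?h t else 0) (8 * card (?S t) + 9) ?\<rho> (?body t ?\<rho>)"
      by (rule adds_tickI)
  qed
  moreover have "mp \<tau> = arr b g" using mp by (simp add: \<tau>_def tick_def)
  ultimately obtain c p where c: "c \<le> ops \<tau> + (\<Sum>y=1..b. (8 * card (?S y) + 9) + 2)" "peak \<tau> \<le> p"
    "p \<le> max (peak \<tau>) (22 + card (dom (blk \<tau>)) + b)"
    "\<sigma>' = \<tau>\<lparr>mp := arr b (\<lambda>y. g y + (if y \<le> b then ?h y else 0)), ops := c, peak := p\<rparr>"
    by (rule addsE)
  have arr: "arr b (\<lambda>y. g y + (if y \<le> b then ?h y else 0)) = arr b (\<lambda>y. g y - (\<Sum>l\<in>?S y. mertens (n div (l * y))))"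
    by (rule arr_cong) (simp add: sum_negf)
  have "step_2d n b r x \<sigma> = tick 3 (blk_clear \<sigma>')"
    unfolding step_2d_def Let_def Min \<sigma>'_def \<tau>_def using flush by (simp only: if_True)
  also have "\<dots> = \<sigma>\<lparr>state.A := lo + 1, blk := Map.empty, ops := c + 4, peak := p,
      mp := arr b (\<lambda>y. g y - (\<Sum>l\<in>?S y. mertens (n div (l * y))))\<rparr>"
    by (simp add: c(4) \<tau>_def arr tick_def blk_clear_def)
  finally have eq: "step_2d n b r x \<sigma> = \<sigma>\<lparr>state.A := lo + 1, blk := Map.empty, ops := c + 4, peak := p,
      mp := arr b (\<lambda>y. g y - (\<Sum>l\<in>?S y. mertens (n div (l * y))))\<rparr>" .
  have \<tau>: "ops \<tau> = ops \<sigma> + 1" "peak \<tau> = peak \<sigma>" "blk \<tau> = blk \<sigma>" by (simp_all add: \<tau>_def tick_def)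
  have sum: "(\<Sum>y=1..b. (8 * card (?S y) + 9) + 2) = 8 * (\<Sum>y=1..b. card (?S y)) + 11 * b"
    by (simp add: sum.distrib sum_distrib_left)
  have cost: "c + 4 \<le> ops \<sigma> + 5 + 11 * b + 8 * (\<Sum>y=1..b. card (?S y))"
    using c(1) unfolding \<tau> sum by linarith
  show ?thesis by (rule that[OF cost c(2,3)[unfolded \<tau>] eq])
qed

lemma step_2d_no_flush:
  "\<not> (b dvd x \<or> x = r) \<Longrightarrow> step_2d n b r x \<sigma> = tick 3 \<sigma>"
  by (simp add: step_2d_def)

lemma step_4_result:
  assumes mp: "mp \<sigma> = arr b g" and flush: "x = a \<or> (x > r \<and> card (dom (blk \<sigma>)) = b)"
    and blk: "blk \<sigma> = (\<lambda>i. if lo < i \<and> i \<le> hi then Some (mertens (n div i)) else None)"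
    and lo: "lo < hi" "hi \<le> s\<^sub>0" and AB: "state.A \<sigma> = hi" "state.B \<sigma> = lo + 1"
  obtains c p where "c \<le> ops \<sigma> + 5 + 22 * b + 7 * (\<Sum>y=1..b. card {t \<in> {2..u y}. lo < t * y \<and> t * y \<le> hi})"
    "peak \<sigma> \<le> p" "p \<le> max (peak \<sigma>) (22 + card (dom (blk \<sigma>)) + b)"
    "step_4 n a b r x \<sigma> = \<sigma>\<lparr>blk := Map.empty, ops := c, peak := p,
      mp := arr b (\<lambda>y. g y - (\<Sum>t | t \<in> {2..u y} \<and> lo < t * y \<and> t * y \<le> hi. mertens (n div (t * y))))\<rparr>"
proof -
  let ?S = "\<lambda>y. {t \<in> {2..u y}. lo < t * y \<and> t * y \<le> hi}"
  have S: "set (step_4_range n r hi (lo + 1) y) = ?S y" if "1 \<le> y" for y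
    using step_4_range_set[OF that _ lo(2), of "lo + 1"] by (simp add: Suc_le_eq)
  let ?inner = "\<lambda>y t \<sigma>. tick 2 (mp_add y (- the (blk \<sigma> (t * y))) \<sigma>)"
  let ?body = "\<lambda>y \<sigma>. tick 20 (for_each (step_4_range n r (state.A \<sigma>) (state.B \<sigma>) y) (?inner y) \<sigma>)"
  let ?h = "\<lambda>y. \<Sum>t\<in>?S y. - mertens (n div (t * y))"
  define \<sigma>' where "\<sigma>' = for_each [1..<Suc b] ?body \<sigma>"
  have "adds b (\<lambda>y. if y \<le> b then ?h y else 0) (\<Sum>y=1..b. (7 * card (?S y) + 20) + 2) \<sigma> \<sigma>'"
    unfolding \<sigma>'_def
  proof (rule adds_for_each_upto[OF le_refl])
    fix y f c p assume y: "1 \<le> y" "y \<le> b"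
    let ?\<rho> = "\<sigma>\<lparr>mp := f, ops := c, peak := p\<rparr>"
    let ?R = "step_4_range n r hi (lo + 1) y"
    have "adds b (\<lambda>j. if j = y then \<Sum>t\<in>set ?R. - mertens (n div (t * y)) else 0)
            ((5 + 2) * card (set ?R)) ?\<rho> (for_each ?R (?inner y) ?\<rho>)"
    proof (rule adds_for_each_const[OF distinct_step_4_range])
      fix t f c p assume t: "t \<in> set ?R"
      let ?\<rho>' = "?\<rho>\<lparr>mp := f, ops := c, peak := p\<rparr>"
      have "t \<in> ?S y" using t by (simp only: S[OF y(1)])
      then have "blk ?\<rho>' (t * y) = Some (mertens (n div (t * y)))"
        by (simp add: blk)
      then show "adds b (\<lambda>j. if j = y then - mertens (n div (t * y)) else 0) 5 ?\<rho>' (?inner y t ?\<rho>')"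
        using adds_tickI[OF adds_mp_add[OF y, of "- mertens (n div (t * y))" ?\<rho>'], of 2] by simp
    qed
    then have "adds b (\<lambda>j. if j = y then ?h y else 0) (7 * card (?S y)) ?\<rho> (for_each ?R (?inner y) ?\<rho>)"
      unfolding S[OF y(1)] by simp
    moreover have "?body y ?\<rho> = tick 20 (for_each ?R (?inner y) ?\<rho>)" using AB by simp
    ultimately show "adds b (\<lambda>j. if j = y then ?h y else 0) (7 * card (?S y) + 20) ?\<rho> (?body y ?\<rho>)"
      by (simp only: adds_tickI)
  qed
  from addsE[OF this mp] obtain c p where c: "c \<le> ops \<sigma> + (\<Sum>y=1..b. (7 * card (?S y) + 20) + 2)" "peak \<sigma> \<le> p"
    "p \<le> max (peak \<sigma>) (22 + card (dom (blk \<sigma>)) + b)"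
    "\<sigma>' = \<sigma>\<lparr>mp := arr b (\<lambda>y. g y + (if y \<le> b then ?h y else 0)), ops := c, peak := p\<rparr>"
    by blast
  have arr: "arr b (\<lambda>y. g y + (if y \<le> b then ?h y else 0)) = arr b (\<lambda>y. g y - (\<Sum>t\<in>?S y. mertens (n div (t * y))))"
    by (rule arr_cong) (simp add: sum_negf)
  have "blk \<sigma> hi \<noteq> None" using lo by (simp add: blk)
  then have "blk \<sigma> \<noteq> Map.empty" by auto
  then have "step_4 n a b r x \<sigma> = tick 4 (blk_clear \<sigma>')"
    unfolding step_4_def Let_def \<sigma>'_def using flush by (simp only: if_True if_False)
  also have "\<dots> = \<sigma>\<lparr>blk := Map.empty, ops := c + 5, peak := p,
      mp := arr b (\<lambda>y. g y - (\<Sum>t\<in>?S y. mertens (n div (t * y))))\<rparr>"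
    by (simp add: c(4) arr tick_def blk_clear_def)
  finally have eq: "step_4 n a b r x \<sigma> = \<sigma>\<lparr>blk := Map.empty, ops := c + 5, peak := p,
      mp := arr b (\<lambda>y. g y - (\<Sum>t\<in>?S y. mertens (n div (t * y))))\<rparr>" .
  have sum: "(\<Sum>y=1..b. (7 * card (?S y) + 20) + 2) = 7 * (\<Sum>y=1..b. card (?S y)) + 22 * b"
    by (simp add: sum.distrib sum_distrib_left)
  have cost: "c + 5 \<le> ops \<sigma> + 5 + 22 * b + 7 * (\<Sum>y=1..b. card (?S y))"
    using c(1) unfolding sum by linarith
  show ?thesis by (rule that[OF cost c(2,3) eq])
qed

lemma step_4_no_flush:
  "\<not> (x = a \<or> (x > r \<and> card (dom (blk \<sigma>)) = b)) \<or> blk \<sigma> = Map.empty \<Longrightarrow> step_4 n a b r x \<sigma> = tick 4 \<sigma>"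
  by (auto simp: step_4_def)

end

subsection \<open>The phase \<open>x \<le> r\<close>\<close>

lemma card_dom_interval: "card (dom (\<lambda>i. if lo < i \<and> i \<le> hi then Some (f i) else None)) = hi - (lo::nat)"
proof -
  have "dom (\<lambda>i. if lo < i \<and> i \<le> hi then Some (f i) else None) = {lo<..hi}"
    by (auto split: if_splits)
  then show ?thesis by simp
qed

lemma mertens_Suc: "mertens (Suc x) = mertens x + moebius (Suc x)"
  by (simp add: mertens_def)

context alg_run
begin

definition X_part :: "nat \<Rightarrow> int" where
  "X_part x = (\<Sum>k = 1..x. moebius k * (int (n div k) * (int (n div k) + 1) div 2))"

lemma X_part_Suc: "X_part (Suc x) = X_part x + moebius (Suc x) * (int (n div Suc x) * (int (n div Suc x) + 1) div 2)"
  by (simp add: X_part_def)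

text \<open>The last \<open>x\<close> at which \<open>\<M>\<close> has been emptied during the phase \<open>x \<le> r\<close>.\<close>

definition flushed :: "nat \<Rightarrow> nat" where
  "flushed x = (if x = r then r else b * (x div b))"

lemma flushed_le: "flushed x \<le> x"
  by (simp add: flushed_def)

lemma flushed_Suc_flush:
  assumes "b dvd Suc x \<or> Suc x = r" shows "flushed (Suc x) = Suc x"
  using assms by (auto simp: flushed_def)

lemma flushed_Suc_no_flush:
  assumes "\<not> (b dvd Suc x \<or> Suc x = r)" "x < r" shows "flushed (Suc x) = flushed x"
proof -
  have "Suc x mod b \<noteq> 0" using assms by (auto simp: dvd_eq_mod_eq_0)
  then have "Suc x div b = x div b" by (simp add: div_Suc)
  then show ?thesis using assms by (simp add: flushed_def)
qed

lemma block_size: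
  assumes "x < r" "0 < b" shows "Suc x - flushed x \<le> b"
proof -
  have "x mod b < b" using assms by simp
  moreover have "x = b * (x div b) + x mod b" by simp
  moreover have "flushed x = b * (x div b)" using assms by (simp add: flushed_def)
  ultimately show ?thesis by linarith
qed

text \<open>An emptying before \<open>x = r\<close> always ends a window of exactly \<open>b\<close>
  arguments, so the growth of \<open>11 * flushed x\<close> in \<open>cost1\<close> pays for its
  \<open>11 * b\<close> operations. Only the emptying at \<open>r\<close> may come early.\<close>

lemma flushed_step:
  assumes "b dvd Suc x" "Suc x \<noteq> r" "x < r" shows "b + flushed x = Suc x"
proof -
  obtain q where q: "Suc x = b * q" using assms(1) by (auto elim: dvdE)
  then have "0 < b" "0 < q" by (auto intro: Nat.gr0I)
  then obtain q' where q': "q = Suc q'" by (cases q) auto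
  have "x div b = q'" by (rule div_nat_eqI) (use q \<open>0 < b\<close> in \<open>auto simp: q' mult.commute\<close>)
  then show ?thesis using q assms(3) by (simp add: flushed_def q')
qed

definition low_terms :: "nat \<Rightarrow> nat \<Rightarrow> nat set" where
  "low_terms z y = {t \<in> {2..u y}. n div (t * y) \<le> z}"

definition high_terms :: "nat \<Rightarrow> nat \<Rightarrow> nat set" where
  "high_terms z y = {t \<in> {2..u y}. z < t * y}"

definition M_at :: "nat \<Rightarrow> nat \<Rightarrow> int" where
  "M_at y t = mertens (n div (t * y))"

text \<open>The three summands are the contributions of steps (2c), (2b) and (2d). The last one
  stops at \<open>flushed x\<close>, because values still in the block have not been subtracted
  yet.\<close>

definition mp1 :: "nat \<Rightarrow> nat \<Rightarrow> int" where
  "mp1 x y = (if u y \<le> x then 1 - int (n div y) + int (u y) * mertens (u y) else 0)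
    - (\<Sum>k = 2..min x (u y). moebius k * int (n div (k * y)))
    - sum (M_at y) (low_terms (flushed x) y)"

text \<open>For the phase \<open>x > r\<close>: steps (2b) and (2c) have contributed everything, and
  the terms are subtracted by decreasing index \<open>t * y\<close>, down to but excluding
  \<open>z\<close>.\<close>

definition mp2 :: "nat \<Rightarrow> nat \<Rightarrow> int" where
  "mp2 z y = 1 - int (n div y) + int (u y) * mertens (u y)
    - (\<Sum>k = 2..u y. moebius k * int (n div (k * y)))
    - sum (M_at y) (high_terms z y)"

text \<open>An amortised bound: 40 covers the constant work of a pass, and the other terms grow with
  the work they pay for. The final \<open>11 * b\<close> is for the possibly partial window emptied
  at \<open>r\<close>.\<close>

definition cost1 :: "nat \<Rightarrow> nat \<Rightarrow> nat" where
  "cost1 x d = 10 + b + 40 * x + 7 * (\<Sum>k = 1..x. card {y \<in> {1..b}. k \<le> u y}) + 11 * (b - d)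
    + 11 * flushed x + 8 * (\<Sum>y = 1..b. card (low_terms (flushed x) y)) + (if x = r then 11 * b else 0)"

text \<open>The upper bound on the peak is guarded because for \<open>b = 0\<close> no positive
  \<open>x\<close> is a multiple of \<open>b\<close>, and the block then grows until
  \<open>x = r\<close>.\<close>

definition inv1 :: "nat \<Rightarrow> state \<Rightarrow> bool" where
  "inv1 x \<sigma> \<longleftrightarrow> state.X \<sigma> = X_part x \<and> state.Y \<sigma> = 0 \<and> state.m \<sigma> = mertens x
    \<and> state.s \<sigma> = s\<^sub>0 \<and> chi \<sigma> = chi_val n s\<^sub>0
    \<and> state.d \<sigma> \<le> b \<and> (\<forall>y. 1 \<le> y \<longrightarrow> y \<le> b \<longrightarrow> (y \<le> state.d \<sigma> \<longleftrightarrow> x < u y)) \<and> gam \<sigma> = gamma_val n (state.d \<sigma>)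
    \<and> blk \<sigma> = (\<lambda>i. if flushed x < i \<and> i \<le> x then Some (mertens i) else None)
    \<and> mp \<sigma> = arr b (mp1 x) \<and> ops \<sigma> \<le> cost1 x (state.d \<sigma>)
    \<and> 22 + b \<le> peak \<sigma> \<and> (0 < b \<longrightarrow> peak \<sigma> \<le> 22 + 2 * b)"

lemma finite_low_terms [simp]: "finite (low_terms z y)"
  by (simp add: low_terms_def)

lemma finite_high_terms [simp]: "finite (high_terms z y)"
  by (simp add: high_terms_def)

lemma low_terms_split:
  assumes "z \<le> z'"
  shows "low_terms z' y = low_terms z y \<union> {t \<in> {2..u y}. z < n div (t * y) \<and> n div (t * y) \<le> z'}"
  using assms by (auto simp: low_terms_def)

lemma high_terms_split:
  assumes "z \<le> z'"
  shows "high_terms z y = high_terms z' y \<union> {t \<in> {2..u y}. z < t * y \<and> t * y \<le> z'}"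
  using assms by (auto simp: high_terms_def)

lemma sum_low_terms:
  "z \<le> z' \<Longrightarrow> sum f (low_terms z' y) = sum f (low_terms z y) + sum f {t \<in> {2..u y}. z < n div (t * y) \<and> n div (t * y) \<le> z'}"
  by (subst low_terms_split, assumption, rule sum.union_disjoint) (auto simp: low_terms_def)

lemma card_low_terms:
  "z \<le> z' \<Longrightarrow> card (low_terms z' y) = card (low_terms z y) + card {t \<in> {2..u y}. z < n div (t * y) \<and> n div (t * y) \<le> z'}"
  unfolding card_eq_sum by (rule sum_low_terms)

lemma sum_high_terms:
  "z \<le> z' \<Longrightarrow> sum f (high_terms z y) = sum f (high_terms z' y) + sum f {t \<in> {2..u y}. z < t * y \<and> t * y \<le> z'}"
  by (subst high_terms_split, assumption, rule sum.union_disjoint) (auto simp: high_terms_def)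

lemma card_high_terms:
  "z \<le> z' \<Longrightarrow> card (high_terms z y) = card (high_terms z' y) + card {t \<in> {2..u y}. z < t * y \<and> t * y \<le> z'}"
  unfolding card_eq_sum by (rule sum_high_terms)

lemma terms_le_n:
  assumes "1 \<le> y" "t \<in> {2..u y}" shows "t * y \<le> n"
proof -
  have "t * t * y \<le> n" using assms le_root_quot_iff[of y t n] by auto
  moreover have "t * y \<le> t * t * y" using assms(2) by simp
  ultimately show ?thesis by (rule le_trans[rotated])
qed

lemma main_step_eq:
  "main_step n a x \<sigma> = step_5 a b x (step_4 n a b r x
     (if x \<le> r then step_2d n b r x (step_2c n x (step_2b n b x (step_2a x (tick 1 (step_1 n x \<sigma>)))))
      else step_3 n b x (tick 1 (step_1 n x \<sigma>))))"
  by (simp only: main_step_def Let_def b_def[symmetric] r_def[symmetric])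

lemma inv1_init: "inv1 0 (init n a)"
proof -
  have init: "init n a = record_peak
         \<lparr>state.X = 0, Y = 0, Z = 0, m = 0, d = b, s = s\<^sub>0,
          chi = chi_val n s\<^sub>0, gam = gamma_val n b, A = 0, B = 0,
          blk = Map.empty, mp = arr b (\<lambda>_. 0), ops = 10 + b, peak = 0\<rparr>"
    by (simp add: init_def arr_def Let_def del: One_nat_def flip: b_def r_def s0_def)
  have f0: "flushed 0 = 0" using r_pos by (simp add: flushed_def)
  have low0: "low_terms 0 y = {}" if "1 \<le> y" for y
    using terms_le_n[OF that] that by (auto simp: low_terms_def div_eq_0_iff not_less)
  have "arr b (\<lambda>_. 0) = arr b (mp1 0)"
  proof (rule arr_cong)
    fix y assume "1 \<le> y" "y \<le> b"
    then show "0 = mp1 0 y" using u_pos[of y] by (simp add: mp1_def f0 low0)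
  qed
  moreover have "y \<le> b \<longleftrightarrow> 0 < u y" if "1 \<le> y" "y \<le> b" for y using u_pos[OF that] that by simp
  moreover have blk0: "(\<lambda>i. if 0 < i \<and> i = 0 then Some (mertens i) else None) = (\<lambda>_. None)" by (rule ext) auto
  ultimately show ?thesis
    using blk0 by (simp add: inv1_def init record_peak_def stored_def X_part_def mertens_def f0 cost1_def)
qed

lemma mp1_Suc:
  assumes "1 \<le> y" "y \<le> b"
  shows "mp1 x y + (if 1 < Suc x \<and> Suc x \<le> u y then - (moebius (Suc x) * int (n div (Suc x * y))) else 0)
      + (if u y = Suc x then 1 - int (n div y) + mertens (Suc x) * int (Suc x) else 0)
      - (sum (M_at y) (low_terms (flushed (Suc x)) y) - sum (M_at y) (low_terms (flushed x) y))
    = mp1 (Suc x) y"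
proof -
  have "(\<Sum>k = 2..min (Suc x) (u y). moebius k * int (n div (k * y)))
      = (\<Sum>k = 2..min x (u y). moebius k * int (n div (k * y)))
      + (if 1 < Suc x \<and> Suc x \<le> u y then moebius (Suc x) * int (n div (Suc x * y)) else 0)"
  proof (cases "Suc x \<le> u y")
    case True
    then show ?thesis by (cases "x = 0") (simp_all add: min_absorb1)
  next
    case False
    then show ?thesis by (simp add: min_absorb2)
  qed
  then show ?thesis by (auto simp: mp1_def)
qed

lemma inv1_step:
  assumes inv: "inv1 x \<sigma>" and x: "x < r"
  shows "inv1 (Suc x) (tick 2 (main_step n a (Suc x) \<sigma>))"
proof -
  let ?x = "Suc x"
  let ?dv = "card {y \<in> {1..b}. ?x \<le> u y}"
  note inv = inv[unfolded inv1_def]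
  define B2 where "B2 = (\<lambda>i. if flushed x < i \<and> i \<le> ?x then Some (mertens i) else None)"
  have blk: "(\<lambda>i. if flushed x < i \<and> i \<le> x then Some (mertens i) else None)(?x \<mapsto> mertens ?x) = B2"
    using flushed_le[of x] by (auto simp: B2_def fun_eq_iff)
  have cardB2: "card (dom B2) = ?x - flushed x" unfolding B2_def by (rule card_dom_interval)
  \<comment> \<open>Only the write of step (2a) can occupy a new cell. The other steps of this pass
    write to \<open>M'\<close> inside its domain, so the peak remains \<open>p2\<close>.\<close>
  define p2 where "p2 = max (peak \<sigma>) (22 + (?x - flushed x) + b)"
  have p2: "22 + b \<le> p2" "0 < b \<Longrightarrow> p2 \<le> 22 + 2 * b" "22 + (?x - flushed x) + b \<le> p2"
    using inv block_size[OF x] by (auto simp: p2_def)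
  define \<tau>2 where "\<tau>2 = step_2a ?x (tick 1 (step_1 n ?x \<sigma>))"
  have \<tau>2: "\<tau>2 = \<sigma>\<lparr>state.m := mertens ?x, state.X := X_part ?x, blk := B2, ops := ops \<sigma> + 9, peak := p2\<rparr>"
    using inv by (simp add: \<tau>2_def step_2a_def step_1_def tick_def blk_write_def record_peak_def stored_def
        Let_def mertens_Suc[symmetric] X_part_Suc[symmetric] blk cardB2 p2_def del: dom_fun_upd)
  define \<tau>3 where "\<tau>3 = step_2b n b ?x \<tau>2"
  have "mp \<tau>2 = arr b (mp1 x)" using inv by (simp add: \<tau>2)
  from addsE[OF adds_step_2b[of ?x \<tau>2] this] obtain c3 p3 where
    c3: "c3 \<le> ops \<tau>2 + (4 + 7 * ?dv)" "peak \<tau>2 \<le> p3" "p3 \<le> max (peak \<tau>2) (22 + card (dom (blk \<tau>2)) + b)"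
    and \<tau>3': "step_2b n b ?x \<tau>2 = \<tau>2\<lparr>mp := arr b (\<lambda>y. mp1 x y + (if 1 < ?x \<and> ?x \<le> u y then - (moebius ?x * int (n div (?x * y))) else 0)), ops := c3, peak := p3\<rparr>"
    by auto
  let ?g3 = "\<lambda>y. mp1 x y + (if 1 < ?x \<and> ?x \<le> u y then - (moebius ?x * int (n div (?x * y))) else 0)"
  have p3: "p3 = p2" using c3(2,3) p2(3) by (simp add: \<tau>2 cardB2)
  have \<tau>3: "\<tau>3 = \<sigma>\<lparr>state.m := mertens ?x, state.X := X_part ?x, blk := B2, mp := arr b ?g3, ops := c3, peak := p2\<rparr>"
    unfolding \<tau>3_def \<tau>3' by (simp add: \<tau>2 p3)
  have m3: "state.m \<tau>3 = mertens ?x" by (simp add: \<tau>3)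
  define \<tau>4 where "\<tau>4 = step_2c n ?x \<tau>3"
  obtain d4 c4 p4 where d4: "d4 \<le> state.d \<tau>3" "\<And>y. 1 \<le> y \<Longrightarrow> y \<le> b \<Longrightarrow> y \<le> d4 \<longleftrightarrow> ?x < u y"
    and c4: "c4 \<le> ops \<tau>3 + 1 + 11 * (state.d \<tau>3 - d4)" and p4': "peak \<tau>3 \<le> p4" "p4 \<le> max (peak \<tau>3) (22 + card (dom (blk \<tau>3)) + b)"
    and \<tau>4': "step_2c n ?x \<tau>3 = \<tau>3\<lparr>state.d := d4, gam := gamma_val n d4, ops := c4, peak := p4,
      mp := arr b (\<lambda>y. ?g3 y + (if u y = ?x then 1 - int (n div y) + state.m \<tau>3 * int ?x else 0))\<rparr>"
  proof (rule step_2c_result[of \<tau>3 ?g3 ?x])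
    show "mp \<tau>3 = arr b ?g3" by (simp add: \<tau>3)
    show "gam \<tau>3 = gamma_val n (state.d \<tau>3)" "state.d \<tau>3 \<le> b" using inv by (simp_all add: \<tau>3)
    show "y \<le> state.d \<tau>3 \<longleftrightarrow> ?x \<le> u y" if "1 \<le> y" "y \<le> b" for y using inv that by (simp add: \<tau>3 Suc_le_eq)
  qed (rule that)
  let ?g4 = "\<lambda>y. ?g3 y + (if u y = ?x then 1 - int (n div y) + mertens ?x * int ?x else 0)"
  have p4: "p4 = p2" using p4' p2(3) by (simp add: \<tau>3 cardB2)
  have d4': "d4 \<le> state.d \<sigma>" "state.d \<sigma> \<le> b" using d4(1) inv by (simp_all add: \<tau>3)
  have \<tau>4: "\<tau>4 = \<sigma>\<lparr>state.m := mertens ?x, state.X := X_part ?x, state.d := d4, gam := gamma_val n d4, blk := B2, mp := arr b ?g4, ops := c4, peak := p2\<rparr>"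
    unfolding \<tau>4_def \<tau>4' m3 by (simp add: \<tau>3 p4)
  have cost4: "c4 \<le> cost1 x (state.d \<sigma>) + 14 + 7 * ?dv + 11 * (state.d \<sigma> - d4)"
    using c4 c3(1) inv by (simp add: \<tau>2 \<tau>3)
  define \<tau>5 where "\<tau>5 = step_2d n b r ?x \<tau>4"
  \<comment> \<open>The slack 20 is ample for the 7 operations still to come: the tests of steps (4)
    and (5) and the loop overhead.\<close>
  have "\<exists>A' c5. \<tau>5 = \<sigma>\<lparr>state.m := mertens ?x, state.X := X_part ?x, state.d := d4, gam := gamma_val n d4, state.A := A',
      blk := (\<lambda>i. if flushed ?x < i \<and> i \<le> ?x then Some (mertens i) else None), mp := arr b (mp1 ?x), ops := c5, peak := p2\<rparr>
      \<and> c5 + 20 \<le> cost1 ?x d4"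
  proof (cases "b dvd ?x \<or> ?x = r")
    case True
    have fl: "flushed ?x = ?x" using True by (rule flushed_Suc_flush)
    have le: "flushed x < ?x" "flushed x \<le> flushed ?x" using flushed_le[of x] fl by simp_all
    let ?S = "\<lambda>y. {l \<in> {2..u y}. flushed x < n div (l * y) \<and> n div (l * y) \<le> ?x}"
    obtain c5 p5 where c5: "c5 \<le> ops \<tau>4 + 5 + 11 * b + 8 * (\<Sum>y=1..b. card (?S y))"
      and p5': "peak \<tau>4 \<le> p5" "p5 \<le> max (peak \<tau>4) (22 + card (dom (blk \<tau>4)) + b)"
      and \<tau>5': "step_2d n b r ?x \<tau>4 = \<tau>4\<lparr>state.A := flushed x + 1, blk := Map.empty, ops := c5, peak := p5,
        mp := arr b (\<lambda>y. ?g4 y - (\<Sum>l\<in>?S y. mertens (n div (l * y))))\<rparr>"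
      by (rule step_2d_result[of \<tau>4 ?g4 ?x "flushed x"]) (use True x le in \<open>auto simp: \<tau>4 B2_def\<close>)
    have p5: "p5 = p2" using p5' p2(3) by (simp add: \<tau>4 cardB2)
    have arr: "arr b (\<lambda>y. ?g4 y - (\<Sum>l\<in>?S y. mertens (n div (l * y)))) = arr b (mp1 ?x)"
    proof (rule arr_cong)
      fix y assume y: "1 \<le> y" "y \<le> b"
      have "(\<Sum>l\<in>?S y. mertens (n div (l * y))) = sum (M_at y) (low_terms (flushed ?x) y) - sum (M_at y) (low_terms (flushed x) y)"
        using sum_low_terms[OF le(2), of "M_at y" y] by (simp add: fl M_at_def)
      then show "?g4 y - (\<Sum>l\<in>?S y. mertens (n div (l * y))) = mp1 ?x y"
        using mp1_Suc[OF y, of x] by simp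
    qed
    have low: "(\<Sum>y=1..b. card (low_terms (flushed ?x) y)) = (\<Sum>y=1..b. card (low_terms (flushed x) y)) + (\<Sum>y=1..b. card (?S y))"
      using card_low_terms[OF le(2)] by (simp add: fl sum.distrib)
    have fb: "11 * b + 11 * flushed x \<le> 11 * flushed ?x + (if ?x = r then 11 * b else 0)"
      using flushed_step[of x] True x le(2) fl by (cases "?x = r") auto
    have "c5 + 20 \<le> cost1 ?x d4"
    proof -
      have "c5 \<le> c4 + 5 + 11 * b + 8 * (\<Sum>y=1..b. card (?S y))" using c5 by (simp add: \<tau>4)
      then show ?thesis using cost4 fb x d4' unfolding cost1_def low by (simp add: distrib_left)
    qed
    moreover have "\<tau>5 = \<sigma>\<lparr>state.m := mertens ?x, state.X := X_part ?x, state.d := d4, gam := gamma_val n d4, state.A := flushed x + 1,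
      blk := (\<lambda>i. if flushed ?x < i \<and> i \<le> ?x then Some (mertens i) else None), mp := arr b (mp1 ?x), ops := c5, peak := p2\<rparr>"
      unfolding \<tau>5_def \<tau>5' arr p5 fl by (simp add: \<tau>4) (auto simp: fun_eq_iff)
    ultimately show ?thesis by blast
  next
    case False
    have fl: "flushed ?x = flushed x" using False x by (rule flushed_Suc_no_flush)
    have arr: "arr b ?g4 = arr b (mp1 ?x)"
      by (rule arr_cong) (use mp1_Suc[of _ x] fl in simp)
    have "c4 + 3 + 20 \<le> cost1 ?x d4"
      using cost4 x d4' False unfolding cost1_def fl by (simp add: distrib_left)
    moreover have "\<tau>5 = \<sigma>\<lparr>state.m := mertens ?x, state.X := X_part ?x, state.d := d4, gam := gamma_val n d4, state.A := state.A \<sigma>,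
      blk := (\<lambda>i. if flushed ?x < i \<and> i \<le> ?x then Some (mertens i) else None), mp := arr b (mp1 ?x), ops := c4 + 3, peak := p2\<rparr>"
      unfolding \<tau>5_def step_2d_no_flush[OF False] fl arr[symmetric] by (simp add: \<tau>4 tick_def B2_def)
    ultimately show ?thesis by blast
  qed
  then obtain A' c5 where \<tau>5: "\<tau>5 = \<sigma>\<lparr>state.m := mertens ?x, state.X := X_part ?x, state.d := d4, gam := gamma_val n d4, state.A := A',
      blk := (\<lambda>i. if flushed ?x < i \<and> i \<le> ?x then Some (mertens i) else None), mp := arr b (mp1 ?x), ops := c5, peak := p2\<rparr>"
    and c5: "c5 + 20 \<le> cost1 ?x d4" by blast
  have "main_step n a ?x \<sigma> = tick 1 (tick 4 \<tau>5)"
    using x r_less unfolding main_step_eq \<tau>5_def \<tau>4_def \<tau>3_def \<tau>2_def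
    by (simp add: step_5_def step_4_def)
  then show ?thesis
    using inv c5 d4(2) d4' p2 by (simp add: inv1_def \<tau>5 tick_def)
qed

end

subsection \<open>The phase \<open>x > r\<close> and the final loop\<close>

context alg_run
begin

lemma flushed_r: "flushed r = r"
  by (simp add: flushed_def)

text \<open>The handover between the phases: the terms subtracted so far, described by their
  arguments, are redescribed by their indices.\<close>

lemma low_terms_r: "1 \<le> y \<Longrightarrow> low_terms r y = high_terms s\<^sub>0 y"
proof -
  assume y: "1 \<le> y"
  have "n div (t * y) \<le> r \<longleftrightarrow> s\<^sub>0 < t * y" if "t \<in> {2..u y}" for t
  proof -
    have "1 \<le> t * y" using that y by simp
    from le_s0_iff[OF this] show ?thesis by auto
  qed
  then show ?thesis unfolding low_terms_def high_terms_def by blast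
qed

lemma mp1_r: "1 \<le> y \<Longrightarrow> mp1 r y = mp2 s\<^sub>0 y"
  using u_le_r[of y] by (simp add: mp1_def mp2_def flushed_r low_terms_r min_absorb2)

text \<open>Each index that has been passed contributes 22, which pays for the overhead of 22 per
  \<open>y\<close> when a block of \<open>b\<close> indices is emptied.\<close>

definition cost2 :: "nat \<Rightarrow> nat" where
  "cost2 z = cost1 r 0 + 22 * (s\<^sub>0 - z) + 7 * (\<Sum>y = 1..b. card (high_terms z y))"

text \<open>
  In the phase \<open>x > r\<close> the array \<open>\<M>\<close> occupies the indices above \<open>max s b\<close> up to \<open>hi\<close>, and the
  terms with index above \<open>hi\<close> have already been subtracted.
\<close>

definition inv2 :: "nat \<Rightarrow> nat \<Rightarrow> nat \<Rightarrow> state \<Rightarrow> bool" where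
  "inv2 x hi e \<sigma> \<longleftrightarrow> state.X \<sigma> = X_part x \<and> state.Y \<sigma> = 0 \<and> state.m \<sigma> = mertens x
    \<and> state.s \<sigma> \<le> s\<^sub>0 \<and> (\<forall>j. 1 \<le> j \<longrightarrow> j \<le> s\<^sub>0 \<longrightarrow> (j \<le> state.s \<sigma> \<longleftrightarrow> x < n div j)) \<and> chi \<sigma> = chi_val n (state.s \<sigma>)
    \<and> max (state.s \<sigma>) b \<le> hi \<and> hi \<le> s\<^sub>0 \<and> (0 < b \<longrightarrow> hi - max (state.s \<sigma>) b \<le> b)
    \<and> blk \<sigma> = (\<lambda>i. if max (state.s \<sigma>) b < i \<and> i \<le> hi then Some (mertens (n div i)) else None)
    \<and> (max (state.s \<sigma>) b < hi \<longrightarrow> state.A \<sigma> = hi \<and> state.B \<sigma> = max (state.s \<sigma>) b + 1)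
    \<and> mp \<sigma> = arr b (mp2 hi) \<and> ops \<sigma> \<le> cost2 hi + e
    \<and> 22 + b \<le> peak \<sigma> \<and> (0 < b \<longrightarrow> peak \<sigma> \<le> 22 + 2 * b)"

lemma inv1_imp_inv2:
  assumes "inv1 r \<sigma>" shows "inv2 r s\<^sub>0 0 \<sigma> \<and> max (state.s \<sigma>) b = s\<^sub>0"
proof -
  note inv = assms[unfolded inv1_def]
  have "arr b (mp1 r) = arr b (mp2 s\<^sub>0)" by (rule arr_cong) (simp add: mp1_r)
  moreover have "cost1 r (state.d \<sigma>) \<le> cost2 s\<^sub>0" by (simp add: cost1_def cost2_def)
  moreover have "(\<lambda>i. if r < i \<and> i \<le> r then Some (mertens i) else None) = (\<lambda>_. None)"
    "(\<lambda>i. if s\<^sub>0 < i \<and> i \<le> s\<^sub>0 then Some (mertens (n div i)) else None) = (\<lambda>_. None)"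
    by (auto simp: fun_eq_iff)
  moreover have "max s\<^sub>0 b = s\<^sub>0" using b_le_s0 by simp
  ultimately show ?thesis using inv le_s0_iff by (simp add: inv2_def flushed_r)
qed

lemma s_ge_b:
  assumes inv: "inv2 x hi e \<sigma>" and x: "x < a"
  shows "b \<le> state.s \<sigma>"
proof (cases "b = 0")
  case False
  then have "x < n div b" using a_le_div[of b] x by simp
  then show ?thesis using inv False b_le_s0 by (simp add: inv2_def)
qed simp

lemma inv2_step_3:
  assumes inv: "inv2 x hi e \<sigma>" and lt: "0 < b \<Longrightarrow> hi - max (state.s \<sigma>) b < b"
    and x: "r \<le> x" "Suc x \<le> a"
  shows "inv2 (Suc x) hi (e + 14) (step_3 n b (Suc x) (tick 1 (step_1 n (Suc x) \<sigma>)))"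
proof -
  let ?x = "Suc x"
  note inv' = inv[unfolded inv2_def]
  define \<tau> where "\<tau> = tick 1 (step_1 n ?x \<sigma>)"
  have \<tau>: "\<tau> = \<sigma>\<lparr>state.m := mertens ?x, state.X := X_part ?x, ops := ops \<sigma> + 8\<rparr>"
    using inv' by (simp add: \<tau>_def step_1_def tick_def Let_def mertens_Suc[symmetric] X_part_Suc[symmetric])
  have s: "j \<le> state.s \<sigma> \<longleftrightarrow> ?x \<le> n div j" if "1 \<le> j" "j \<le> s\<^sub>0" for j
    using inv' that by (simp add: Suc_le_eq)
  have sb: "b \<le> state.s \<sigma>" using s_ge_b[OF inv] x by simp
  then have mx: "max (state.s \<sigma>) b = state.s \<sigma>" by simp
  show "inv2 ?x hi (e + 14) (step_3 n b ?x \<tau>)"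
  proof (cases "enat ?x = chi \<sigma>")
    case False
    have s': "j \<le> state.s \<sigma> \<longleftrightarrow> ?x < n div j" if j: "1 \<le> j" "j \<le> s\<^sub>0" for j
    proof -
      \<comment> \<open>All quotients at indices up to \<open>s\<close> are at least
        \<open>Suc x\<close>, and the smallest is the one at \<open>s\<close>. If any equals
        \<open>Suc x\<close>, then so does \<open>chi\<close>.\<close>
      have "n div j \<noteq> ?x" if "j \<le> state.s \<sigma>"
      proof
        assume eq: "n div j = ?x"
        have "1 \<le> state.s \<sigma>" "state.s \<sigma> \<le> s\<^sub>0" using j that inv' by auto
        then have "?x \<le> n div state.s \<sigma>" using s by blast
        moreover have "n div state.s \<sigma> \<le> n div j" using j that by (simp add: div_le_mono2)
        ultimately have "n div state.s \<sigma> = ?x" using eq by simp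
        then show False using False inv' \<open>1 \<le> state.s \<sigma>\<close> by (simp add: chi_val_def)
      qed
      then show ?thesis using s[OF j] by auto
    qed
    have "step_3 n b ?x \<tau> = tick 1 \<tau>" using False by (simp add: step_3_def \<tau>)
    then show ?thesis using inv' s' by (simp add: inv2_def \<tau> tick_def)
  next
    case True
    let ?s = "state.s \<sigma>"
    have s1: "1 \<le> ?s" "n div ?s = ?x" using True inv' by (auto simp: chi_val_def split: if_splits)
    have s2: "?s \<le> s\<^sub>0" using inv' by simp
    have v: "n div ?x = ?s" using div_div_self[OF s1(1) s2] s1(2) by simp
    have s': "j \<le> ?s - 1 \<longleftrightarrow> ?x < n div j" if j: "1 \<le> j" "j \<le> s\<^sub>0" for j
    proof
      assume "j \<le> ?s - 1"
      then show "?x < n div j" using div_strict_antimono[of j ?s] j s1 s2 by simp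
    next
      assume "?x < n div j"
      then have "j \<le> ?s" "j \<noteq> ?s" using s[OF j] s1 by auto
      then show "j \<le> ?s - 1" by simp
    qed
    show ?thesis
    proof (cases "?s = b")
      \<comment> \<open>Here \<open>n div b = Suc x\<close>, which forces \<open>Suc x = a\<close>.
        Nothing is stored, as indices up to \<open>b\<close> belong to the final loop, but
        \<open>s\<close> drops below \<open>b\<close>; this is why \<open>inv2\<close> uses
        \<open>max (state.s \<sigma>) b\<close>.\<close>
      case eq: True
      have "step_3 n b ?x \<tau> = tick 1 (tick 3 (\<tau>\<lparr>state.s := ?s - 1, chi := chi_val n (?s - 1)\<rparr>))"
        using True by (simp add: step_3_def \<tau> v eq Let_def)
      moreover have "max (b - Suc 0) b = b" "b - Suc 0 \<le> s\<^sub>0" using b_le_s0 by simp_all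
      ultimately show ?thesis using inv' s' s2 by (simp add: inv2_def \<tau> tick_def eq)
    next
      case ne: False
      have mx': "max (?s - Suc 0) b = ?s - Suc 0" using sb ne by simp
      let ?blk = "\<lambda>i. if ?s - Suc 0 < i \<and> i \<le> hi then Some (mertens (n div i)) else None"
      have hi: "?s \<le> hi" "hi \<le> s\<^sub>0" using inv' by auto
      have blk: "(\<lambda>i. if ?s < i \<and> i \<le> hi then Some (mertens (n div i)) else None)(?s \<mapsto> mertens ?x) = ?blk"
        using hi s1 by (auto simp: fun_eq_iff)
      have blk_\<sigma>: "blk \<sigma> = (\<lambda>i. if ?s < i \<and> i \<le> hi then Some (mertens (n div i)) else None)"
        using inv' unfolding mx by blast
      have empty: "blk \<sigma> = Map.empty \<longleftrightarrow> hi = ?s"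
      proof
        assume "blk \<sigma> = Map.empty"
        then have "blk \<sigma> hi = None" by simp
        then show "hi = ?s" using hi by (auto simp: blk_\<sigma> split: if_splits)
      next
        assume "hi = ?s" then show "blk \<sigma> = Map.empty" unfolding blk_\<sigma> by (auto simp: fun_eq_iff)
      qed
      have card: "card (dom ?blk) = hi - (?s - Suc 0)" by (rule card_dom_interval)
      define p where "p = max (peak \<sigma>) (22 + (hi - (?s - Suc 0)) + b)"
      have size: "0 < b \<Longrightarrow> hi - (?s - Suc 0) \<le> b" using lt s1 unfolding mx by simp
      have p: "22 + b \<le> p" "0 < b \<longrightarrow> p \<le> 22 + 2 * b" using inv' size by (auto simp: p_def)
      define q where "q = (if hi = ?s then ?s else state.A \<sigma>)"
      have mp_\<sigma>: "mp \<sigma> = arr b (mp2 hi)" using inv' by blast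
      have "step_3 n b ?x \<tau> = \<sigma>\<lparr>state.m := mertens ?x, state.X := X_part ?x, state.A := q, state.B := ?s,
          blk := ?blk, state.s := ?s - 1, chi := chi_val n (?s - 1), ops := ops \<sigma> + 14, peak := p\<rparr>"
      proof -
        have q: "(if hi = ?s then \<tau>\<lparr>state.A := ?s\<rparr> else \<tau>) = \<tau>\<lparr>state.A := q\<rparr>"
          by (cases \<sigma>) (simp add: q_def \<tau>)
        have "step_3 n b ?x \<tau> = tick 1 (tick 3 ((tick 1 ((blk_write ?s (mertens ?x)
            (if hi = ?s then \<tau>\<lparr>state.A := ?s\<rparr> else \<tau>))\<lparr>state.B := ?s\<rparr>))\<lparr>state.s := ?s - 1, chi := chi_val n (?s - 1)\<rparr>))"
          using True ne empty by (simp add: step_3_def \<tau> v Let_def tick_def blk_write_def record_peak_def)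
        then have "step_3 n b ?x \<tau> = tick 1 (tick 3 ((tick 1 ((blk_write ?s (mertens ?x)
            (\<tau>\<lparr>state.A := q\<rparr>))\<lparr>state.B := ?s\<rparr>))\<lparr>state.s := ?s - 1, chi := chi_val n (?s - 1)\<rparr>))"
          unfolding q .
        also have "\<dots> = \<sigma>\<lparr>state.m := mertens ?x, state.X := X_part ?x, state.A := q, state.B := ?s,
          blk := ?blk, state.s := ?s - 1, chi := chi_val n (?s - 1), ops := ops \<sigma> + 14, peak := p\<rparr>"
          by (simp add: \<tau> tick_def blk_write_def record_peak_def stored_def blk_\<sigma> blk card mp_\<sigma> p_def del: dom_fun_upd)
        finally show ?thesis .
      qed
      moreover have "?s - Suc 0 \<le> s\<^sub>0" "?s - Suc 0 \<le> hi" using s2 hi by simp_all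
      ultimately show ?thesis using inv' s' s1 s2 hi p size sb ne unfolding inv2_def by (simp add: mx mx' q_def)
    qed
  qed
qed

lemma inv2_tick: "inv2 x hi e \<sigma> \<Longrightarrow> e + k \<le> e' \<Longrightarrow> inv2 x hi e' (tick k \<sigma>)"
  by (auto simp: inv2_def tick_def)

lemma s_tick [simp]: "state.s (tick k \<sigma>) = state.s \<sigma>"
  by (simp add: tick_def)

text \<open>Moving from \<open>hi\<close> to \<open>lo\<close> raises \<open>cost2\<close> by
  \<open>22 * (hi - lo)\<close>. A full block thereby covers its own \<open>22 * b\<close>; for the
  last block, which may be partial, \<open>e'\<close> has to absorb that amount.\<close>

lemma inv2_flush:
  assumes inv: "inv2 x hi e \<sigma>" and flush: "x = a \<or> (x > r \<and> card (dom (blk \<sigma>)) = b)"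
    and lo: "lo = max (state.s \<sigma>) b" "lo < hi" and e': "e + 5 + 22 * b \<le> e' + 22 * (hi - lo)"
  shows "inv2 x lo e' (step_4 n a b r x \<sigma>) \<and> state.s (step_4 n a b r x \<sigma>) = state.s \<sigma>"
proof -
  note inv' = inv[unfolded inv2_def]
  let ?S = "\<lambda>y. {t \<in> {2..u y}. lo < t * y \<and> t * y \<le> hi}"
  have blk: "blk \<sigma> = (\<lambda>i. if lo < i \<and> i \<le> hi then Some (mertens (n div i)) else None)"
    using inv' unfolding lo(1) by blast
  have mp: "mp \<sigma> = arr b (mp2 hi)" and hi: "hi \<le> s\<^sub>0" and AB: "state.A \<sigma> = hi" "state.B \<sigma> = lo + 1"
    using inv' lo by auto
  obtain c p where c: "c \<le> ops \<sigma> + 5 + 22 * b + 7 * (\<Sum>y=1..b. card (?S y))"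
    and p': "peak \<sigma> \<le> p" "p \<le> max (peak \<sigma>) (22 + card (dom (blk \<sigma>)) + b)"
    and eq: "step_4 n a b r x \<sigma> = \<sigma>\<lparr>blk := Map.empty, ops := c, peak := p,
      mp := arr b (\<lambda>y. mp2 hi y - (\<Sum>t\<in>?S y. mertens (n div (t * y))))\<rparr>"
    by (rule step_4_result[OF mp flush blk lo(2) hi AB])
  have "card (dom (blk \<sigma>)) = hi - lo" unfolding blk by (rule card_dom_interval)
  then have p: "22 + b \<le> p" "0 < b \<longrightarrow> p \<le> 22 + 2 * b" using p' inv' lo(1) by auto
  have arr: "arr b (\<lambda>y. mp2 hi y - (\<Sum>t\<in>?S y. mertens (n div (t * y)))) = arr b (mp2 lo)"
  proof (rule arr_cong)
    fix y
    have "(\<Sum>t\<in>?S y. mertens (n div (t * y))) = sum (M_at y) (high_terms lo y) - sum (M_at y) (high_terms hi y)"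
      using sum_high_terms[of lo hi "M_at y" y] lo by (simp add: M_at_def)
    then show "mp2 hi y - (\<Sum>t\<in>?S y. mertens (n div (t * y))) = mp2 lo y" by (simp add: mp2_def)
  qed
  have "(\<Sum>y = 1..b. card (high_terms lo y)) = (\<Sum>y = 1..b. card (high_terms hi y)) + (\<Sum>y=1..b. card (?S y))"
    using card_high_terms[of lo hi] lo by (simp add: sum.distrib)
  moreover have "22 * (s\<^sub>0 - lo) = 22 * (s\<^sub>0 - hi) + 22 * (hi - lo)" using lo(2) hi by simp
  moreover have "ops \<sigma> \<le> cost2 hi + e" using inv' by blast
  ultimately have cost: "c \<le> cost2 lo + e'" using c e' unfolding cost2_def distrib_left by linarith
  have "(\<lambda>i. if lo < i \<and> i \<le> lo then Some (mertens (n div i)) else None) = (\<lambda>_. None)"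
    by (auto simp: fun_eq_iff)
  then show ?thesis using inv' p lo hi cost unfolding eq arr inv2_def by simp
qed

lemma inv2_step:
  assumes inv: "inv2 x hi e \<sigma>" and lt: "0 < b \<Longrightarrow> hi - max (state.s \<sigma>) b < b"
    and x: "r \<le> x" "Suc x < a"
  shows "\<exists>hi'. inv2 (Suc x) hi' (e + 40) (tick 2 (main_step n a (Suc x) \<sigma>))
    \<and> (0 < b \<longrightarrow> hi' - max (state.s (tick 2 (main_step n a (Suc x) \<sigma>))) b < b)"
proof -
  let ?x = "Suc x"
  define \<tau> where "\<tau> = step_3 n b ?x (tick 1 (step_1 n ?x \<sigma>))"
  have inv3: "inv2 ?x hi (e + 14) \<tau>" unfolding \<tau>_def using inv lt x by (intro inv2_step_3) auto
  have main: "main_step n a ?x \<sigma> = tick 1 (step_4 n a b r ?x \<tau>)"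
    using x by (simp add: main_step_eq \<tau>_def step_5_def)
  let ?lo = "max (state.s \<tau>) b"
  have card: "card (dom (blk \<tau>)) = hi - ?lo"
    using inv3 card_dom_interval[of ?lo hi "\<lambda>i. mertens (n div i)"] unfolding inv2_def by metis
  show ?thesis
  proof (cases "?lo < hi \<and> card (dom (blk \<tau>)) = b")
    case True
    then have "inv2 ?x ?lo (e + 19) (step_4 n a b r ?x \<tau>) \<and> state.s (step_4 n a b r ?x \<tau>) = state.s \<tau>"
      using card x by (intro inv2_flush[OF inv3]) auto
    then have "inv2 ?x ?lo (e + 40) (tick 2 (main_step n a ?x \<sigma>))" "state.s (tick 2 (main_step n a ?x \<sigma>)) = state.s \<tau>"
      unfolding main by (auto intro!: inv2_tick[OF inv2_tick[OF _ le_refl]])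
    then show ?thesis by (intro exI[of _ ?lo]) simp
  next
    case False
    have "blk \<tau> = Map.empty \<or> \<not> (?x = a \<or> ?x > r \<and> card (dom (blk \<tau>)) = b)"
    proof (cases "?lo < hi")
      case False
      then have "blk \<tau> = (\<lambda>_. None)" using inv3 unfolding inv2_def by (auto simp: fun_eq_iff)
      then show ?thesis by simp
    qed (use False x in simp)
    then have "step_4 n a b r ?x \<tau> = tick 4 \<tau>" by (intro step_4_no_flush) blast
    then have eq: "tick 2 (main_step n a ?x \<sigma>) = tick 2 (tick 1 (tick 4 \<tau>))" by (simp add: main)
    have "inv2 ?x hi (e + 40) (tick 2 (main_step n a ?x \<sigma>))"
      unfolding eq by (intro inv2_tick[OF inv2_tick[OF inv2_tick[OF inv3 le_refl] le_refl]]) simp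
    moreover have "hi - ?lo < b" if "0 < b"
    proof -
      have "hi - ?lo \<le> b" using inv3 that by (simp add: inv2_def)
      then show ?thesis using False card that by auto
    qed
    ultimately show ?thesis by (intro exI[of _ hi]) (simp add: eq)
  qed
qed

definition after_main :: "state \<Rightarrow> bool" where
  "after_main \<sigma> \<longleftrightarrow> state.X \<sigma> = X_part a \<and> state.Y \<sigma> = 0 \<and> state.Z \<sigma> = mertens a * (int b * (int b + 1) div 2)
    \<and> blk \<sigma> = Map.empty \<and> mp \<sigma> = arr b (mp2 b) \<and> ops \<sigma> \<le> cost2 b + 40 * (a - r) + 22 * b
    \<and> 22 + b \<le> peak \<sigma> \<and> (0 < b \<longrightarrow> peak \<sigma> \<le> 22 + 2 * b)"

lemma inv2_last:
  assumes inv: "inv2 x hi e \<sigma>" and lt: "0 < b \<Longrightarrow> hi - max (state.s \<sigma>) b < b"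
    and x: "r \<le> x" "Suc x = a" and e: "e + 40 \<le> 40 * (a - r)"
  shows "after_main (tick 2 (main_step n a a \<sigma>))"
proof -
  define \<tau> where "\<tau> = step_3 n b a (tick 1 (step_1 n a \<sigma>))"
  have inv3: "inv2 a hi (e + 14) \<tau>" unfolding \<tau>_def using inv2_step_3[OF inv lt x(1)] x by simp
  \<comment> \<open>Every index \<open>k > b\<close> has \<open>n div k < a\<close>, so its value
    has been met by the time \<open>x = a\<close>.\<close>
  have s: "max (state.s \<tau>) b = b"
  proof (rule ccontr)
    assume "max (state.s \<tau>) b \<noteq> b"
    then have bs: "b < state.s \<tau>" "state.s \<tau> \<le> s\<^sub>0" using inv3 by (auto simp: inv2_def)
    have all: "\<forall>j. 1 \<le> j \<longrightarrow> j \<le> s\<^sub>0 \<longrightarrow> (j \<le> state.s \<tau> \<longleftrightarrow> a < n div j)"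
      using inv3 unfolding inv2_def by blast
    have "a < n div state.s \<tau>" using all[rule_format, of "state.s \<tau>"] bs by simp
    then show False using div_less_a[OF bs(1)] by simp
  qed
  have "inv2 a b (e + 19 + 22 * b) (step_4 n a b r a \<tau>) \<and> max (state.s (step_4 n a b r a \<tau>)) b = b"
  proof (cases "b < hi")
    case True
    have "inv2 a b (e + 19 + 22 * b) (step_4 n a b r a \<tau>) \<and> state.s (step_4 n a b r a \<tau>) = state.s \<tau>"
      by (rule inv2_flush[OF inv3]) (use True s in auto)
    then show ?thesis using s by simp
  next
    case False
    then have hi: "hi = b" using inv3 by (simp add: inv2_def)
    then have "blk \<tau> = (\<lambda>_. None)" using inv3 s unfolding inv2_def by (auto simp: fun_eq_iff)
    then have eq: "step_4 n a b r a \<tau> = tick 4 \<tau>" by (intro step_4_no_flush) simp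
    have "inv2 a b (e + 19 + 22 * b) (tick 4 \<tau>)"
      by (rule inv2_tick[OF inv3[unfolded hi]]) simp
    then show ?thesis using s by (simp add: eq)
  qed
  then have inv4: "inv2 a b (e + 19 + 22 * b) (step_4 n a b r a \<tau>)" "max (state.s (step_4 n a b r a \<tau>)) b = b" by auto
  define \<rho> where "\<rho> = step_4 n a b r a \<tau>"
  have main: "main_step n a a \<sigma> = step_5 a b a \<rho>"
    using r_less by (simp add: main_step_eq \<tau>_def \<rho>_def)
  note inv4' = inv4(1)[unfolded inv2_def inv4(2), folded \<rho>_def]
  have "blk \<rho> = (\<lambda>i. if b < i \<and> i \<le> b then Some (mertens (n div i)) else None)" using inv4' by blast
  then have "blk \<rho> = (\<lambda>_. None)" by (auto simp: fun_eq_iff)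
  then show ?thesis using inv4' e by (simp add: after_main_def main step_5_def tick_def)
qed

lemma for_each_snoc: "for_each (xs @ [x]) body \<sigma> = tick 2 (body x (for_each xs body \<sigma>))"
  by (simp add: for_each_def)

lemma main_loop: "after_main (for_each [1..<Suc a] (main_step n a) (init n a))"
proof -
  let ?L = "\<lambda>x. for_each [1..<Suc x] (main_step n a) (init n a)"
  have L: "?L (Suc x) = tick 2 (main_step n a (Suc x) (?L x))" for x
  proof -
    have "[1..<Suc (Suc x)] = [1..<Suc x] @ [Suc x]" by simp
    then show ?thesis by (simp only: for_each_snoc)
  qed
  have 1: "inv1 x (?L x)" if "x \<le> r" for x
    using that
  proof (induction x)
    case 0
    then show ?case using inv1_init by (simp add: for_each_def)
  next
    case (Suc x)
    then show ?case unfolding L by (intro inv1_step) auto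
  qed
  have 2: "\<exists>hi. inv2 (r + k) hi (40 * k) (?L (r + k)) \<and> (0 < b \<longrightarrow> hi - max (state.s (?L (r + k))) b < b)"
    if "r + k < a" for k
    using that
  proof (induction k)
    case 0
    show ?case using inv1_imp_inv2[OF 1[OF le_refl]] by (intro exI[of _ s\<^sub>0]) (simp del: upt_Suc)
  next
    case (Suc k)
    then obtain hi where hi: "inv2 (r + k) hi (40 * k) (?L (r + k))" "0 < b \<longrightarrow> hi - max (state.s (?L (r + k))) b < b" by auto
    have "r + Suc k = Suc (r + k)" "40 * Suc k = 40 * k + 40" by simp_all
    then show ?case using inv2_step[OF hi(1)] hi(2) Suc.prems by (simp only: L)
  qed
  obtain k where k: "a = Suc (r + k)" using r_less less_iff_Suc_add by auto
  from 2[of k] obtain hi where hi: "inv2 (r + k) hi (40 * k) (?L (r + k))" "0 < b \<longrightarrow> hi - max (state.s (?L (r + k))) b < b"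
    using k by auto
  have "after_main (tick 2 (main_step n a a (?L (r + k))))"
    by (rule inv2_last[OF hi(1)]) (use hi(2) k in auto)
  then show ?thesis using L[of "r + k"] unfolding k[symmetric] by (simp only:)
qed

text \<open>The test detects \<open>t * y > b\<close>. If \<open>t * y \<le> b\<close>, then
  \<open>n div (t * y) \<ge> a\<close>, while \<open>n < a * (b + 1)\<close>. Otherwise
  \<open>b + 1 \<le> t * y\<close>, and \<open>n div (t * y) * (t * y) \<le> n\<close>.\<close>

lemma final_loop_test:
  assumes "1 \<le> y" "y \<le> b" "1 \<le> t"
  shows "real n / real (b + 1) \<ge> real (n div y div t) \<longleftrightarrow> \<not> t \<le> b div y"
proof -
  have tb: "t \<le> b div y \<longleftrightarrow> t * y \<le> b" using assms(1) by (simp add: less_eq_div_iff_mult_less_eq)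
  have v: "n div y div t = n div (t * y)" by (simp add: div_mult2_eq[symmetric] mult.commute)
  have 1: "real n / real (b + 1) \<ge> real q \<longleftrightarrow> q * (b + 1) \<le> n" for q
  proof -
    have "real n / real (b + 1) \<ge> real q \<longleftrightarrow> real (q * (b + 1)) \<le> real n" by (simp add: field_simps)
    then show ?thesis by (simp only: of_nat_le_iff)
  qed
  have "n div (t * y) * (b + 1) \<le> n \<longleftrightarrow> \<not> t * y \<le> b"
  proof
    assume le: "n div (t * y) * (b + 1) \<le> n"
    show "\<not> t * y \<le> b"
    proof
      assume ty: "t * y \<le> b"
      have "1 \<le> t * y" using assms by simp
      then have "a * (b + 1) \<le> n div (t * y) * (b + 1)" using a_le_div ty by (intro mult_le_mono1)
      moreover have "n < a * (b + 1)" using a_pos by (simp add: b_def dividend_less_times_div)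
      ultimately show False using le by simp
    qed
  next
    assume "\<not> t * y \<le> b"
    then have "n div (t * y) * (b + 1) \<le> n div (t * y) * (t * y)" by (intro mult_le_mono2) simp
    also have "\<dots> \<le> n" by simp
    finally show "n div (t * y) * (b + 1) \<le> n" .
  qed
  then show ?thesis unfolding v 1 tb .
qed

text \<open>The downward order of \<open>y\<close> matters: the entries read have index
  \<open>t * y > y\<close> and are already final. The computed subscript is \<open>t * y\<close> by
  \<open>div_div_self\<close>, since \<open>t * y \<le> b \<le> s\<^sub>0\<close>.\<close>

lemma final_step_result:
  assumes mp: "mp \<sigma> = arr b g" and y: "1 \<le> y" "y \<le> b"
    and g: "\<And>z. y < z \<Longrightarrow> z \<le> b \<Longrightarrow> g z = mertens (n div z)"
  obtains c p m' where "c \<le> ops \<sigma> + 11 + 8 * (b div y)" "peak \<sigma> \<le> p" "p \<le> max (peak \<sigma>) (22 + card (dom (blk \<sigma>)) + b)"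
    "final_step n b y \<sigma> = \<sigma>\<lparr>state.m := m', ops := c, peak := p,
       mp := arr b (g(y := g y - sum (M_at y) {2..b div y})),
       state.Y := state.Y \<sigma> + int y * (g y - sum (M_at y) {2..b div y})\<rparr>"
proof -
  let ?v = "n div y"
  let ?T = "b div y"
  have T: "1 \<le> ?T" using y by (simp add: Suc_le_eq div_greater_zero_iff)
  let ?c = "\<lambda>(t, \<sigma>). \<not> real n / real (b + 1) \<ge> real (?v div t)"
  let ?body = "\<lambda>(t, \<sigma>). (t + 1, tick 8 (\<sigma>\<lparr>state.m := state.m \<sigma> - the (mp \<sigma> (n div (?v div t)))\<rparr>))"
  let ?st = "\<lambda>t. \<sigma>\<lparr>state.m := - sum (M_at y) {2..<t}, ops := ops \<sigma> + 8 * (t - 2)\<rparr>"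
  define P where "P = (\<lambda>p. 2 \<le> fst p \<and> fst p \<le> ?T + 1 \<and> snd p = ?st (fst p))"
  let ?W = "while ?c ?body (2, \<sigma>\<lparr>state.m := 0\<rparr>)"
  have "P ?W \<and> \<not> ?c ?W"
  proof (rule while_induct[where f = "\<lambda>p. ?T + 1 - fst p"])
    show "P (2, \<sigma>\<lparr>state.m := 0\<rparr>)" using T by (simp add: P_def)
  next
    fix p assume "P p" and c: "?c p"
    then obtain t where t: "2 \<le> t" "t \<le> ?T + 1" and p: "p = (t, ?st t)" by (cases p) (auto simp: P_def)
    have "t \<le> ?T" using c final_loop_test[OF y, of t] t by (simp add: p)
    then have ty: "t * y \<le> b" using y by (simp add: less_eq_div_iff_mult_less_eq)
    have "y < t * y" using t y by simp
    have v: "?v div t = n div (t * y)" by (simp add: div_mult2_eq[symmetric] mult.commute)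
    have "n div (?v div t) = t * y"
      unfolding v using ty y t b_le_s0 by (intro div_div_self) auto
    then have "the (mp \<sigma> (n div (?v div t))) = M_at y t"
      using g[OF \<open>y < t * y\<close> ty] ty y t by (simp add: mp the_arr M_at_def)
    then have "?body p = (t + 1, ?st (t + 1))"
      using t by (simp add: p tick_def atLeastLessThanSuc)
    then show "P (?body p) \<and> ?T + 1 - fst (?body p) < ?T + 1 - fst p"
      using t \<open>t \<le> ?T\<close> by (simp add: P_def p)
  qed
  then obtain t where t: "2 \<le> t" "t \<le> ?T + 1" "\<not> t \<le> ?T" and W: "?W = (t, ?st t)"
    using final_loop_test[OF y] by (cases ?W) (auto simp: P_def)
  then have "t = ?T + 1" by simp
  then have W: "?W = (?T + 1, ?st (?T + 1))" using W by simp
  let ?S = "sum (M_at y) {2..?T}"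
  have S: "{2..<?T + 1} = {2..?T}" by auto
  define \<tau> where "\<tau> = tick 5 (?st (?T + 1))"
  have \<tau>: "\<tau> = \<sigma>\<lparr>state.m := - ?S, ops := ops \<sigma> + 8 * (?T + 1 - 2) + 5\<rparr>"
    unfolding \<tau>_def S by (simp add: tick_def)
  have m': "state.m (?st (?T + 1)) = - ?S" unfolding S by simp
  have mp_\<tau>: "mp \<tau> = arr b g" by (simp add: \<tau> mp)
  from addsE[OF adds_mp_add[OF y] mp_\<tau>, of "- ?S"] obtain c p where c: "c \<le> ops \<tau> + 3"
    "peak \<tau> \<le> p" "p \<le> max (peak \<tau>) (22 + card (dom (blk \<tau>)) + b)"
    "mp_add y (- ?S) \<tau> = \<tau>\<lparr>mp := arr b (\<lambda>j. g j + (if j = y then - ?S else 0)), ops := c, peak := p\<rparr>" by blast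
  have arr: "arr b (\<lambda>j. g j + (if j = y then - ?S else 0)) = arr b (g(y := g y - ?S))"
    by (rule arr_cong) simp
  have "final_step n b y \<sigma> = tick 3 ((mp_add y (- ?S) \<tau>)\<lparr>state.Y := state.Y (mp_add y (- ?S) \<tau>) + int y * the (mp (mp_add y (- ?S) \<tau>) y)\<rparr>)"
    unfolding final_step_def Let_def W prod.case \<tau>_def[symmetric] m' ..
  also have "\<dots> = \<sigma>\<lparr>state.m := - ?S, ops := c + 3, peak := p, mp := arr b (g(y := g y - ?S)),
       state.Y := state.Y \<sigma> + int y * (g y - ?S)\<rparr>"
    unfolding c(4) arr using y by (simp add: tick_def \<tau> the_arr)
  finally have eq: "final_step n b y \<sigma> = \<sigma>\<lparr>state.m := - ?S, ops := c + 3, peak := p, mp := arr b (g(y := g y - ?S)),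
       state.Y := state.Y \<sigma> + int y * (g y - ?S)\<rparr>" .
  have "c + 3 \<le> ops \<sigma> + 11 + 8 * ?T" using c(1) T by (simp add: \<tau>)
  moreover have "peak \<sigma> \<le> p" "p \<le> max (peak \<sigma>) (22 + card (dom (blk \<sigma>)) + b)" using c(2,3) by (simp_all add: \<tau>)
  ultimately show ?thesis by (rule that[OF _ _ _ eq])
qed

text \<open>Follows from \<open>b * b \<le> a * b \<le> n\<close>. The final loop has no test
  against \<open>u y\<close>; this shows that it stays within the recursion for
  \<open>n div y\<close>.\<close>

lemma div_le_u:
  assumes "1 \<le> y" "y \<le> b" shows "b div y \<le> u y"
proof -
  have "b div y * y \<le> b" "b div y \<le> b" by simp_all
  then have "b div y * (b div y * y) \<le> b * b" by (intro mult_le_mono)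
  also have "\<dots> \<le> a * b" using b_le_s0 s0_le_r r_less by (intro mult_le_mono1) simp
  also have "\<dots> \<le> n" by (simp add: b_def)
  finally show ?thesis using assms by (simp add: le_root_quot_iff mult.assoc)
qed

text \<open>The recursion at \<open>v = n div y\<close>, with its terms divided at
  \<open>t * y = b\<close>: those above were subtracted in the main loop, those below are subtracted
  now.\<close>

lemma mp2_final:
  assumes "1 \<le> y" "y \<le> b"
  shows "mp2 b y - sum (M_at y) {2..b div y} = mertens (n div y)"
proof -
  have div: "n div y div k = n div (k * y)" for k by (simp add: div_mult2_eq[symmetric] mult.commute)
  have "u y * u y * y \<le> n" "\<not> (u y + 1) * (u y + 1) * y \<le> n"
    using le_root_quot_iff[of y "u y" n] le_root_quot_iff[of y "u y + 1" n] assms by auto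
  then have "u y * u y \<le> n div y" "n div y < (u y + 1) * (u y + 1)"
    using assms by (auto simp: less_eq_div_iff_mult_less_eq div_less_iff_less_mult)
  moreover have "0 < n div y" using a_le_div[OF assms] a_pos by simp
  ultimately have M: "mertens (n div y) = 1 - int (n div y) + int (u y) * mertens (u y)
    - (\<Sum>k = 2..u y. moebius k * int (n div (k * y))) - sum (M_at y) {2..u y}"
    using mertens_hyperbola[of "n div y" "u y"] by (simp add: div M_at_def)
  have mem: "t \<le> b div y \<longleftrightarrow> t * y \<le> b" for t using assms by (simp add: less_eq_div_iff_mult_less_eq)
  have le: "t \<le> u y" if "t * y \<le> b" for t using that div_le_u[OF assms] mem le_trans by blast
  have "{2..u y} = high_terms b y \<union> {2..b div y}"
    unfolding high_terms_def using le mem by (auto simp: not_less)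
  moreover have "high_terms b y \<inter> {2..b div y} = {}"
    unfolding high_terms_def using mem by auto
  ultimately have "sum (M_at y) {2..u y} = sum (M_at y) (high_terms b y) + sum (M_at y) {2..b div y}"
    by (simp add: sum.union_disjoint)
  then show ?thesis by (simp add: mp2_def M)
qed

lemma run_result:
  "state.X (run n a) = X_part a \<and> state.Z (run n a) = mertens a * (int b * (int b + 1) div 2)
   \<and> state.Y (run n a) = (\<Sum>y = 1..b. int y * mertens (n div y))
   \<and> ops (run n a) \<le> cost2 b + 40 * (a - r) + 22 * b + (\<Sum>y = 1..b. 13 + 8 * (b div y))
   \<and> 22 + b \<le> peak (run n a) \<and> (0 < b \<longrightarrow> peak (run n a) \<le> 22 + 2 * b)"
proof -
  define \<sigma> where "\<sigma> = for_each [1..<Suc a] (main_step n a) (init n a)"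
  have main: "after_main \<sigma>" unfolding \<sigma>_def by (rule main_loop)
  note main = main[unfolded after_main_def]
  let ?L = "\<lambda>j. for_each (rev [Suc j..<Suc b]) (final_step n b) \<sigma>"
  define P where "P = (\<lambda>j (\<tau> :: state). state.X \<tau> = X_part a \<and> state.Z \<tau> = mertens a * (int b * (int b + 1) div 2)
     \<and> state.Y \<tau> = (\<Sum>y = Suc j..b. int y * mertens (n div y))
     \<and> blk \<tau> = Map.empty \<and> mp \<tau> = arr b (\<lambda>y. if j < y then mertens (n div y) else mp2 b y)
     \<and> ops \<tau> \<le> cost2 b + 40 * (a - r) + 22 * b + (\<Sum>y = Suc j..b. 13 + 8 * (b div y))
     \<and> 22 + b \<le> peak \<tau> \<and> (0 < b \<longrightarrow> peak \<tau> \<le> 22 + 2 * b))"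
  have "P 0 (?L 0)"
  \<comment> \<open>Induction from \<open>b\<close> down to \<open>0\<close>, following the loop;
    \<open>j\<close> is the number of entries not yet final.\<close>
  proof (rule inc_induct[of 0 b])
    have "arr b (\<lambda>y. if b < y then mertens (n div y) else mp2 b y) = arr b (mp2 b)" by (rule arr_cong) simp
    then show "P b (?L b)" using main by (simp add: P_def for_each_def)
  next
    fix j assume j: "j < b" and "P (Suc j) (?L (Suc j))"
    then have P: "P (Suc j) (?L (Suc j))" by simp
    let ?\<tau> = "?L (Suc j)"
    note P' = P[unfolded P_def]
    let ?g = "\<lambda>y. if Suc j < y then mertens (n div y) else mp2 b y"
    have y: "1 \<le> Suc j" "Suc j \<le> b" using j by simp_all
    obtain c p m' where c: "c \<le> ops ?\<tau> + 11 + 8 * (b div Suc j)" "peak ?\<tau> \<le> p" "p \<le> max (peak ?\<tau>) (22 + card (dom (blk ?\<tau>)) + b)"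
      and eq: "final_step n b (Suc j) ?\<tau> = ?\<tau>\<lparr>state.m := m', ops := c, peak := p,
       mp := arr b (?g(Suc j := ?g (Suc j) - sum (M_at (Suc j)) {2..b div Suc j})),
       state.Y := state.Y ?\<tau> + int (Suc j) * (?g (Suc j) - sum (M_at (Suc j)) {2..b div Suc j})\<rparr>"
    proof (rule final_step_result)
      show "mp ?\<tau> = arr b ?g" using P' by blast
    qed (use y in auto)
    have g: "?g (Suc j) - sum (M_at (Suc j)) {2..b div Suc j} = mertens (n div Suc j)"
      using mp2_final[OF y] by simp
    have arr: "arr b (?g(Suc j := mertens (n div Suc j))) = arr b (\<lambda>y. if j < y then mertens (n div y) else mp2 b y)"
      by (rule arr_cong) auto
    have "?L j = tick 2 (final_step n b (Suc j) ?\<tau>)"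
    proof -
      have "[Suc j..<Suc b] = Suc j # [Suc (Suc j)..<Suc b]" using j by (simp add: upt_conv_Cons del: upt_Suc)
      then show ?thesis by (simp only: rev.simps for_each_snoc)
    qed
    then have L: "?L j = ?\<tau>\<lparr>state.m := m', ops := c + 2, peak := p,
       mp := arr b (\<lambda>y. if j < y then mertens (n div y) else mp2 b y),
       state.Y := state.Y ?\<tau> + int (Suc j) * mertens (n div Suc j)\<rparr>"
      unfolding eq g arr by (simp only:) (simp add: tick_def)
    have sum: "(\<Sum>y = Suc j..b. f y) = f (Suc j) + (\<Sum>y = Suc (Suc j)..b. f y)" for f :: "nat \<Rightarrow> 'x::comm_monoid_add"
      using y by (simp add: sum.atLeast_Suc_atMost)
    have pk: "p = peak ?\<tau>" using c(2,3) P' by simp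
    show "P j (?L j)" unfolding P_def L using P' c(1) pk by (simp add: sum del: upt_Suc)
  qed simp
  moreover have "run n a = ?L 0" unfolding run_def \<sigma>_def b_def by simp
  ultimately show ?thesis unfolding P_def by (simp del: upt_Suc)
qed

lemma alg_output_correct: "alg_output n a = int (totient_sum n)"
  using run_result totient_sum_hyperbola[of n a] n_pos a_pos
  by (simp add: alg_output_def X_part_def b_def)

end

subsection \<open>Number of operations\<close>

text \<open>Telescoping: with \<open>t * t - s * s = 1\<close> and \<open>s \<le> t\<close>, one
  gets \<open>1 / t \<le> 2 * (t - s)\<close> for consecutive square roots \<open>s\<close> and
  \<open>t\<close>.\<close>

lemma sum_inverse_sqrt_le: "(\<Sum>y = 1..b. 1 / sqrt (real y)) \<le> 2 * sqrt (real b)"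
proof (induction b)
  case (Suc b)
  let ?s = "sqrt (real b)" and ?t = "sqrt (real (Suc b))"
  have t: "0 < ?t" "?s \<le> ?t" by simp_all
  have "1 = ?t * ?t - ?s * ?s" by simp
  also have "\<dots> = (?t - ?s) * (?t + ?s)" by (simp only: algebra_simps)
  also have "\<dots> \<le> (?t - ?s) * (2 * ?t)" using t by (intro mult_left_mono) auto
  finally have "1 / ?t \<le> 2 * ?t - 2 * ?s" using t(1) by (simp add: field_simps)
  then show ?case using Suc by simp
qed simp

lemma root_quot_le: "real (root_quot n y) \<le> sqrt (real n) * (1 / sqrt (real y))"
  using of_int_floor_le[of "sqrt (real n / real y)"] by (simp add: root_quot_def real_sqrt_divide)

lemma sum_root_quot_le:
  assumes "0 < a"
  shows "(\<Sum>y = 1..n div a. real (root_quot n y)) \<le> 2 * (real n / sqrt (real a))"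
proof -
  have "(\<Sum>y = 1..n div a. real (root_quot n y)) \<le> sqrt (real n) * (\<Sum>y = 1..n div a. 1 / sqrt (real y))"
    unfolding sum_distrib_left by (intro sum_mono root_quot_le)
  also have "\<dots> \<le> sqrt (real n) * (2 * sqrt (real (n div a)))"
    by (intro mult_left_mono sum_inverse_sqrt_le) simp
  also have "\<dots> \<le> sqrt (real n) * (2 * sqrt (real n / real a))"
    by (intro mult_left_mono) (simp_all add: of_nat_div_le_of_nat)
  also have "\<dots> = 2 * (real n / sqrt (real a))" by (simp add: real_sqrt_divide)
  finally show ?thesis .
qed

context alg_run
begin

text \<open>Each family of inner iterations has total length at most the sum of \<open>u y\<close>;
  for step (2b) this appears after exchanging the sums. The factor 30 is 7 + 8 + 7 for steps (2b),
  (2d), (4) plus 8 for the final loop. The factor 200 is a generous bound for the linear terms, as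
  \<open>b\<close>, \<open>r\<close> and \<open>s\<^sub>0\<close> are at most
  \<open>a\<close>.\<close>

lemma ops_run_le: "ops (run n a) \<le> 200 * a + 30 * (\<Sum>y = 1..b. u y)"
proof -
  let ?S = "\<Sum>y = 1..b. u y"
  have "(\<Sum>k = 1..r. card {y \<in> {1..b}. k \<le> u y}) = (\<Sum>k = 1..r. \<Sum>y = 1..b. if k \<le> u y then 1 else 0)"
    by (simp add: sum.If_cases Int_def)
  also have "\<dots> = (\<Sum>y = 1..b. \<Sum>k = 1..r. if k \<le> u y then 1 else 0)" by (rule sum.swap)
  also have "\<dots> \<le> ?S"
  proof (rule sum_mono)
    fix y
    have "(\<Sum>k = 1..r. if k \<le> u y then 1 else 0) = card {k \<in> {1..r}. k \<le> u y}"
      by (simp add: sum.If_cases Int_def)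
    also have "\<dots> \<le> card {1..u y}" by (rule card_mono) auto
    finally show "(\<Sum>k = 1..r. if k \<le> u y then 1 else 0) \<le> u y" by simp
  qed
  finally have 1: "(\<Sum>k = 1..r. card {y \<in> {1..b}. k \<le> u y}) \<le> ?S" .
  have 2: "(\<Sum>y = 1..b. card (low_terms z y)) \<le> ?S" "(\<Sum>y = 1..b. card (high_terms z y)) \<le> ?S" for z
  proof -
    have *: "card {t \<in> {2..u y}. Q t} \<le> u y" for Q y
    proof -
      have "card {t \<in> {2..u y}. Q t} \<le> card {2..u y}" by (rule card_mono) auto
      then show ?thesis by simp
    qed
    show "(\<Sum>y = 1..b. card (low_terms z y)) \<le> ?S" "(\<Sum>y = 1..b. card (high_terms z y)) \<le> ?S"
      unfolding low_terms_def high_terms_def by (intro sum_mono *)+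
  qed
  have "(\<Sum>y = 1..b. 13 + 8 * (b div y)) = 13 * b + 8 * (\<Sum>y = 1..b. b div y)"
    by (simp add: sum.distrib sum_distrib_left)
  also have "(\<Sum>y = 1..b. b div y) \<le> ?S" by (intro sum_mono) (simp add: div_le_u)
  finally have 3: "(\<Sum>y = 1..b. 13 + 8 * (b div y)) \<le> 13 * b + 8 * ?S" by simp
  have 4: "b \<le> a" "r \<le> a" "s\<^sub>0 \<le> a" "1 \<le> a" using b_le_s0 s0_le_r r_less by simp_all
  have 5: "ops (run n a) \<le> cost2 b + 40 * (a - r) + 22 * b + (\<Sum>y = 1..b. 13 + 8 * (b div y))"
    using run_result by blast
  have 6: "cost2 b \<le> 10 + b + 40 * r + 7 * ?S + 11 * b + 11 * r + 8 * ?S + 11 * b + 22 * s\<^sub>0 + 7 * ?S"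
    unfolding cost2_def cost1_def flushed_r using 1 2(1)[of r] 2(2)[of b] by simp
  show ?thesis using 3 4 5 6 by linarith
qed

end

lemma alg_run_exists:
  assumes "1 \<le> n" "root_quot n 1 < a"
  obtains r s\<^sub>0 where "alg_run n a (n div a) r s\<^sub>0"
  using assms by (auto simp: alg_run_def)

lemma ops_run_upper:
  assumes "1 \<le> n" "root_quot n 1 < a"
  shows "real (ops (run n a)) \<le> 200 * real a + 60 * (real n / sqrt (real a))"
proof -
  obtain r s\<^sub>0 where "alg_run n a (n div a) r s\<^sub>0" using alg_run_exists[OF assms] .
  then have "ops (run n a) \<le> 200 * a + 30 * (\<Sum>y = 1..n div a. root_quot n y)" by (rule alg_run.ops_run_le)
  then have "real (ops (run n a)) \<le> real (200 * a + 30 * (\<Sum>y = 1..n div a. root_quot n y))" by (simp only: of_nat_le_iff)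
  also have "\<dots> = 200 * real a + 30 * (\<Sum>y = 1..n div a. real (root_quot n y))" by simp
  also have "\<dots> \<le> 200 * real a + 60 * (real n / sqrt (real a))"
    using sum_root_quot_le[of a n] assms by simp
  finally show ?thesis .
qed

section \<open>Lower bound on the number of operations for arbitrary parameters\<close>

text \<open>
  For an arbitrary parameter the output may be wrong, and the state may be undefined in places.
  A lower bound on the number of operations only needs that the loop in step (2c) terminates,
  which is guaranteed by the relation between \<open>\<gamma>\<close> and \<open>d\<close>.
\<close>

definition advances :: "nat \<Rightarrow> nat \<Rightarrow> state \<Rightarrow> state \<Rightarrow> bool" where
  "advances n k \<sigma> \<sigma>' \<longleftrightarrow> (gam \<sigma> = gamma_val n (state.d \<sigma>) \<longrightarrow>
     ops \<sigma> + k \<le> ops \<sigma>' \<and> gam \<sigma>' = gamma_val n (state.d \<sigma>'))"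

lemma advances_trans: "advances n k \<sigma> \<sigma>' \<Longrightarrow> advances n l \<sigma>' \<sigma>'' \<Longrightarrow> advances n (k + l) \<sigma> \<sigma>''"
  by (auto simp: advances_def)

lemma advances_trans0: "advances n k \<sigma> \<sigma>' \<Longrightarrow> advances n 0 \<sigma>' \<sigma>'' \<Longrightarrow> advances n k \<sigma> \<sigma>''"
  using advances_trans[of n k \<sigma> \<sigma>' 0 \<sigma>''] by simp

lemma advances_refl: "advances n 0 \<sigma> \<sigma>"
  by (simp add: advances_def)

lemma advances_tick: "advances n l \<sigma> \<sigma>' \<Longrightarrow> advances n l \<sigma> (tick k \<sigma>')"
  by (auto simp: advances_def tick_def)

lemma advances_mp_add: "advances n 0 \<sigma> (mp_add i e \<sigma>)"
  by (simp add: advances_def mp_add_def tick_def record_peak_def)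

lemma advances_blk_write: "advances n 0 \<sigma> (blk_write i e \<sigma>)"
  by (simp add: advances_def blk_write_def tick_def record_peak_def)

lemma advances_blk_clear: "advances n l \<sigma> \<sigma>' \<Longrightarrow> advances n l \<sigma> (blk_clear \<sigma>')"
  by (auto simp: advances_def blk_clear_def tick_def)

lemma advances_for_each:
  assumes "\<And>i \<sigma>. i \<in> set xs \<Longrightarrow> advances n (k i) \<sigma> (body i \<sigma>)"
  shows "advances n (\<Sum>i\<leftarrow>xs. k i + 2) \<sigma> (for_each xs body \<sigma>)"
  using assms
proof (induction xs arbitrary: \<sigma>)
  case Nil
  then show ?case by (simp add: for_each_def advances_refl)
next
  case (Cons i xs)
  have "advances n (k i + 2) \<sigma> (tick 2 (body i \<sigma>))"
    using Cons.prems[of i \<sigma>] by (auto simp: advances_def tick_def)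
  moreover have "advances n (\<Sum>i\<leftarrow>xs. k i + 2) (tick 2 (body i \<sigma>)) (for_each xs body (tick 2 (body i \<sigma>)))"
    using Cons by simp
  ultimately have "advances n ((k i + 2) + (\<Sum>i\<leftarrow>xs. k i + 2)) \<sigma> (for_each xs body (tick 2 (body i \<sigma>)))"
    by (rule advances_trans)
  then show ?case by (simp add: for_each_def)
qed

lemma advances_mono: "advances n k \<sigma> \<sigma>' \<Longrightarrow> l \<le> k \<Longrightarrow> advances n l \<sigma> \<sigma>'"
  by (auto simp: advances_def)

lemma advances_for_each0:
  assumes "\<And>i \<sigma>. i \<in> set xs \<Longrightarrow> advances n 0 \<sigma> (body i \<sigma>)"
  shows "advances n 0 \<sigma> (for_each xs body \<sigma>)"
  by (rule advances_mono[OF advances_for_each]) (use assms in auto)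

lemma advances_step_1: "advances n 0 \<sigma> (step_1 n x \<sigma>)"
  by (simp add: advances_def step_1_def tick_def Let_def)

lemma advances_step_2a: "advances n 0 \<sigma> (step_2a x \<sigma>)"
  unfolding step_2a_def by (rule advances_blk_write)

lemma advances_step_2b:
  "advances n (if 1 < x \<and> moebius x \<noteq> 0 then 2 * min b (n div x div x) else 0) \<sigma> (step_2b n b x \<sigma>)"
proof (cases "1 < x \<and> moebius x \<noteq> 0")
  case True
  let ?N = "min b (n div x div x)"
  have "advances n (\<Sum>i\<leftarrow>[1..<Suc ?N]. 0 + 2) \<sigma>
    (for_each [1..<Suc ?N] (\<lambda>y \<sigma>. tick 2 (mp_add y (- (moebius x * int (n div x div y))) \<sigma>)) \<sigma>)"
    by (rule advances_for_each) (intro advances_tick advances_mp_add)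
  then have "advances n (2 * ?N) \<sigma>
    (for_each [1..<Suc ?N] (\<lambda>y \<sigma>. tick 2 (mp_add y (- (moebius x * int (n div x div y))) \<sigma>)) \<sigma>)"
    by (rule advances_mono) (simp add: sum_list_triv del: upt_Suc)
  then show ?thesis
    unfolding step_2b_def Let_def using True by (simp del: upt_Suc add: advances_tick)
next
  case False
  then show ?thesis unfolding step_2b_def Let_def by (auto intro: advances_tick advances_refl)
qed

text \<open>A nonterminating \<open>while\<close> has an unspecified value, so nothing could be said
  about \<open>ops\<close> after it. If \<open>gam\<close> belongs to \<open>d\<close>, a successful
  test excludes \<open>d = 0\<close>, where \<open>gam\<close> is infinite, and hence
  \<open>d\<close> decreases.\<close>

lemma advances_step_2c: "advances n 0 \<sigma> (step_2c n x \<sigma>)"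
proof -
  let ?body = "(\<lambda>\<sigma>. let d = state.d \<sigma>;
                 \<sigma>' = mp_add d (1 - int (n div d) + state.m \<sigma> * int x) \<sigma>
             in tick 8 (\<sigma>'\<lparr>state.d := d - 1, gam := gamma_val n (d - 1)\<rparr>))"
  let ?W = "while (\<lambda>\<sigma>. enat x = gam \<sigma>) ?body \<sigma>"
  have "ops \<sigma> \<le> ops ?W \<and> gam ?W = gamma_val n (state.d ?W)" if g: "gam \<sigma> = gamma_val n (state.d \<sigma>)"
  proof -
    define P where "P = (\<lambda>\<tau> :: state. ops \<sigma> \<le> ops \<tau> \<and> gam \<tau> = gamma_val n (state.d \<tau>))"
    have "P ?W \<and> \<not> enat x = gam ?W"
    proof (rule while_induct[where f = state.d])
      show "P \<sigma>" using g by (simp add: P_def)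
    next
      fix \<tau> assume P: "P \<tau>" and x: "enat x = gam \<tau>"
      have "state.d \<tau> \<noteq> 0" using P x by (auto simp: P_def gamma_val_def split: if_splits)
      then show "P (?body \<tau>) \<and> state.d (?body \<tau>) < state.d \<tau>"
        using P by (simp add: P_def Let_def tick_def mp_add_def record_peak_def)
    qed
    then show ?thesis by (simp add: P_def)
  qed
  then show ?thesis unfolding step_2c_def by (intro advances_tick) (auto simp: advances_def)
qed

lemma advances_step_2d: "advances n 0 \<sigma> (step_2d n b r x \<sigma>)"
proof -
  have "advances n 0 \<sigma> (\<sigma>\<lparr>state.A := A'\<rparr>)" for A' by (simp add: advances_def)
  then show ?thesis unfolding step_2d_def Let_def
    by (auto intro!: advances_tick advances_refl advances_blk_clear advances_mp_add
        advances_for_each0 advances_trans0[OF _ advances_for_each0])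
qed

lemma advances_step_3: "advances n 0 \<sigma> (step_3 n b x \<sigma>)"
  by (auto simp: advances_def step_3_def Let_def tick_def blk_write_def record_peak_def)

lemma advances_step_4: "advances n 0 \<sigma> (step_4 n a b r x \<sigma>)"
  unfolding step_4_def
  by (auto intro!: advances_tick advances_refl advances_blk_clear advances_mp_add advances_for_each0)

lemma advances_step_5: "advances n 0 \<sigma> (step_5 a b x \<sigma>)"
  by (auto simp: advances_def step_5_def tick_def)

text \<open>Termination holds for any \<open>b\<close>: as soon as \<open>t\<close> exceeds
  \<open>v\<close>, the quotient \<open>v div t\<close> is 0 and the loop ends.\<close>

lemma advances_final_step: "advances n 0 \<sigma> (final_step n b y \<sigma>)"
proof -
  let ?v = "n div y"
  let ?c = "\<lambda>(t, \<sigma>). \<not> real n / real (b + 1) \<ge> real (?v div t)"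
  let ?body = "\<lambda>(t, \<sigma>). (t + 1, tick 8 (\<sigma>\<lparr>state.m := state.m \<sigma> - the (mp \<sigma> (n div (?v div t)))\<rparr>))"
  let ?W = "while ?c ?body (2, \<sigma>\<lparr>state.m := 0\<rparr>)"
  define P where "P = (\<lambda>p :: nat \<times> state. 2 \<le> fst p \<and> advances n 0 \<sigma> (snd p))"
  have "P ?W \<and> \<not> ?c ?W"
  proof (rule while_induct[where f = "\<lambda>p. ?v + 1 - fst p"])
    show "P (2, \<sigma>\<lparr>state.m := 0\<rparr>)" by (simp add: P_def advances_def)
  next
    fix p assume P: "P p" and c: "?c p"
    obtain t \<tau> where p: "p = (t, \<tau>)" by (cases p)
    have "?v div t \<noteq> 0"
    proof
      assume "?v div t = 0"
      moreover have "0 \<le> real n / real (b + 1)" by simp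
      ultimately show False using c by (simp add: p)
    qed
    then have "t \<le> ?v" by (metis div_less not_le)
    moreover have "P (?body p)" using P by (auto simp: P_def p advances_def tick_def)
    ultimately show "P (?body p) \<and> ?v + 1 - fst (?body p) < ?v + 1 - fst p" by (simp add: p)
  qed
  then obtain t \<tau> where W: "?W = (t, \<tau>)" and adv: "advances n 0 \<sigma> \<tau>" by (cases ?W) (auto simp: P_def)
  show ?thesis
    unfolding final_step_def Let_def W prod.case using adv
    by (auto simp: advances_def tick_def mp_add_def record_peak_def)
qed

text \<open>From \<open>x * x \<le> a \<le> n\<close> follow \<open>x \<le> r\<close>, so step (2b)
  is reached, and \<open>n div a \<le> n div x div x\<close>, so its loop has full length. Only the
  2 units of loop overhead per iteration are counted.\<close>

lemma advances_main_step:
  "advances n (if 1 < x \<and> moebius x \<noteq> 0 \<and> x * x \<le> a \<and> a \<le> n then 2 * (n div a) else 0) \<sigma> (main_step n a x \<sigma>)"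
proof -
  let ?w = "if 1 < x \<and> moebius x \<noteq> 0 \<and> x * x \<le> a \<and> a \<le> n then 2 * (n div a) else 0"
  let ?b = "n div a" and ?r = "root_quot n 1"
  define \<tau> where "\<tau> = tick 1 (step_1 n x \<sigma>)"
  have 1: "advances n 0 \<sigma> \<tau>" unfolding \<tau>_def by (intro advances_tick advances_step_1)
  have 2: "advances n ?w (step_2a x \<tau>) (step_2b n ?b x (step_2a x \<tau>))"
  proof (rule advances_mono[OF advances_step_2b])
    have "n div a \<le> n div x div x" if "1 < x" "x * x \<le> a"
      using that by (simp add: div_mult2_eq[symmetric] div_le_mono2)
    then show "?w \<le> (if 1 < x \<and> moebius x \<noteq> 0 then 2 * min ?b (n div x div x) else 0)" by auto
  qed
  have "advances n ?w \<sigma> (if x \<le> ?r then step_2d n ?b ?r x (step_2c n x (step_2b n ?b x (step_2a x \<tau>))) else step_3 n ?b x \<tau>)"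
  proof (cases "x \<le> ?r")
    case True
    have "advances n (0 + 0 + ?w) \<sigma> (step_2b n ?b x (step_2a x \<tau>))"
      by (intro advances_trans[OF advances_trans[OF 1 advances_step_2a] 2])
    then have "advances n ?w \<sigma> (step_2d n ?b ?r x (step_2c n x (step_2b n ?b x (step_2a x \<tau>))))"
      by (intro advances_trans0[OF advances_trans0[OF _ advances_step_2c] advances_step_2d]) simp
    then show ?thesis using True by simp
  next
    case False
    have "\<not> (x * x \<le> a \<and> a \<le> n)"
      using False le_root_quot_iff[of 1 x n] by auto
    then have "?w = 0" by auto
    moreover have "advances n 0 \<sigma> (step_3 n ?b x \<tau>)"
      by (intro advances_trans0[OF 1 advances_step_3])
    ultimately show ?thesis using False by simp
  qed
  then show ?thesis unfolding main_step_def Let_def \<tau>_def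
    by (intro advances_trans0[OF advances_trans0[OF _ advances_step_4] advances_step_5])
qed

section \<open>Positive density of the squarefree numbers\<close>

lemma sum_inverse_squares_le: "2 \<le> N \<Longrightarrow> (\<Sum>k = 2..N. 1 / (real k)\<^sup>2) \<le> 3 / 4 - 1 / real N"
proof (induction N rule: dec_induct)
  case (step N)
  have "1 / real N - 1 / real (Suc N) = 1 / (real N * real (Suc N))"
    using step(1) by (simp add: field_simps)
  moreover have "1 / (real (Suc N))\<^sup>2 \<le> 1 / (real N * real (Suc N))"
    using step(1) by (intro divide_left_mono) (simp_all add: power2_eq_square)
  ultimately have "1 / (real (Suc N))\<^sup>2 \<le> 1 / real N - 1 / real (Suc N)" by simp
  then show ?case using step by simp
qed simp

text \<open>A number that is not squarefree is a multiple of some \<open>k ^ 2\<close> with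
  \<open>k \<ge> 2\<close>. The multiples of these squares up to \<open>N\<close> number at most
  \<open>N\<close> times the sum of \<open>1 / k ^ 2\<close>, which telescoping from
  \<open>k = 2\<close> keeps below 3/4; at least a quarter of the numbers remain.\<close>

lemma card_squarefree_ge: "real N \<le> 4 * real (card {x \<in> {1..N}. squarefree x})"
proof -
  consider "N = 0" | "N = 1" | "2 \<le> N" by linarith
  then show ?thesis
  proof cases
    case 2
    have "{x \<in> {1..1::nat}. squarefree x} = {1}" by auto
    then show ?thesis by (simp only: 2) simp
  next
    case 3
    let ?Q = "{x \<in> {1..N}. squarefree x}" and ?D = "\<lambda>k. {x \<in> {1..N}. k ^ 2 dvd x}"
    have "{1..N} \<subseteq> ?Q \<union> (\<Union>k\<in>{2..N}. ?D k)"
    proof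
      fix x assume x: "x \<in> {1..N}"
      show "x \<in> ?Q \<union> (\<Union>k\<in>{2..N}. ?D k)"
      proof (cases "squarefree x")
        case False
        then obtain k where k: "k ^ 2 dvd x" "\<not> k dvd 1" unfolding squarefree_def by auto
        have "k \<noteq> 0" using k(1) x by (auto intro: ccontr)
        then have "2 \<le> k" using k(2) by (cases "k = 1") auto
        moreover have "k ^ 2 \<le> x" using k(1) x by (auto intro: dvd_imp_le)
        then have "k \<le> N" using x \<open>k \<noteq> 0\<close> self_le_power[of k 2] by auto
        ultimately show ?thesis using x k(1) by auto
      qed (use x in auto)
    qed
    then have "card {1..N} \<le> card (?Q \<union> (\<Union>k\<in>{2..N}. ?D k))" by (intro card_mono) auto
    also have "\<dots> \<le> card ?Q + card (\<Union>k\<in>{2..N}. ?D k)" by (rule card_Un_le)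
    also have "card (\<Union>k\<in>{2..N}. ?D k) \<le> (\<Sum>k = 2..N. card (?D k))" by (rule card_UN_le) simp
    finally have "real N \<le> real (card ?Q + (\<Sum>k = 2..N. card (?D k)))" by (simp only: of_nat_le_iff) simp
    also have "\<dots> = real (card ?Q) + (\<Sum>k = 2..N. real (card (?D k)))" by simp
    also have "(\<Sum>k = 2..N. real (card (?D k))) \<le> (\<Sum>k = 2..N. real N * (1 / (real k)\<^sup>2))"
    proof (rule sum_mono)
      fix k assume k: "k \<in> {2..N}"
      have "?D k \<subseteq> (\<lambda>j. k ^ 2 * j) ` {1..N div k ^ 2}"
      proof
        fix x assume x: "x \<in> ?D k"
        then obtain j where j: "x = k ^ 2 * j" by (auto elim: dvdE)
        have "1 \<le> j" "j \<le> N div k ^ 2" using x k by (auto simp: j less_eq_div_iff_mult_less_eq mult.commute Suc_le_eq)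
        then show "x \<in> (\<lambda>j. k ^ 2 * j) ` {1..N div k ^ 2}" using j by auto
      qed
      then have "card (?D k) \<le> N div k ^ 2" by (metis card_atLeastAtMost diff_Suc_1 finite_atLeastAtMost surj_card_le)
      then have "real (card (?D k)) \<le> real (N div k ^ 2)" by simp
      also have "\<dots> \<le> real N / real (k ^ 2)" by (rule of_nat_div_le_of_nat)
      finally show "real (card (?D k)) \<le> real N * (1 / (real k)\<^sup>2)" by simp
    qed
    also have "\<dots> = real N * (\<Sum>k = 2..N. 1 / (real k)\<^sup>2)" by (simp add: sum_distrib_left)
    also have "\<dots> \<le> real N * (3 / 4)"
    proof (rule mult_left_mono)
      have "0 \<le> 1 / real N" by simp
      then show "(\<Sum>k = 2..N. 1 / (real k)\<^sup>2) \<le> 3 / 4" using sum_inverse_squares_le[OF 3] by linarith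
    qed simp
    finally show ?thesis by simp
  qed simp
qed

lemma ops_run_ge:
  assumes "0 < a" "a \<le> n" "N * N \<le> a"
  shows "(n div a) * N \<le> 4 * ops (run n a)"
proof -
  let ?b = "n div a"
  let ?w = "\<lambda>x. if 1 < x \<and> moebius x \<noteq> 0 \<and> x * x \<le> a \<and> a \<le> n then 2 * ?b else 0"
  let ?Q = "{x \<in> {1..N}. squarefree x}"
  define c where "c = card ?Q"
  have "advances n (\<Sum>x\<leftarrow>[1..<Suc a]. ?w x + 2) (init n a) (for_each [1..<Suc a] (main_step n a) (init n a))"
    by (rule advances_for_each) (rule advances_main_step)
  then have "advances n (\<Sum>x\<leftarrow>[1..<Suc a]. ?w x + 2) (init n a) (run n a)"
    unfolding run_def by (rule advances_trans0) (intro advances_for_each0 advances_final_step)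
  moreover have "gam (init n a) = gamma_val n (state.d (init n a))" "ops (init n a) = 10 + ?b"
    by (simp_all add: init_def Let_def record_peak_def)
  ultimately have ops: "10 + ?b + (\<Sum>x\<leftarrow>[1..<Suc a]. ?w x + 2) \<le> ops (run n a)" by (simp add: advances_def)
  have "?Q - {1} \<subseteq> {1..a}"
  proof
    fix x assume "x \<in> ?Q - {1}"
    then have "x * x \<le> N * N" "x \<le> x * x" "1 \<le> x" by (auto intro: mult_le_mono)
    then have "x \<le> a" using assms(3) by linarith
    then show "x \<in> {1..a}" using \<open>1 \<le> x\<close> by simp
  qed
  then have "(\<Sum>x\<in>?Q - {1}. ?w x) \<le> (\<Sum>x = 1..a. ?w x)" by (intro sum_mono2) auto
  moreover have "(\<Sum>x\<in>?Q - {1}. ?w x) = (\<Sum>x\<in>?Q - {1}. 2 * ?b)"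
  proof (rule sum.cong[OF refl])
    fix x assume "x \<in> ?Q - {1}"
    then have x: "1 < x" "squarefree x" "x * x \<le> N * N" by (auto intro: mult_le_mono)
    then have "moebius x \<noteq> 0" by (simp add: moebius_def)
    then show "?w x = 2 * ?b" using x assms by auto
  qed
  moreover have "card (?Q - {1}) = c - 1" by (cases "N = 0") (simp_all add: c_def)
  ultimately have w: "(c - 1) * (2 * ?b) \<le> (\<Sum>x = 1..a. ?w x)" by simp
  have "(\<Sum>x = 1..a. ?w x) \<le> (\<Sum>x\<leftarrow>[1..<Suc a]. ?w x + 2)"
    by (simp only: interv_sum_list_conv_sum_set_nat set_upt atLeastLessThanSuc_atLeastAtMost) (intro sum_mono, simp)
  with w ops have "?b + (c - 1) * (2 * ?b) \<le> ops (run n a)" by linarith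
  \<comment> \<open>Step (2b) does nothing at the squarefree number 1; the \<open>b\<close>
    operations that initialise \<open>M'\<close> stand in for it.\<close>
  moreover have "c * ?b \<le> ?b + (c - 1) * (2 * ?b)" by (cases c) simp_all
  ultimately have "c * ?b \<le> ops (run n a)" by linarith
  moreover have "real N \<le> real (4 * c)" using card_squarefree_ge[of N] by (simp add: c_def)
  then have "N \<le> 4 * c" by (simp only: of_nat_le_iff)
  then have "?b * N \<le> ?b * (4 * c)" by (rule mult_le_mono2)
  moreover have "?b * (4 * c) = 4 * (c * ?b)" by simp
  ultimately show ?thesis by linarith
qed

text \<open>Rounding down \<open>n div a\<close> and \<open>sqrt a\<close>, both at least 1, loses a
  factor of at most 2 each; with the 4 of \<open>ops_run_ge\<close> this makes 16.\<close>

lemma ops_run_lower: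
  assumes "0 < a" "a \<le> n"
  shows "real n / sqrt (real a) \<le> 16 * real (ops (run n a))"
proof -
  define N where "N = nat \<lfloor>sqrt (real a)\<rfloor>"
  have N1: "real N \<le> sqrt (real a)" "sqrt (real a) < real N + 1" "1 \<le> real N"
    using assms(1) by (simp_all add: N_def)
  have "real (N * N) \<le> real a"
    using mult_mono[OF N1(1) N1(1)] by simp
  then have "N * N \<le> a" by (simp only: of_nat_le_iff)
  then have "(n div a) * N \<le> 4 * ops (run n a)" by (rule ops_run_ge[OF assms])
  then have "real ((n div a) * N) \<le> real (4 * ops (run n a))" by (simp only: of_nat_le_iff)
  then have 1: "real (n div a) * real N \<le> 4 * real (ops (run n a))" by simp
  have "n < a * (n div a + 1)" using assms(1) by (simp add: dividend_less_times_div)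
  also have "\<dots> \<le> a * (2 * (n div a))" using assms by (intro mult_le_mono2) (simp add: Suc_le_eq div_greater_zero_iff)
  finally have "real n \<le> real (a * (2 * (n div a)))" by (simp only: of_nat_le_iff)
  then have b: "real n / (2 * real a) \<le> real (n div a)" using assms(1) by (simp add: field_simps)
  have "sqrt (real a) / 2 \<le> real N" using N1 by linarith
  then have "real n / (2 * real a) * (sqrt (real a) / 2) \<le> real (n div a) * real N"
    using b by (intro mult_mono) auto
  also have "real n / (2 * real a) * (sqrt (real a) / 2) = real n / sqrt (real a) / 4"
  proof -
    have "real a = sqrt (real a) * sqrt (real a)" by simp
    then show ?thesis using assms(1) by (simp add: field_simps)
  qed
  finally have "real n / sqrt (real a) / 4 \<le> 4 * real (ops (run n a))" using 1 by (rule order_trans)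
  then show ?thesis by simp
qed

subsection \<open>Asymptotics\<close>

text \<open>\<open>q\<close> is the solution of \<open>x / sqrt q = q * l\<close>, which balances
  loops against sieving. The same \<open>q\<close> satisfies \<open>x / q = sqrt q * l\<close>, so
  the array size and the bound on the sieve space also agree in order.\<close>

lemma balanced_powr:
  fixes x l :: real
  assumes "0 < x" "0 < l"
  defines "q \<equiv> (x / l) powr (2 / 3)"
  shows "x / sqrt q = x powr (2 / 3) * l powr (1 / 3)"
    and "q * l = x powr (2 / 3) * l powr (1 / 3)"
    and "x / q = x powr (1 / 3) * l powr (2 / 3)"
    and "sqrt q * l = x powr (1 / 3) * l powr (2 / 3)"
proof -
  have x: "x = x powr (1 / 3) * x powr (2 / 3)" and l: "l = l powr (1 / 3) * l powr (2 / 3)"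
    using assms by (simp_all flip: powr_add)
  have q: "q = x powr (2 / 3) / l powr (2 / 3)" using assms by (simp add: q_def powr_divide)
  have s: "sqrt q = x powr (1 / 3) / l powr (1 / 3)"
    using assms by (simp add: q_def powr_half_sqrt[symmetric] powr_powr powr_divide)
  have pos: "0 < x powr (1 / 3)" "0 < x powr (2 / 3)" "0 < l powr (1 / 3)" "0 < l powr (2 / 3)"
    using assms by simp_all
  show "x / sqrt q = x powr (2 / 3) * l powr (1 / 3)" unfolding s by (subst x) (use pos in simp)
  show "q * l = x powr (2 / 3) * l powr (1 / 3)" unfolding q by (subst (2) l) (use pos in simp)
  show "x / q = x powr (1 / 3) * l powr (2 / 3)" unfolding q by (subst x) (use pos in simp)
  show "sqrt q * l = x powr (1 / 3) * l powr (2 / 3)" unfolding s by (subst (2) l) (use pos in simp)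
qed

definition optimum :: "nat \<Rightarrow> real" where
  "optimum n = (real n / ln (ln (real n))) powr (2 / 3)"

definition time_bound :: "nat \<Rightarrow> real" where
  "time_bound n = real n powr (2 / 3) * ln (ln (real n)) powr (1 / 3)"

definition space_bound :: "nat \<Rightarrow> real" where
  "space_bound n = real n powr (1 / 3) * ln (ln (real n)) powr (2 / 3)"

lemma eventually_lnln: "\<forall>\<^sub>F n in sequentially. 1 \<le> ln (ln (real n)) \<and> 1 \<le> n"
  by (rule eventually_conj; real_asymp)

lemma optimum_identities:
  assumes "1 \<le> ln (ln (real n))" "1 \<le> n"
  shows "real n / sqrt (optimum n) = time_bound n" "optimum n * ln (ln (real n)) = time_bound n"
    "real n / optimum n = space_bound n" "sqrt (optimum n) * ln (ln (real n)) = space_bound n"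
  unfolding optimum_def time_bound_def space_bound_def
  using balanced_powr[of "real n" "ln (ln (real n))"] assms by simp_all

lemma optimum_at_top: "filterlim optimum at_top sequentially"
  unfolding optimum_def by real_asymp

text \<open>The first part secures \<open>r < a\<close>, hence correctness; the second secures
  \<open>a \<le> n\<close>, hence \<open>b > 0\<close> and the bound on the peak.\<close>

lemma eventually_optimum_between:
  assumes "0 < c"
  shows "\<forall>\<^sub>F n in sequentially. sqrt (real n) < c * optimum n"
    and "\<forall>\<^sub>F n in sequentially. c * optimum n \<le> real n"
  unfolding optimum_def using assms by real_asymp+

lemma eventually_space_bound: "\<forall>\<^sub>F n in sequentially. 22 \<le> space_bound n"
  unfolding space_bound_def by real_asymp

lemma eventually_exp_le_optimum: "\<forall>\<^sub>F n in sequentially. exp 1 \<le> optimum n"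
  unfolding optimum_def by real_asymp

text \<open>\<open>ln (optimum n)\<close> grows like \<open>2 / 3 * ln n\<close>, so the iterated
  logarithms differ by a bounded amount; the factor 1/2 absorbs it.\<close>

lemma eventually_lnln_optimum: "\<forall>\<^sub>F n in sequentially. ln (ln (real n)) / 2 \<le> ln (ln (optimum n))"
  unfolding optimum_def by real_asymp

lemma optimum_le_time_bound:
  assumes "1 \<le> ln (ln (real n))" "1 \<le> n"
  shows "optimum n \<le> time_bound n"
proof -
  have "optimum n * 1 \<le> optimum n * ln (ln (real n))"
    using assms by (intro mult_left_mono) (simp_all add: optimum_def)
  then show ?thesis using optimum_identities[OF assms] by simp
qed

text \<open>The loop cost \<open>n / sqrt a\<close> falls with \<open>a\<close>, the sieve cost
  rises, and both have the order of \<open>time_bound\<close> at \<open>optimum\<close>. Hence below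
  \<open>optimum\<close> the loops are expensive enough, above it the sieve is. The bound is uniform
  in \<open>a\<close>, so it applies to every choice of the parameter.\<close>

lemma alg_time_lower:
  assumes sieve: "\<And>k. k \<ge> K \<Longrightarrow> c * (real k * ln (ln (real k))) \<le> real (sieve_time k)" and "0 < c"
  shows "\<forall>\<^sub>F n in sequentially. \<forall>a>0. min (c / 2) (1 / 16) * time_bound n \<le> real (alg_time sieve_time n a)"
proof -
  have "\<forall>\<^sub>F n in sequentially. real K \<le> optimum n"
    using optimum_at_top by (simp add: filterlim_at_top)
  then show ?thesis
    using eventually_optimum_between(2)[OF zero_less_one] eventually_exp_le_optimum eventually_lnln_optimum eventually_lnln
  proof eventually_elim
    case (elim n)
    note ids = optimum_identities[of n]
    show ?case
    proof (intro allI impI)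
      fix a :: nat assume a: "0 < a"
      have time: "real (alg_time sieve_time n a) = real (sieve_time a) + real (ops (run n a)) + 2"
        by (simp add: alg_time_def)
      have T: "0 \<le> time_bound n" by (simp add: time_bound_def)
      show "min (c / 2) (1 / 16) * time_bound n \<le> real (alg_time sieve_time n a)"
      proof (cases "real a \<le> optimum n")
        case True
        then have "real a \<le> real n" using elim by simp
        then have "real n / sqrt (real a) \<le> 16 * real (ops (run n a))" using a by (intro ops_run_lower) auto
        moreover have "real n / sqrt (optimum n) \<le> real n / sqrt (real a)"
          using True a by (intro divide_left_mono) auto
        ultimately have "time_bound n \<le> 16 * real (ops (run n a))" using ids elim by simp
        moreover have "min (c / 2) (1 / 16) * time_bound n \<le> 1 / 16 * time_bound n"
          using T by (intro mult_right_mono) auto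
        ultimately show ?thesis unfolding time by linarith
      next
        case False
        then have "K \<le> a" using elim by simp
        have e: "exp 1 \<le> optimum n" using elim by blast
        then have o: "0 < optimum n" using exp_gt_zero less_le_trans by blast
        have "exp 1 \<le> real a" using e False by simp
        have "1 \<le> ln (optimum n)" using e o by (simp add: ln_ge_iff)
        have "ln (optimum n) \<le> ln (real a)" using False o by simp
        then have "ln (ln (optimum n)) \<le> ln (ln (real a))" using \<open>1 \<le> ln (optimum n)\<close> by simp
        then have "ln (ln (real n)) / 2 \<le> ln (ln (real a))" using elim by linarith
        then have "optimum n * (ln (ln (real n)) / 2) \<le> real a * ln (ln (real a))"
          using False o elim by (intro mult_mono) auto
        then have "time_bound n / 2 \<le> real a * ln (ln (real a))" using ids(2) elim by simp
        then have "c * (time_bound n / 2) \<le> c * (real a * ln (ln (real a)))" using \<open>0 < c\<close> by (intro mult_left_mono) auto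
        also have "\<dots> \<le> real (sieve_time a)" using sieve[OF \<open>K \<le> a\<close>] .
        finally have "c / 2 * time_bound n \<le> real (sieve_time a)" by simp
        moreover have "min (c / 2) (1 / 16) * time_bound n \<le> c / 2 * time_bound n"
          using T by (intro mult_right_mono) auto
        ultimately show ?thesis unfolding time by linarith
      qed
    qed
  qed
qed

theorem theorem7:
  fixes sieve_time sieve_space :: "nat \<Rightarrow> nat"
    and a :: "nat \<Rightarrow> nat"
  assumes sieve_time: "(\<lambda>k. real (sieve_time k)) \<in> \<Theta>(\<lambda>k. real k * ln (ln (real k)))"
    and sieve_space: "(\<lambda>k. real (sieve_space k)) \<in> O(\<lambda>k. sqrt (real k) * ln (ln (real k)))"
    and a_pos: "\<And>n. a n > 0"
    and a_choice: "(\<lambda>n. real (a n)) \<in> \<Theta>(\<lambda>n. (real n / ln (ln (real n))) powr (2 / 3))"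
  shows
    "(\<forall>n\<ge>1. \<lfloor>sqrt (real n)\<rfloor> < int (a n) \<longrightarrow> alg_output n (a n) = int (totient_sum n))
     \<and> (\<forall>\<^sub>F n in sequentially. alg_output n (a n) = int (totient_sum n))
     \<and> (\<lambda>n. real (alg_space sieve_space n (a n)))
          \<in> \<Theta>(\<lambda>n. real n powr (1 / 3) * ln (ln (real n)) powr (2 / 3))
     \<and> (\<lambda>n. real (alg_time sieve_time n (a n)))
          \<in> \<Theta>(\<lambda>n. real n powr (2 / 3) * ln (ln (real n)) powr (1 / 3))
     \<and> (\<forall>a'. (\<forall>n. a' n > 0) \<longrightarrow>
          (\<lambda>n. real (alg_time sieve_time n (a' n)))
            \<in> \<Omega>(\<lambda>n. real (alg_time sieve_time n (a n))))"
proof -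
  have correct: "alg_output n (a n) = int (totient_sum n)" if n: "1 \<le> n" "root_quot n 1 < a n" for n
  proof -
    obtain r s\<^sub>0 where "alg_run n (a n) (n div a n) r s\<^sub>0" using alg_run_exists[OF n] .
    then show ?thesis by (rule alg_run.alg_output_correct)
  qed
  have root_less: "root_quot n 1 < k \<longleftrightarrow> \<lfloor>sqrt (real n)\<rfloor> < int k" for n k
    by (simp add: root_quot_def nat_less_iff)
  have "(\<lambda>n. real (a n)) \<in> \<Theta>(optimum)" using a_choice by (simp add: optimum_def[abs_def])
  note a_big = bigthetaD1[OF this] bigthetaD2[OF this]
  obtain c1 where "0 < c1" "\<forall>\<^sub>F n in sequentially. c1 * norm (optimum n) \<le> norm (real (a n))"
    using a_big(2) by (elim landau_omega.bigE)
  moreover obtain c2 where "0 < c2" "\<forall>\<^sub>F n in sequentially. norm (real (a n)) \<le> c2 * norm (optimum n)"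
    using a_big(1) by (elim landau_o.bigE)
  ultimately have c: "0 < c1" "0 < c2"
    and "\<forall>\<^sub>F n in sequentially. c1 * norm (optimum n) \<le> norm (real (a n))"
    and "\<forall>\<^sub>F n in sequentially. norm (real (a n)) \<le> c2 * norm (optimum n)" by auto
  then have a_bounds: "\<forall>\<^sub>F n in sequentially. c1 * optimum n \<le> real (a n) \<and> real (a n) \<le> c2 * optimum n"
    by (simp add: optimum_def eventually_conj_iff)
  obtain t1 where t1: "0 < t1" "\<forall>\<^sub>F k in sequentially. t1 * norm (real k * ln (ln (real k))) \<le> norm (real (sieve_time k))"
    using bigthetaD2[OF sieve_time] by (elim landau_omega.bigE)
  obtain t2 where t2: "0 < t2" "\<forall>\<^sub>F k in sequentially. norm (real (sieve_time k)) \<le> t2 * norm (real k * ln (ln (real k)))"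
    using bigthetaD1[OF sieve_time] by (elim landau_o.bigE)
  note t = t1(1) t2(1)
  note t1(2) t2(2)
  moreover have "\<forall>\<^sub>F k in sequentially. 0 \<le> real k * ln (ln (real k))" by real_asymp
  ultimately have time_k: "\<forall>\<^sub>F k in sequentially. t1 * (real k * ln (ln (real k))) \<le> real (sieve_time k)
      \<and> real (sieve_time k) \<le> t2 * (real k * ln (ln (real k)))"
    by eventually_elim simp
  obtain s2 where s: "0 < s2" and s_bound: "\<forall>\<^sub>F k in sequentially. norm (real (sieve_space k)) \<le> s2 * norm (sqrt (real k) * ln (ln (real k)))"
    using sieve_space by (elim landau_o.bigE)
  have "\<forall>\<^sub>F k in sequentially. 0 \<le> sqrt (real k) * ln (ln (real k))" by real_asymp
  with s_bound have space_k: "\<forall>\<^sub>F k in sequentially. real (sieve_space k) \<le> s2 * (sqrt (real k) * ln (ln (real k)))"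
    by eventually_elim simp
  \<comment> \<open>The sieve bounds hold for large arguments only; this permits substituting
    \<open>a n\<close>.\<close>
  have a_at_top: "filterlim a sequentially sequentially"
  proof -
    have "filterlim (\<lambda>n. c1 * optimum n) at_top sequentially"
      by (rule filterlim_tendsto_pos_mult_at_top[OF tendsto_const c(1) optimum_at_top])
    then have "filterlim (\<lambda>n. real (a n)) at_top sequentially"
      by (rule filterlim_at_top_mono) (use a_bounds in eventually_elim, simp)
    then show ?thesis by (simp add: filterlim_sequentially_iff_filterlim_real)
  qed
  have time_a: "\<forall>\<^sub>F n in sequentially. real (sieve_time (a n)) \<le> t2 * (real (a n) * ln (ln (real (a n))))"
    using eventually_compose_filterlim[OF time_k a_at_top] by eventually_elim simp
  have space_a: "\<forall>\<^sub>F n in sequentially. real (sieve_space (a n)) \<le> s2 * (sqrt (real (a n)) * ln (ln (real (a n))))"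
    using eventually_compose_filterlim[OF space_k a_at_top] .
  \<comment> \<open>As 3 exceeds \<open>exp 1\<close>, this makes
    \<open>ln (ln (real (a n)))\<close> nonnegative.\<close>
  have a_ge_3: "\<forall>\<^sub>F n in sequentially. 3 \<le> a n"
    using a_at_top by (simp add: filterlim_at_top)
  have basic: "\<forall>\<^sub>F n in sequentially. 1 \<le> n \<and> 1 \<le> ln (ln (real n)) \<and> root_quot n 1 < a n \<and> real (a n) \<le> real n
      \<and> c1 * optimum n \<le> real (a n) \<and> real (a n) \<le> c2 * optimum n \<and> 0 < optimum n
      \<and> 0 \<le> ln (ln (real (a n))) \<and> ln (ln (real (a n))) \<le> ln (ln (real n))"
    using a_bounds eventually_lnln eventually_optimum_between(1)[OF c(1)] eventually_optimum_between(2)[OF c(2)]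
      eventually_exp_le_optimum a_ge_3
  proof eventually_elim
    case (elim n)
    have "sqrt (real n) < real (a n)" using elim by linarith
    then have "\<lfloor>sqrt (real n)\<rfloor> < int (a n)" by (simp add: floor_less_iff)
    then have 1: "root_quot n 1 < a n" by (simp only: root_less)
    have 2: "real (a n) \<le> real n" using elim by linarith
    have "exp 1 \<le> real (a n)" using elim exp_le by (metis of_nat_le_iff of_nat_numeral order_trans)
    then have l: "1 \<le> ln (real (a n))" using elim by (simp add: ln_ge_iff)
    have "ln (real (a n)) \<le> ln (real n)" using 2 elim by simp
    then have "ln (ln (real (a n))) \<le> ln (ln (real n))" using l by simp
    moreover have "0 < optimum n" using elim exp_gt_zero less_le_trans by blast
    ultimately show ?case using elim 1 2 l by simp
  qed
  have part2: "\<forall>\<^sub>F n in sequentially. alg_output n (a n) = int (totient_sum n)"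
    using basic by eventually_elim (simp add: correct)
  \<comment> \<open>The summands of the constant belong to the sieve, to the two terms of
    \<open>ops_run_upper\<close>, and to the closing 2 operations, absorbed by
    \<open>1 \<le> time_bound n\<close>.\<close>
  have upper: "\<forall>\<^sub>F n in sequentially. real (alg_time sieve_time n (a n)) \<le> (t2 * c2 + 200 * c2 + 60 / sqrt c1 + 2) * time_bound n"
    using basic time_a eventually_exp_le_optimum
  proof eventually_elim
    case (elim n)
    have ids: "real n / sqrt (optimum n) = time_bound n" "optimum n * ln (ln (real n)) = time_bound n"
      using optimum_identities[of n] elim by simp_all
    have "real (a n) * ln (ln (real (a n))) \<le> (c2 * optimum n) * ln (ln (real n))"
      using elim by (intro mult_mono) auto
    also have "\<dots> = c2 * time_bound n" by (simp add: ids(2)[symmetric])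
    finally have "t2 * (real (a n) * ln (ln (real (a n)))) \<le> t2 * (c2 * time_bound n)"
      using t by (intro mult_left_mono) auto
    then have 1: "real (sieve_time (a n)) \<le> t2 * c2 * time_bound n" using elim by simp
    have "real n / sqrt (real (a n)) \<le> real n / sqrt (c1 * optimum n)"
      using elim c by (intro divide_left_mono) auto
    also have "\<dots> = 1 / sqrt c1 * time_bound n" by (simp add: ids(1)[symmetric] real_sqrt_mult)
    finally have 2: "real n / sqrt (real (a n)) \<le> 1 / sqrt c1 * time_bound n" .
    have le: "optimum n \<le> time_bound n" using optimum_le_time_bound elim by blast
    then have "c2 * optimum n \<le> c2 * time_bound n" using c by (intro mult_left_mono) auto
    then have 3: "real (a n) \<le> c2 * time_bound n" using elim by linarith
    have 4: "real (ops (run n (a n))) \<le> 200 * real (a n) + 60 * (real n / sqrt (real (a n)))"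
      using elim by (intro ops_run_upper) auto
    have "1 \<le> time_bound n"
      using elim le by (meson order_trans one_le_exp_iff zero_le_one)
    moreover have "real (alg_time sieve_time n (a n)) = real (sieve_time (a n)) + real (ops (run n (a n))) + 2"
      by (simp add: alg_time_def)
    moreover have "(t2 * c2 + 200 * c2 + 60 / sqrt c1 + 2) * time_bound n
      = t2 * c2 * time_bound n + 200 * (c2 * time_bound n) + 60 * (1 / sqrt c1 * time_bound n) + 2 * time_bound n"
      by (simp add: distrib_right)
    ultimately show ?case using 1 2 3 4 by linarith
  qed
  obtain K where K: "\<And>k. k \<ge> K \<Longrightarrow> t1 * (real k * ln (ln (real k))) \<le> real (sieve_time k)"
    using time_k unfolding eventually_sequentially by blast
  have lower: "\<forall>\<^sub>F n in sequentially. \<forall>k>0. min (t1 / 2) (1 / 16) * time_bound n \<le> real (alg_time sieve_time n k)"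
    by (rule alg_time_lower[OF _ t(1)]) (rule K)
  let ?c = "min (t1 / 2) (1 / 16)" and ?C = "t2 * c2 + 200 * c2 + 60 / sqrt c1 + 2"
  have c_pos: "0 < ?c" using t by simp
  have T0: "0 \<le> time_bound n" "0 \<le> space_bound n" for n by (simp_all add: time_bound_def space_bound_def)
  have big_time: "(\<lambda>n. real (alg_time sieve_time n (a' n))) \<in> \<Omega>(time_bound)" if "\<forall>n. 0 < a' n" for a'
    by (rule landau_omega.bigI[OF c_pos]) (use lower in eventually_elim, use that T0 in simp)
  have upper_O: "(\<lambda>n. real (alg_time sieve_time n (a n))) \<in> O(time_bound)"
    by (rule bigoI[of _ ?C]) (use upper in eventually_elim, use T0 in simp)
  have "(\<lambda>n. real (alg_time sieve_time n (a n))) \<in> \<Theta>(time_bound)"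
    using upper_O big_time[of a] a_pos by (intro bigthetaI) auto
  moreover have "(\<lambda>n. real (alg_time sieve_time n (a' n))) \<in> \<Omega>(\<lambda>n. real (alg_time sieve_time n (a n)))"
    if "\<forall>n. 0 < a' n" for a'
    using big_time[OF that] upper_O by (meson bigomega_iff_bigo landau_omega.big_trans)
  moreover have "(\<lambda>n. real (alg_space sieve_space n (a n))) \<in> \<Theta>(space_bound)"
  proof (rule bigthetaI)
    have "\<forall>\<^sub>F n in sequentially. 22 + n div a n \<le> peak (run n (a n)) \<and> peak (run n (a n)) \<le> 22 + 2 * (n div a n)"
      using basic
    proof eventually_elim
      case (elim n)
      then obtain r s\<^sub>0 where "alg_run n (a n) (n div a n) r s\<^sub>0" using alg_run_exists[of n "a n"] by blast
      from alg_run.run_result[OF this] elim a_pos show ?case by (simp add: div_greater_zero_iff)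
    qed
    then have peak: "\<forall>\<^sub>F n in sequentially. space_bound n / c2 \<le> real (peak (run n (a n)))
        \<and> real (peak (run n (a n))) \<le> 22 + 2 * (space_bound n / c1)"
      using basic
    proof eventually_elim
      case (elim n)
      have ids: "real n / optimum n = space_bound n" using optimum_identities[of n] elim by simp
      have "space_bound n / c2 = real n / (c2 * optimum n)" by (simp add: ids[symmetric])
      also have "\<dots> \<le> real n / real (a n)" using elim c a_pos by (intro divide_left_mono) auto
      also have "\<dots> \<le> real (n div a n) + 1"
        using dividend_less_times_div[of "a n" n] a_pos[of n]
        by (simp add: field_simps) (metis less_imp_le of_nat_add of_nat_le_iff of_nat_mult)
      also have "\<dots> \<le> real (22 + n div a n)" by simp
      also have "\<dots> \<le> real (peak (run n (a n)))" using elim by (simp only: of_nat_le_iff)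
      finally have 1: "space_bound n / c2 \<le> real (peak (run n (a n)))" .
      have "real (n div a n) \<le> real n / real (a n)" by (rule of_nat_div_le_of_nat)
      also have "\<dots> \<le> real n / (c1 * optimum n)" using elim c a_pos by (intro divide_left_mono) auto
      also have "\<dots> = space_bound n / c1" by (simp add: ids[symmetric])
      finally have "real (22 + 2 * (n div a n)) \<le> 22 + 2 * (space_bound n / c1)" by simp
      moreover have "real (peak (run n (a n))) \<le> real (22 + 2 * (n div a n))" using elim by (simp only: of_nat_le_iff)
      ultimately show ?case using 1 by simp
    qed
    \<comment> \<open>The sieve space is bounded from above only, so the lower bound comes from
      \<open>peak\<close>, that is, from the \<open>b\<close> cells of \<open>M'\<close>.\<close>
    show "(\<lambda>n. real (alg_space sieve_space n (a n))) \<in> \<Omega>(space_bound)"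
      by (rule landau_omega.bigI[of "1 / c2"]) (use c in simp, use peak in eventually_elim, use T0 c in \<open>simp add: alg_space_def\<close>)
    \<comment> \<open>The three summands belong to the sieve, to the 22 scalars, and to the at most
      \<open>2 * b\<close> array cells.\<close>
    have space_upper: "\<forall>\<^sub>F n in sequentially. real (alg_space sieve_space n (a n)) \<le> (s2 * sqrt c2 + 1 + 2 / c1) * space_bound n"
      using basic space_a peak eventually_space_bound
    proof eventually_elim
      case (elim n)
      have ids: "sqrt (optimum n) * ln (ln (real n)) = space_bound n" using optimum_identities[of n] elim by simp
      have "sqrt (real (a n)) * ln (ln (real (a n))) \<le> sqrt (c2 * optimum n) * ln (ln (real n))"
        using elim by (intro mult_mono) auto
      also have "\<dots> = sqrt c2 * space_bound n" by (simp add: ids[symmetric] real_sqrt_mult)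
      finally have "s2 * (sqrt (real (a n)) * ln (ln (real (a n)))) \<le> s2 * (sqrt c2 * space_bound n)"
        using s by (intro mult_left_mono) auto
      then have "real (sieve_space (a n)) \<le> s2 * (sqrt c2 * space_bound n)" using elim by linarith
      then show ?case using elim unfolding alg_space_def by (simp add: algebra_simps)
    qed
    show "(\<lambda>n. real (alg_space sieve_space n (a n))) \<in> O(space_bound)"
      by (rule bigoI[of _ "s2 * sqrt c2 + 1 + 2 / c1"]) (use space_upper in eventually_elim, use T0 in simp)
  qed
  ultimately show ?thesis
    using part2 correct root_less unfolding time_bound_def[abs_def] space_bound_def[abs_def] by blast
qed

end
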